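(* Let $(R,\mathfrak{m})$ be a local integral domain with $\operatorname{depth}R>1$, and let $M:=\mathfrak{m}$. Then there is no torsionless $R$-module $U\neq0$ such that $$\operatorname{depth}(M\otimes_R U)=\operatorname{depth}(N\otimes_R U)$$ for every nonzero finitely generated $R$-module $N$ with $\operatorname{depth}M\le\operatorname{depth}N$.
   Context: All rings are commutative and noetherian. An $R$-module $U$ is torsionless if the natural map $U\to U^{**}$ is injective, where $(-)^*=\operatorname{Hom}_R(-,R)$. Depth is taken with respect to $\mathfrak{m}$: $\operatorname{depth}(X)=\inf\{i: H^i_{\mathfrak{m}}(X)\ne0\}$. *)

theory Defs
  imports "HOL-Algebra.Module" "HOL-Algebra.Ideal_Product" "HOL-Algebra.Ring_Divisibility" "HOL-Library.Extended_Nat"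
begin

section \<open>Local rings and modules\<close>

definition local_ring :: "('a, 'r) ring_scheme \<Rightarrow> 'a set \<Rightarrow> bool" where
  "local_ring R \<mm> \<longleftrightarrow> cring R \<and> maximalideal \<mm> R \<and> (\<forall>I. maximalideal I R \<longrightarrow> I = \<mm>)"

text \<open>A module record extends a ring record; its multiplicative fields play no role
  and are left undefined below.\<close>

definition self_module :: "('a, 'r) ring_scheme \<Rightarrow> ('a, 'a) module" where
  "self_module R = \<lparr>carrier = carrier R, monoid.mult = undefined, one = undefined,
     zero = \<zero>\<^bsub>R\<^esub>, add = add R, smult = monoid.mult R\<rparr>"

definition ideal_module :: "('a, 'r) ring_scheme \<Rightarrow> 'a set \<Rightarrow> ('a, 'a) module" where
  "ideal_module R I = (self_module R)\<lparr>carrier := I\<rparr>"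

definition nonzero_module :: "('a, 'm) module \<Rightarrow> bool" where
  "nonzero_module M \<longleftrightarrow> carrier M \<noteq> {\<zero>\<^bsub>M\<^esub>}"

definition submodule_span ::
    "('a, 'r) ring_scheme \<Rightarrow> ('a, 'm) module \<Rightarrow> 'm set \<Rightarrow> 'm set" where
  "submodule_span R M S = \<Inter>{H. submodule H R M \<and> S \<subseteq> H}"

definition fin_gen_module :: "('a, 'r) ring_scheme \<Rightarrow> ('a, 'm) module \<Rightarrow> bool" where
  "fin_gen_module R M \<longleftrightarrow>
     module R M \<and> (\<exists>S \<subseteq> carrier M. finite S \<and> submodule_span R M S = carrier M)"

definition quot_module ::
    "('a, 'r) ring_scheme \<Rightarrow> ('a, 'm) module \<Rightarrow> 'm set \<Rightarrow> ('a, 'm set) module" where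
  "quot_module R M K = \<lparr>carrier = A_RCOSETS M K, monoid.mult = undefined, one = undefined,
     zero = K, add = set_add M, smult = (\<lambda>a C. \<Union>x\<in>C. K +>\<^bsub>M\<^esub> (a \<odot>\<^bsub>M\<^esub> x))\<rparr>"

definition module_hom ::
    "('a, 'r) ring_scheme \<Rightarrow> ('a, 'm) module \<Rightarrow> ('a, 'n) module \<Rightarrow> ('m \<Rightarrow> 'n) set" where
  "module_hom R M N = {f \<in> carrier M \<rightarrow> carrier N.
     (\<forall>x\<in>carrier M. \<forall>y\<in>carrier M. f (x \<oplus>\<^bsub>M\<^esub> y) = f x \<oplus>\<^bsub>N\<^esub> f y) \<and>
     (\<forall>a\<in>carrier R. \<forall>x\<in>carrier M. f (a \<odot>\<^bsub>M\<^esub> x) = a \<odot>\<^bsub>N\<^esub> f x)}"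


section \<open>Torsionless modules\<close>

text \<open>Homomorphisms are normalised to be undefined off the carrier, so that equality of
  elements of Hom is equality of maps on the carrier.\<close>

definition Hom_module ::
    "('a, 'r) ring_scheme \<Rightarrow> ('a, 'm) module \<Rightarrow> ('a, 'n) module \<Rightarrow> ('a, 'm \<Rightarrow> 'n) module" where
  "Hom_module R M N = \<lparr>carrier = module_hom R M N \<inter> extensional (carrier M),
     monoid.mult = undefined, one = undefined,
     zero = (\<lambda>x\<in>carrier M. \<zero>\<^bsub>N\<^esub>),
     add = (\<lambda>f g. \<lambda>x\<in>carrier M. f x \<oplus>\<^bsub>N\<^esub> g x),
     smult = (\<lambda>a f. \<lambda>x\<in>carrier M. a \<odot>\<^bsub>N\<^esub> f x)\<rparr>"

definition dual_module ::
    "('a, 'r) ring_scheme \<Rightarrow> ('a, 'm) module \<Rightarrow> ('a, 'm \<Rightarrow> 'a) module" where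
  "dual_module R U = Hom_module R U (self_module R)"

definition bidual_map ::
    "('a, 'r) ring_scheme \<Rightarrow> ('a, 'm) module \<Rightarrow> 'm \<Rightarrow> (('m \<Rightarrow> 'a) \<Rightarrow> 'a)" where
  "bidual_map R U u = (\<lambda>f\<in>carrier (dual_module R U). f u)"

definition torsionless :: "('a, 'r) ring_scheme \<Rightarrow> ('a, 'm) module \<Rightarrow> bool" where
  "torsionless R U \<longleftrightarrow> inj_on (bidual_map R U) (carrier U)"


section \<open>Tensor products\<close>

definition free_module :: "('a, 'r) ring_scheme \<Rightarrow> 's set \<Rightarrow> ('a, 's \<Rightarrow> 'a) module" where
  "free_module R S = \<lparr>carrier = {f. (\<forall>s\<in>S. f s \<in> carrier R) \<and> (\<forall>s. s \<notin> S \<longrightarrow> f s = \<zero>\<^bsub>R\<^esub>) \<and>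
       finite {s. f s \<noteq> \<zero>\<^bsub>R\<^esub>}},
     monoid.mult = undefined, one = undefined,
     zero = (\<lambda>s. \<zero>\<^bsub>R\<^esub>),
     add = (\<lambda>f g s. f s \<oplus>\<^bsub>R\<^esub> g s),
     smult = (\<lambda>a f s. a \<otimes>\<^bsub>R\<^esub> f s)\<rparr>"

definition free_basis :: "('a, 'r) ring_scheme \<Rightarrow> 's \<Rightarrow> 's \<Rightarrow> 'a" where
  "free_basis R s = (\<lambda>t. if t = s then \<one>\<^bsub>R\<^esub> else \<zero>\<^bsub>R\<^esub>)"

definition tensor_relations ::
    "('a, 'r) ring_scheme \<Rightarrow> ('a, 'm) module \<Rightarrow> ('a, 'n) module \<Rightarrow> ('m \<times> 'n \<Rightarrow> 'a) set" where
  "tensor_relations R M N =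
    (let F = free_module R (carrier M \<times> carrier N); e = free_basis R in
      {e (x \<oplus>\<^bsub>M\<^esub> x', y) \<ominus>\<^bsub>F\<^esub> (e (x, y) \<oplus>\<^bsub>F\<^esub> e (x', y)) | x x' y.
         x \<in> carrier M \<and> x' \<in> carrier M \<and> y \<in> carrier N}
    \<union> {e (x, y \<oplus>\<^bsub>N\<^esub> y') \<ominus>\<^bsub>F\<^esub> (e (x, y) \<oplus>\<^bsub>F\<^esub> e (x, y')) | x y y'.
         x \<in> carrier M \<and> y \<in> carrier N \<and> y' \<in> carrier N}
    \<union> {e (a \<odot>\<^bsub>M\<^esub> x, y) \<ominus>\<^bsub>F\<^esub> (a \<odot>\<^bsub>F\<^esub> e (x, y)) | a x y.
         a \<in> carrier R \<and> x \<in> carrier M \<and> y \<in> carrier N}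
    \<union> {e (x, a \<odot>\<^bsub>N\<^esub> y) \<ominus>\<^bsub>F\<^esub> (a \<odot>\<^bsub>F\<^esub> e (x, y)) | a x y.
         a \<in> carrier R \<and> x \<in> carrier M \<and> y \<in> carrier N})"

definition tensor_module ::
    "('a, 'r) ring_scheme \<Rightarrow> ('a, 'm) module \<Rightarrow> ('a, 'n) module
      \<Rightarrow> ('a, ('m \<times> 'n \<Rightarrow> 'a) set) module" where
  "tensor_module R M N =
    (let F = free_module R (carrier M \<times> carrier N)
     in quot_module R F (submodule_span R F (tensor_relations R M N)))"


section \<open>Local cohomology and depth\<close>

text \<open>The lifting property is tested on all modules \<open>B\<close> whose elements have the same type
  as those of \<open>E\<close>. As soon as the ring itself injects into that type, this includes all
  ideals up to isomorphism, so by Baer's criterion it is injectivity in the unrestricted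
  sense.\<close>

definition injective_module :: "('a, 'r) ring_scheme \<Rightarrow> ('a, 'e) module \<Rightarrow> bool" where
  "injective_module R E \<longleftrightarrow> module R E \<and>
     (\<forall>(B :: ('a, 'e) module) A. module R B \<and> submodule A R B \<longrightarrow>
       (\<forall>f\<in>module_hom R (B\<lparr>carrier := A\<rparr>) E. \<exists>g\<in>module_hom R B E. \<forall>x\<in>A. g x = f x))"

definition is_injective_resolution ::
    "('a, 'r) ring_scheme \<Rightarrow> ('a, 'm) module \<Rightarrow> ('m \<Rightarrow> 'e)
      \<Rightarrow> (nat \<Rightarrow> ('a, 'e) module) \<Rightarrow> (nat \<Rightarrow> 'e \<Rightarrow> 'e) \<Rightarrow> bool" where
  "is_injective_resolution R X \<epsilon> E d \<longleftrightarrow>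
     (\<forall>i. injective_module R (E i)) \<and>
     \<epsilon> \<in> module_hom R X (E 0) \<and>
     (\<forall>i. d i \<in> module_hom R (E i) (E (Suc i))) \<and>
     inj_on \<epsilon> (carrier X) \<and>
     \<epsilon> ` carrier X = {e \<in> carrier (E 0). d 0 e = \<zero>\<^bsub>E 1\<^esub>} \<and>
     (\<forall>i. d i ` carrier (E i) =
       {e \<in> carrier (E (Suc i)). d (Suc i) e = \<zero>\<^bsub>E (Suc (Suc i))\<^esub>})"

text \<open>The terms of a resolution must have a common type. The type \<open>nat \<Rightarrow> 'a + 'm\<close> is infinite
  and at least as large as \<open>R\<close> and \<open>X\<close>. Over a noetherian ring, every module of cardinality at
  most such a \<open>\<kappa>\<close> embeds in an injective module of cardinality at most \<open>\<kappa>\<close>: ideals are finitely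
  generated, so inside any injective overmodule it suffices to adjoin, countably often,
  solutions of the at most \<open>\<kappa>\<close> extension problems from ideals. Cokernels again have cardinality
  at most \<open>\<kappa>\<close>, hence every \<open>X\<close> has an injective resolution of this type.\<close>

definition injective_resolution ::
    "('a, 'r) ring_scheme \<Rightarrow> ('a, 'm) module \<Rightarrow>
      (nat \<Rightarrow> ('a, nat \<Rightarrow> 'a + 'm) module) \<times> (nat \<Rightarrow> (nat \<Rightarrow> 'a + 'm) \<Rightarrow> (nat \<Rightarrow> 'a + 'm))" where
  "injective_resolution R X =
     (SOME (E, d). \<exists>\<epsilon>. is_injective_resolution R X \<epsilon> E d)"

definition torsion_part ::
    "('a, 'r) ring_scheme \<Rightarrow> 'a set \<Rightarrow> ('a, 'm) module \<Rightarrow> 'm set" where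
  "torsion_part R \<mm> X =
     {x \<in> carrier X. \<exists>n::nat. \<forall>a \<in> \<mm> [^]\<^bsub>ideals_set R\<^esub> n. a \<odot>\<^bsub>X\<^esub> x = \<zero>\<^bsub>X\<^esub>}"

text \<open>\<open>H\<^sup>i\<close> is the \<open>i\<close>-th right derived functor of the torsion functor: the cohomology in
  degree \<open>i\<close> of the torsion parts of an injective resolution.\<close>

definition local_cohomology ::
    "('a, 'r) ring_scheme \<Rightarrow> 'a set \<Rightarrow> ('a, 'm) module \<Rightarrow> nat
      \<Rightarrow> ('a, (nat \<Rightarrow> 'a + 'm) set) module" where
  "local_cohomology R \<mm> X i =
    (let (E, d) = injective_resolution R X;
         Z = {z \<in> torsion_part R \<mm> (E i). d i z = \<zero>\<^bsub>E (Suc i)\<^esub>};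
         B = (case i of 0 \<Rightarrow> {\<zero>\<^bsub>E i\<^esub>} | Suc j \<Rightarrow> d j ` torsion_part R \<mm> (E j))
     in quot_module R ((E i)\<lparr>carrier := Z\<rparr>) B)"

text \<open>The infimum is taken in the extended naturals, so it is \<open>\<infinity>\<close> if all \<open>H\<^sup>i\<close> vanish.\<close>

definition depth :: "('a, 'r) ring_scheme \<Rightarrow> 'a set \<Rightarrow> ('a, 'm) module \<Rightarrow> enat" where
  "depth R \<mm> X = Inf {enat i | i. nonzero_module (local_cohomology R \<mm> X i)}"


text \<open>Every finitely generated module is isomorphic to some \<open>R\<^sup>n / K\<close>, whose elements are cosets
  of finite sequences; so the following type contains a copy of each of them.\<close>

type_synonym 'a fg_module = "('a, (nat \<Rightarrow> 'a) set) module"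

end

theory Submission
  imports Defs "HOL-Algebra.IntRing" Complex_Main
begin

text \<open>Write \<open>d\<close> for the depth of \<open>\<mm> \<otimes> U\<close>. The only test modules needed are the cyclic modules
  \<open>N = R/yR\<close> with \<open>y \<in> \<mm>\<close>, including \<open>N = R\<close> for \<open>y = 0\<close>. Since \<open>R\<close> is a domain of depth at
  least two, such a module has depth at least one, whereas the depth of \<open>\<mm>\<close> is at most one; so
  each of them is admissible, and if \<open>U\<close> had the stated property, then \<open>U/yU = N \<otimes> U\<close> would have
  depth \<open>d\<close> for every \<open>y \<in> \<mm>\<close>, in particular \<open>U\<close> itself.

  The argument needs no more of local cohomology than the following description
  (\<open>depth_ge_1_iff\<close>, \<open>depth_ge_2_iff\<close>): the depth of \<open>X\<close> is at least one iff no nonzero element of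
  \<open>X\<close> is killed by \<open>\<mm>\<close>, and it is at least two iff in addition every homomorphism \<open>\<mm> \<rightarrow> X\<close> is
  multiplication by an element of \<open>X\<close>, that is, \<open>Hom(R/\<mm>, X)\<close> and \<open>Ext\<^sup>1(R/\<mm>, X)\<close> vanish.

  Upper bound \<open>d \<le> 1\<close> (\<open>depth_tensor_maximal_ideal\<close>). As \<open>U\<close> is torsionless and nonzero, there is
  a nonzero \<open>f : U \<rightarrow> R\<close>. By Nakayama, the ideal \<open>f(U)\<close> has a proper subideal \<open>L\<close> that contains
  \<open>\<mm> f(U)\<close>; choose \<open>u\<close> with \<open>f u \<notin> L\<close>. The homomorphism \<open>a \<mapsto> a \<otimes> u\<close> from \<open>\<mm>\<close> to \<open>\<mm> \<otimes> U\<close> is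
  not multiplication by an element \<open>t\<close>: applying the map \<open>a \<otimes> v \<mapsto> a f(v)\<close>, which has values in
  \<open>L\<close>, and cancelling a nonzero \<open>a \<in> \<mm>\<close>, one would find \<open>f u \<in> L\<close>.

  Lower bound \<open>d \<ge> 2\<close> (\<open>no_equidepth_torsionless_module\<close>). A torsionless module over a domain is
  torsion-free, so \<open>d\<close>, being the depth of \<open>U\<close>, is at least one. Fix \<open>0 \<noteq> y \<in> \<mm>\<close>; then \<open>U/yU\<close>,
  whose depth is also \<open>d\<close>, has no nonzero element killed by \<open>\<mm>\<close>. A homomorphism \<open>\<psi> : \<mm> \<rightarrow> U\<close>
  satisfies \<open>a \<psi>(y) = y \<psi>(a)\<close>, so the class of \<open>\<psi>(y)\<close> in \<open>U/yU\<close> is killed by \<open>\<mm>\<close>. Hence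
  \<open>\<psi>(y) = y v\<close> for some \<open>v\<close>, and cancelling \<open>y\<close> shows that \<open>\<psi>\<close> is multiplication by \<open>v\<close>. So the
  depth of \<open>U\<close> is at least two, a contradiction.

  Depth is defined through a chosen injective resolution whose terms have elements in the type
  \<open>nat \<Rightarrow> 'a + 'm\<close>, so the description of depth presupposes that every module has such a
  resolution. By \<open>embeds_in_injective\<close>, every module \<open>X\<close> that injects into this type embeds in an
  injective module over it: \<open>X\<close> embeds in a product of copies of \<open>Hom\<^sub>\<int>(R, S\<^sup>1)\<close>, where \<open>S\<^sup>1\<close> is the
  circle group, this product satisfies Baer's criterion, and since \<open>R\<close> is noetherian the criterion
  is inherited by the closure of \<open>X\<close> under a chosen solution for each solvable sequence of linear
  equations, iterated countably often. That closure is an image of the type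
  \<open>nat \<Rightarrow> 'a + 'm\<close>, because sequences in this type can be coded by its elements.\<close>

section \<open>Module homomorphisms\<close>

lemma module_homI:
  assumes "\<And>x. x \<in> carrier M \<Longrightarrow> f x \<in> carrier N"
    and "\<And>x y. x \<in> carrier M \<Longrightarrow> y \<in> carrier M \<Longrightarrow> f (x \<oplus>\<^bsub>M\<^esub> y) = f x \<oplus>\<^bsub>N\<^esub> f y"
    and "\<And>a x. a \<in> carrier R \<Longrightarrow> x \<in> carrier M \<Longrightarrow> f (a \<odot>\<^bsub>M\<^esub> x) = a \<odot>\<^bsub>N\<^esub> f x"
  shows "f \<in> module_hom R M N"
  using assms by (auto simp: module_hom_def)

lemma module_homD:
  assumes "f \<in> module_hom R M N"
  shows "x \<in> carrier M \<Longrightarrow> f x \<in> carrier N"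
    and "x \<in> carrier M \<Longrightarrow> y \<in> carrier M \<Longrightarrow> f (x \<oplus>\<^bsub>M\<^esub> y) = f x \<oplus>\<^bsub>N\<^esub> f y"
    and "a \<in> carrier R \<Longrightarrow> x \<in> carrier M \<Longrightarrow> f (a \<odot>\<^bsub>M\<^esub> x) = a \<odot>\<^bsub>N\<^esub> f x"
  using assms by (auto simp: module_hom_def)

lemma module_hom_zero:
  assumes "module R M" "module R N" "f \<in> module_hom R M N"
  shows "f \<zero>\<^bsub>M\<^esub> = \<zero>\<^bsub>N\<^esub>"
proof -
  interpret M: module R M by fact
  interpret N: module R N by fact
  have "f (\<zero>\<^bsub>R\<^esub> \<odot>\<^bsub>M\<^esub> \<zero>\<^bsub>M\<^esub>) = \<zero>\<^bsub>R\<^esub> \<odot>\<^bsub>N\<^esub> f \<zero>\<^bsub>M\<^esub>"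
    by (rule module_homD[OF assms(3)]) auto
  then show ?thesis
    using module_homD(1)[OF assms(3)] by simp
qed

lemma module_hom_minus:
  assumes "module R M" "module R N" "f \<in> module_hom R M N" "x \<in> carrier M"
  shows "f (\<ominus>\<^bsub>M\<^esub> x) = \<ominus>\<^bsub>N\<^esub> f x"
proof -
  interpret M: module R M by fact
  interpret N: module R N by fact
  have "f ((\<ominus>\<^bsub>R\<^esub> \<one>\<^bsub>R\<^esub>) \<odot>\<^bsub>M\<^esub> x) = (\<ominus>\<^bsub>R\<^esub> \<one>\<^bsub>R\<^esub>) \<odot>\<^bsub>N\<^esub> f x"
    using assms by (intro module_homD[OF assms(3)]) auto
  then show ?thesis
    using module_homD(1)[OF assms(3)] assms
    by (simp add: M.smult_l_minus N.smult_l_minus)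
qed

lemma module_hom_comp:
  assumes "f \<in> module_hom R M N" "g \<in> module_hom R N P"
  shows "g \<circ> f \<in> module_hom R M P"
  using assms by (auto simp: module_hom_def Pi_iff)

lemma module_hom_inj_iff:
  assumes "module R M" "module R N" "f \<in> module_hom R M N"
  shows "inj_on f (carrier M) \<longleftrightarrow> (\<forall>x\<in>carrier M. f x = \<zero>\<^bsub>N\<^esub> \<longrightarrow> x = \<zero>\<^bsub>M\<^esub>)"
proof -
  interpret M: module R M by fact
  interpret N: module R N by fact
  note f = module_homD[OF assms(3)]
  show ?thesis
  proof
    assume "inj_on f (carrier M)"
    then show "\<forall>x\<in>carrier M. f x = \<zero>\<^bsub>N\<^esub> \<longrightarrow> x = \<zero>\<^bsub>M\<^esub>"
      using module_hom_zero[OF assms] by (metis M.zero_closed inj_onD)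
  next
    assume *: "\<forall>x\<in>carrier M. f x = \<zero>\<^bsub>N\<^esub> \<longrightarrow> x = \<zero>\<^bsub>M\<^esub>"
    show "inj_on f (carrier M)"
    proof (rule inj_onI)
      fix x y assume xy: "x \<in> carrier M" "y \<in> carrier M" "f x = f y"
      have "f (x \<oplus>\<^bsub>M\<^esub> \<ominus>\<^bsub>M\<^esub> y) = f x \<oplus>\<^bsub>N\<^esub> \<ominus>\<^bsub>N\<^esub> f y"
        using xy by (simp add: f module_hom_minus[OF assms])
      then have "f (x \<oplus>\<^bsub>M\<^esub> \<ominus>\<^bsub>M\<^esub> y) = \<zero>\<^bsub>N\<^esub>"
        using xy f(1)[of y] by (simp add: N.r_neg)
      then have "x \<oplus>\<^bsub>M\<^esub> \<ominus>\<^bsub>M\<^esub> y = \<zero>\<^bsub>M\<^esub>"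
        using * xy by simp
      then show "x = y"
        using xy by (metis M.minus_equality M.minus_minus M.a_comm M.a_inv_closed)
    qed
  qed
qed

lemma self_module_simps [simp]:
  "carrier (self_module R) = carrier R" "\<zero>\<^bsub>self_module R\<^esub> = \<zero>\<^bsub>R\<^esub>"
  "x \<oplus>\<^bsub>self_module R\<^esub> y = x \<oplus>\<^bsub>R\<^esub> y" "a \<odot>\<^bsub>self_module R\<^esub> x = a \<otimes>\<^bsub>R\<^esub> x"
  by (simp_all add: self_module_def)

lemma ideal_module_simps [simp]:
  "carrier (ideal_module R I) = I" "\<zero>\<^bsub>ideal_module R I\<^esub> = \<zero>\<^bsub>R\<^esub>"
  "x \<oplus>\<^bsub>ideal_module R I\<^esub> y = x \<oplus>\<^bsub>R\<^esub> y" "a \<odot>\<^bsub>ideal_module R I\<^esub> x = a \<otimes>\<^bsub>R\<^esub> x"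
  by (simp_all add: ideal_module_def self_module_def)

lemma self_module_is_module:
  assumes "cring R"
  shows "module R (self_module R)"
proof -
  interpret cring R by fact
  show ?thesis
    by (rule moduleI[OF assms], rule abelian_groupI)
      (auto simp: a_ac m_ac l_distr r_distr intro: bexI[of _ "\<ominus>\<^bsub>R\<^esub> x" for x] l_neg)
qed

lemma ideal_module_is_module:
  assumes "cring R" "ideal I R"
  shows "module R (ideal_module R I)"
proof -
  interpret cring R by fact
  interpret I: ideal I R by fact
  have [simp]: "x \<in> carrier R" if "x \<in> I" for x using that I.a_subset by auto
  have "\<exists>y\<in>I. y \<oplus>\<^bsub>R\<^esub> x = \<zero>\<^bsub>R\<^esub>" if "x \<in> I" for x
    using that by (intro bexI[of _ "\<ominus>\<^bsub>R\<^esub> x"]) (auto simp: l_neg)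
  then show ?thesis
    by (intro moduleI[OF assms(1)] abelian_groupI)
      (auto simp: a_ac m_ac l_distr r_distr I.I_l_closed)
qed

section \<open>Baer's criterion\<close>

text \<open>Baer's condition: every homomorphism from an ideal to \<open>E\<close> is multiplication by an element of
  \<open>E\<close>. Unlike \<open>injective_module\<close> it does not refer to modules over the element type of \<open>E\<close>.\<close>

definition baer :: "('a, 'r) ring_scheme \<Rightarrow> ('a, 'e) module \<Rightarrow> bool" where
  "baer R E \<longleftrightarrow> (\<forall>I f. ideal I R \<and> f \<in> module_hom R (ideal_module R I) E \<longrightarrow>
     (\<exists>e\<in>carrier E. \<forall>a\<in>I. f a = a \<odot>\<^bsub>E\<^esub> e))"

text \<open>The graph of an \<open>R\<close>-linear map from some submodule of \<open>B\<close> to \<open>E\<close>. Single-valuedness is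
  required at zero only, which suffices by linearity.\<close>

definition linear_graph ::
    "('a, 'r) ring_scheme \<Rightarrow> ('a, 'm) module \<Rightarrow> ('a, 'e) module \<Rightarrow> ('m \<times> 'e) set \<Rightarrow> bool" where
  "linear_graph R B E G \<longleftrightarrow> G \<subseteq> carrier B \<times> carrier E \<and> (\<zero>\<^bsub>B\<^esub>, \<zero>\<^bsub>E\<^esub>) \<in> G \<and>
     (\<forall>x u y v. (x, u) \<in> G \<and> (y, v) \<in> G \<longrightarrow> (x \<oplus>\<^bsub>B\<^esub> y, u \<oplus>\<^bsub>E\<^esub> v) \<in> G) \<and>
     (\<forall>a\<in>carrier R. \<forall>x u. (x, u) \<in> G \<longrightarrow> (a \<odot>\<^bsub>B\<^esub> x, a \<odot>\<^bsub>E\<^esub> u) \<in> G) \<and>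
     (\<forall>u. (\<zero>\<^bsub>B\<^esub>, u) \<in> G \<longrightarrow> u = \<zero>\<^bsub>E\<^esub>)"

lemma linear_graph_unique:
  assumes B: "module R B" and E: "module R E" and G: "linear_graph R B E G"
    and xu: "(x, u) \<in> G" and xv: "(x, v) \<in> G"
  shows "u = v"
proof -
  interpret B: module R B by fact
  interpret E: module R E by fact
  have c: "x \<in> carrier B" "u \<in> carrier E" "v \<in> carrier E"
    using G xu xv by (auto simp: linear_graph_def)
  have "(\<ominus>\<^bsub>R\<^esub> \<one>\<^bsub>R\<^esub> \<odot>\<^bsub>B\<^esub> x, \<ominus>\<^bsub>R\<^esub> \<one>\<^bsub>R\<^esub> \<odot>\<^bsub>E\<^esub> v) \<in> G"
    using G xv by (auto simp: linear_graph_def)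
  then have "(x \<oplus>\<^bsub>B\<^esub> (\<ominus>\<^bsub>R\<^esub> \<one>\<^bsub>R\<^esub> \<odot>\<^bsub>B\<^esub> x), u \<oplus>\<^bsub>E\<^esub> (\<ominus>\<^bsub>R\<^esub> \<one>\<^bsub>R\<^esub> \<odot>\<^bsub>E\<^esub> v)) \<in> G"
    using G xu unfolding linear_graph_def by blast
  then have "(\<zero>\<^bsub>B\<^esub>, u \<oplus>\<^bsub>E\<^esub> \<ominus>\<^bsub>E\<^esub> v) \<in> G"
    using c by (simp add: B.smult_l_minus E.smult_l_minus B.r_neg)
  then have "u \<oplus>\<^bsub>E\<^esub> \<ominus>\<^bsub>E\<^esub> v = \<zero>\<^bsub>E\<^esub>"
    using G by (auto simp: linear_graph_def)
  then show ?thesis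
    using c by (metis E.minus_equality E.minus_minus E.a_comm E.a_inv_closed)
qed

text \<open>The step in Baer's argument: if \<open>I\<close> is the ideal of those \<open>a\<close> for which \<open>a b\<close> lies in the domain
  and \<open>e\<close> extends the resulting map \<open>I \<rightarrow> E\<close>, then \<open>b \<mapsto> e\<close> is a consistent prescription.\<close>

lemma linear_graph_enlarge:
  fixes R (structure)
  assumes B: "module R B" and E: "module R E" and baer: "baer R E"
    and G: "linear_graph R B E G" and b: "b \<in> carrier B"
  obtains G' where "linear_graph R B E G'" "G \<subseteq> G'" "b \<in> fst ` G'"
proof -
  interpret B: module R B by fact
  interpret E: module R E by fact
  note uniq = linear_graph_unique[OF B E G]
  have Gc: "x \<in> carrier B" "u \<in> carrier E" if "(x, u) \<in> G" for x u
    using G that by (auto simp: linear_graph_def)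
  have Gadd: "(x \<oplus>\<^bsub>B\<^esub> y, u \<oplus>\<^bsub>E\<^esub> v) \<in> G" if "(x, u) \<in> G" "(y, v) \<in> G" for x u y v
    using G that unfolding linear_graph_def by blast
  have Gsm: "(a \<odot>\<^bsub>B\<^esub> x, a \<odot>\<^bsub>E\<^esub> u) \<in> G" if "(x, u) \<in> G" "a \<in> carrier R" for a x u
    using G that unfolding linear_graph_def by blast
  have G0: "(\<zero>\<^bsub>B\<^esub>, \<zero>\<^bsub>E\<^esub>) \<in> G" using G unfolding linear_graph_def by blast
  define I where "I = {a \<in> carrier R. a \<odot>\<^bsub>B\<^esub> b \<in> fst ` G}"
  define f where "f a = (THE u. (a \<odot>\<^bsub>B\<^esub> b, u) \<in> G)" for a
  have f: "(a \<odot>\<^bsub>B\<^esub> b, f a) \<in> G" if aI: "a \<in> I" for a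
  proof -
    obtain u where u: "(a \<odot>\<^bsub>B\<^esub> b, u) \<in> G" using aI unfolding I_def by force
    show ?thesis unfolding f_def by (rule theI[of _ u]) (use u uniq in auto)
  qed
  have fI: "a \<in> I \<and> f a = u" if "(a \<odot>\<^bsub>B\<^esub> b, u) \<in> G" "a \<in> carrier R" for a u
  proof
    show "a \<in> I" using that unfolding I_def by force
    from f[OF this] that uniq show "f a = u" by blast
  qed
  have Ic: "a \<in> carrier R" if "a \<in> I" for a using that by (simp add: I_def)
  have Iadd: "a \<oplus> c \<in> I \<and> f (a \<oplus> c) = f a \<oplus>\<^bsub>E\<^esub> f c" if "a \<in> I" "c \<in> I" for a c
    using fI[of "a \<oplus> c"] Gadd[OF f[OF that(1)] f[OF that(2)]] Ic that b
    by (simp add: B.smult_l_distr)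
  have Ism: "c \<otimes> a \<in> I \<and> f (c \<otimes> a) = c \<odot>\<^bsub>E\<^esub> f a" if "a \<in> I" "c \<in> carrier R" for a c
    using fI[of "c \<otimes> a"] Gsm[OF f[OF that(1)] that(2)] Ic that b
    by (simp add: B.smult_assoc1)
  have I: "ideal I R"
  proof (rule idealI)
    show "ring R" by (rule B.R.ring_axioms)
    show "subgroup I (add_monoid R)"
    proof (rule B.R.add.subgroupI)
      show "I \<subseteq> carrier R" by (auto simp: I_def)
      have "\<zero> \<in> I" using fI[of "\<zero>"] b G0 by simp
      then show "I \<noteq> {}" by auto
      show "\<ominus> a \<in> I" if "a \<in> I" for a
        using Ism[OF that, of "\<ominus> \<one>"] Ic[OF that] by (simp add: B.R.l_minus)
      show "a \<oplus> c \<in> I" if "a \<in> I" "c \<in> I" for a c using Iadd that by simp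
    qed
    show "x \<otimes> a \<in> I" if "a \<in> I" "x \<in> carrier R" for a x using Ism that by simp
    then show "a \<otimes> x \<in> I" if "a \<in> I" "x \<in> carrier R" for a x
      using that Ic by (simp add: B.R.m_comm)
  qed
  have "f \<in> module_hom R (ideal_module R I) E"
    using Iadd Ism Gc(2)[OF f] by (intro module_homI) auto
  with I baer obtain e where e: "e \<in> carrier E" "\<And>a. a \<in> I \<Longrightarrow> f a = a \<odot>\<^bsub>E\<^esub> e"
    unfolding baer_def by blast
  define G' where "G' = {(x \<oplus>\<^bsub>B\<^esub> a \<odot>\<^bsub>B\<^esub> b, u \<oplus>\<^bsub>E\<^esub> a \<odot>\<^bsub>E\<^esub> e) | x u a. (x, u) \<in> G \<and> a \<in> carrier R}"
  have G'I: "(y, v) \<in> G'" if "(x, u) \<in> G" "a \<in> carrier R"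
    "y = x \<oplus>\<^bsub>B\<^esub> a \<odot>\<^bsub>B\<^esub> b" "v = u \<oplus>\<^bsub>E\<^esub> a \<odot>\<^bsub>E\<^esub> e" for x u a y v
    using that unfolding G'_def by blast
  show ?thesis
  proof
    show "G \<subseteq> G'"
      using G'I[of _ _ "\<zero>"] Gc b e by auto
    then have G'0: "(\<zero>\<^bsub>B\<^esub>, \<zero>\<^bsub>E\<^esub>) \<in> G'" using G0 by blast
    have "(b, e) \<in> G'" using G'I[OF G0, of "\<one>"] b e by simp
    then show "b \<in> fst ` G'" by force
    have "G' \<subseteq> carrier B \<times> carrier E" using Gc b e unfolding G'_def by auto
    moreover have "(x \<oplus>\<^bsub>B\<^esub> y, u \<oplus>\<^bsub>E\<^esub> v) \<in> G'" if xu: "(x, u) \<in> G'" and yv: "(y, v) \<in> G'" for x u y v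
    proof -
      obtain x' u' a where 1: "(x', u') \<in> G" "a \<in> carrier R" "x = x' \<oplus>\<^bsub>B\<^esub> a \<odot>\<^bsub>B\<^esub> b" "u = u' \<oplus>\<^bsub>E\<^esub> a \<odot>\<^bsub>E\<^esub> e"
        using xu unfolding G'_def by blast
      obtain y' v' c where 2: "(y', v') \<in> G" "c \<in> carrier R" "y = y' \<oplus>\<^bsub>B\<^esub> c \<odot>\<^bsub>B\<^esub> b" "v = v' \<oplus>\<^bsub>E\<^esub> c \<odot>\<^bsub>E\<^esub> e"
        using yv unfolding G'_def by blast
      show ?thesis
        by (rule G'I[OF Gadd[OF 1(1) 2(1)], of "a \<oplus> c"])
          (use 1 2 Gc[OF 1(1)] Gc[OF 2(1)] b e in
            \<open>simp_all add: B.smult_l_distr E.smult_l_distr B.M.a_ac E.M.a_ac\<close>)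
    qed
    moreover have "(c \<odot>\<^bsub>B\<^esub> x, c \<odot>\<^bsub>E\<^esub> u) \<in> G'" if xu: "(x, u) \<in> G'" and c: "c \<in> carrier R" for x u c
    proof -
      obtain x' u' a where 1: "(x', u') \<in> G" "a \<in> carrier R" "x = x' \<oplus>\<^bsub>B\<^esub> a \<odot>\<^bsub>B\<^esub> b" "u = u' \<oplus>\<^bsub>E\<^esub> a \<odot>\<^bsub>E\<^esub> e"
        using xu unfolding G'_def by blast
      show ?thesis
        by (rule G'I[OF Gsm[OF 1(1) c], of "c \<otimes> a"])
          (use 1 c Gc[OF 1(1)] b e in
            \<open>simp_all add: B.smult_r_distr E.smult_r_distr B.smult_assoc1 E.smult_assoc1\<close>)
    qed
    moreover have "w = \<zero>\<^bsub>E\<^esub>" if zw: "(\<zero>\<^bsub>B\<^esub>, w) \<in> G'" for w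
    proof -
      obtain x u a where 1: "(x, u) \<in> G" "a \<in> carrier R" "\<zero>\<^bsub>B\<^esub> = x \<oplus>\<^bsub>B\<^esub> a \<odot>\<^bsub>B\<^esub> b" "w = u \<oplus>\<^bsub>E\<^esub> a \<odot>\<^bsub>E\<^esub> e"
        using zw unfolding G'_def by blast
      note c = Gc[OF 1(1)]
      have x: "x = \<ominus>\<^bsub>B\<^esub> (a \<odot>\<^bsub>B\<^esub> b)"
        using 1 c b by (metis B.minus_equality B.smult_closed)
      have "((\<ominus> \<one>) \<odot>\<^bsub>B\<^esub> x, (\<ominus> \<one>) \<odot>\<^bsub>E\<^esub> u) \<in> G"
        by (rule Gsm[OF 1(1)]) simp
      then have "(a \<odot>\<^bsub>B\<^esub> b, \<ominus>\<^bsub>E\<^esub> u) \<in> G"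
        using 1 c b x by (simp add: B.smult_l_minus E.smult_l_minus)
      from fI[OF this 1(2)] e(2)[of a] have "a \<odot>\<^bsub>E\<^esub> e = \<ominus>\<^bsub>E\<^esub> u" by simp
      then show ?thesis using 1 c by (simp add: E.r_neg)
    qed
    ultimately show "linear_graph R B E G'"
      using G'0 unfolding linear_graph_def by blast
  qed
qed

text \<open>Linear maps into a module that satisfies Baer's condition extend. The element types of \<open>B\<close> and
  \<open>E\<close> are unrelated, so the lemma applies to \<open>R\<close>-modules as well as to abelian groups, taken as
  \<open>\<Z>\<close>-modules with values in the circle.\<close>

lemma linear_graph_extends:
  assumes B: "module R B" and E: "module R E" and baer: "baer R E"
    and G: "linear_graph R B E G"
  obtains g where "g \<in> module_hom R B E" "\<And>x u. (x, u) \<in> G \<Longrightarrow> g x = u"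
proof -
  define A where "A = {H. linear_graph R B E H \<and> G \<subseteq> H}"
  have "\<exists>U\<in>A. \<forall>X\<in>C. X \<subseteq> U" if C: "C \<noteq> {}" "subset.chain A C" for C
  proof (intro bexI[of _ "\<Union>C"] ballI)
    have CA: "linear_graph R B E H" "G \<subseteq> H" if "H \<in> C" for H
      using C that by (auto simp: subset.chain_def A_def)
    have two: "\<exists>H\<in>C. p \<in> H \<and> q \<in> H" if "p \<in> \<Union>C" "q \<in> \<Union>C" for p q
      using C that unfolding subset_chain_def by blast
    have "linear_graph R B E (\<Union>C)"
      unfolding linear_graph_def
    proof (intro conjI allI impI ballI)
      show "\<Union>C \<subseteq> carrier B \<times> carrier E" using CA unfolding linear_graph_def by blast
      show "(\<zero>\<^bsub>B\<^esub>, \<zero>\<^bsub>E\<^esub>) \<in> \<Union>C" using CA C unfolding linear_graph_def by blast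
      fix x u y v assume "(x, u) \<in> \<Union>C \<and> (y, v) \<in> \<Union>C"
      then obtain H where "H \<in> C" "(x, u) \<in> H" "(y, v) \<in> H" using two by blast
      then show "(x \<oplus>\<^bsub>B\<^esub> y, u \<oplus>\<^bsub>E\<^esub> v) \<in> \<Union>C" using CA(1)[of H] unfolding linear_graph_def by blast
    next
      fix a x u assume "a \<in> carrier R" "(x, u) \<in> \<Union>C"
      then show "(a \<odot>\<^bsub>B\<^esub> x, a \<odot>\<^bsub>E\<^esub> u) \<in> \<Union>C" using CA unfolding linear_graph_def by blast
    next
      fix u assume "(\<zero>\<^bsub>B\<^esub>, u) \<in> \<Union>C"
      then show "u = \<zero>\<^bsub>E\<^esub>" using CA unfolding linear_graph_def by blast
    qed
    then show "\<Union>C \<in> A" using CA C unfolding A_def by blast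
  qed auto
  moreover have "A \<noteq> {}" using G by (auto simp: A_def)
  ultimately obtain H where H: "H \<in> A" "\<And>X. X \<in> A \<Longrightarrow> H \<subseteq> X \<Longrightarrow> X = H"
    using subset_Zorn[of A] by (metis empty_iff subset_empty equals0I)
  then have HG: "linear_graph R B E H" "G \<subseteq> H" by (auto simp: A_def)
  have dom: "\<exists>u. (b, u) \<in> H" if b: "b \<in> carrier B" for b
  proof -
    obtain H' where "linear_graph R B E H'" "H \<subseteq> H'" "b \<in> fst ` H'"
      using linear_graph_enlarge[OF B E baer HG(1) b] by metis
    with H(2)[of H'] HG show ?thesis by (force simp: A_def)
  qed
  define g where "g b = (SOME u. (b, u) \<in> H)" for b
  have g: "(b, g b) \<in> H" if "b \<in> carrier B" for b
    using someI_ex[OF dom[OF that]] by (simp add: g_def)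
  have eq: "g b = u" if "(b, u) \<in> H" for b u
  proof -
    have "b \<in> carrier B" using that HG(1) by (auto simp: linear_graph_def)
    then show ?thesis using linear_graph_unique[OF B E HG(1) g that] by simp
  qed
  have "g \<in> module_hom R B E"
  proof (rule module_homI)
    show "g x \<in> carrier E" if "x \<in> carrier B" for x
      using g[OF that] HG(1) by (auto simp: linear_graph_def)
    show "g (x \<oplus>\<^bsub>B\<^esub> y) = g x \<oplus>\<^bsub>E\<^esub> g y" if "x \<in> carrier B" "y \<in> carrier B" for x y
      using g[OF that(1)] g[OF that(2)] HG(1) by (intro eq) (auto simp: linear_graph_def)
    show "g (a \<odot>\<^bsub>B\<^esub> x) = a \<odot>\<^bsub>E\<^esub> g x" if "a \<in> carrier R" "x \<in> carrier B" for a x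
      using g[OF that(2)] that(1) HG(1) by (intro eq) (auto simp: linear_graph_def)
  qed
  with eq HG(2) show thesis by (intro that[of g]) auto
qed

lemma baer_imp_injective:
  fixes E :: "('a, 'e) module"
  assumes "module R E" "baer R E"
  shows "injective_module R E"
  unfolding injective_module_def
proof (intro conjI allI impI ballI)
  fix B :: "('a, 'e) module" and A f
  assume BA: "module R B \<and> submodule A R B" and f: "f \<in> module_hom R (B\<lparr>carrier := A\<rparr>) E"
  interpret B: module R B using BA by simp
  interpret E: module R E by fact
  have A: "A \<subseteq> carrier B" "\<zero>\<^bsub>B\<^esub> \<in> A" "\<And>x y. x \<in> A \<Longrightarrow> y \<in> A \<Longrightarrow> x \<oplus>\<^bsub>B\<^esub> y \<in> A"
    "\<And>a x. a \<in> carrier R \<Longrightarrow> x \<in> A \<Longrightarrow> a \<odot>\<^bsub>B\<^esub> x \<in> A"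
    using BA B.submoduleE[of A] subgroup.one_closed[of A "add_monoid B"]
    by (auto simp: submodule_def)
  have m: "module R (B\<lparr>carrier := A\<rparr>)"
    using BA submodule.submodule_is_module by blast
  have f0: "f \<zero>\<^bsub>B\<^esub> = \<zero>\<^bsub>E\<^esub>" using module_hom_zero[OF m assms(1) f] by simp
  note f' = module_homD[OF f, simplified]
  have "linear_graph R B E ((\<lambda>x. (x, f x)) ` A)"
    unfolding linear_graph_def
    using A f' f0 by (auto simp: image_iff)
  then obtain g where "g \<in> module_hom R B E" "\<And>x u. (x, u) \<in> (\<lambda>x. (x, f x)) ` A \<Longrightarrow> g x = u"
    using linear_graph_extends[OF B.module_axioms assms] by blast
  then show "\<exists>g\<in>module_hom R B E. \<forall>x\<in>A. g x = f x" by blast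
qed fact

section \<open>Characters of abelian groups\<close>

lemma additive_imp_int_linear:
  assumes "module \<Z> M" "module \<Z> N"
    and cl: "\<And>x. x \<in> carrier M \<Longrightarrow> f x \<in> carrier N"
    and add: "\<And>x y. x \<in> carrier M \<Longrightarrow> y \<in> carrier M \<Longrightarrow> f (x \<oplus>\<^bsub>M\<^esub> y) = f x \<oplus>\<^bsub>N\<^esub> f y"
  shows "f \<in> module_hom \<Z> M N"
proof (rule module_homI[OF cl add])
  interpret M: module \<Z> M by fact
  interpret N: module \<Z> N by fact
  fix n x assume x: "x \<in> carrier M"
  have M1: "(k + l) \<odot>\<^bsub>M\<^esub> y = k \<odot>\<^bsub>M\<^esub> y \<oplus>\<^bsub>M\<^esub> l \<odot>\<^bsub>M\<^esub> y" if "y \<in> carrier M" for k l y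
    using M.smult_l_distr[OF _ _ that, of k l] by simp
  have N1: "(k + l) \<odot>\<^bsub>N\<^esub> y = k \<odot>\<^bsub>N\<^esub> y \<oplus>\<^bsub>N\<^esub> l \<odot>\<^bsub>N\<^esub> y" if "y \<in> carrier N" for k l y
    using N.smult_l_distr[OF _ _ that, of k l] by simp
  have Mc: "k \<odot>\<^bsub>M\<^esub> y \<in> carrier M" if "y \<in> carrier M" for k y
    using M.smult_closed[OF _ that, of k] by simp
  have Nc: "k \<odot>\<^bsub>N\<^esub> y \<in> carrier N" if "y \<in> carrier N" for k y
    using N.smult_closed[OF _ that, of k] by simp
  have M0: "1 \<odot>\<^bsub>M\<^esub> y = y" "0 \<odot>\<^bsub>M\<^esub> y = \<zero>\<^bsub>M\<^esub>" if "y \<in> carrier M" for y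
    using M.smult_one[OF that] M.smult_l_null[OF that] by simp_all
  have N0: "1 \<odot>\<^bsub>N\<^esub> y = y" "0 \<odot>\<^bsub>N\<^esub> y = \<zero>\<^bsub>N\<^esub>" if "y \<in> carrier N" for y
    using N.smult_one[OF that] N.smult_l_null[OF that] by simp_all
  have f0: "f \<zero>\<^bsub>M\<^esub> = \<zero>\<^bsub>N\<^esub>"
    using add[of "\<zero>\<^bsub>M\<^esub>" "\<zero>\<^bsub>M\<^esub>"] cl[of "\<zero>\<^bsub>M\<^esub>"] by (metis M.l_zero M.zero_closed N.add.l_cancel_one')
  have nonneg: "f (int k \<odot>\<^bsub>M\<^esub> x) = int k \<odot>\<^bsub>N\<^esub> f x" for k
  proof (induction k)
    case 0
    then show ?case using x cl f0 M0 N0 by simp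
  next
    case (Suc k)
    have "f (int (Suc k) \<odot>\<^bsub>M\<^esub> x) = f (x \<oplus>\<^bsub>M\<^esub> int k \<odot>\<^bsub>M\<^esub> x)"
      using M1[OF x, of 1 "int k"] M0[OF x] by simp
    also have "\<dots> = f x \<oplus>\<^bsub>N\<^esub> int k \<odot>\<^bsub>N\<^esub> f x"
      using x Mc Suc by (simp add: add)
    also have "\<dots> = int (Suc k) \<odot>\<^bsub>N\<^esub> f x"
      using N1[OF cl[OF x], of 1 "int k"] N0[OF cl[OF x]] by simp
    finally show ?case .
  qed
  show "f (n \<odot>\<^bsub>M\<^esub> x) = n \<odot>\<^bsub>N\<^esub> f x"
  proof (cases "n \<ge> 0")
    case True
    then show ?thesis using nonneg[of "nat n"] by simp
  next
    case False
    have 1: "f (- n \<odot>\<^bsub>M\<^esub> x) = - n \<odot>\<^bsub>N\<^esub> f x" using nonneg[of "nat (- n)"] False by simp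
    have "f (n \<odot>\<^bsub>M\<^esub> x) \<oplus>\<^bsub>N\<^esub> f (- n \<odot>\<^bsub>M\<^esub> x) = \<zero>\<^bsub>N\<^esub>"
      using x Mc M0 M1[OF x, of n "- n"] f0 by (metis add add.right_inverse)
    moreover have "n \<odot>\<^bsub>N\<^esub> f x \<oplus>\<^bsub>N\<^esub> f (- n \<odot>\<^bsub>M\<^esub> x) = \<zero>\<^bsub>N\<^esub>"
      using cl[OF x] N0 N1[OF cl[OF x], of n "- n"] by (simp add: 1)
    ultimately show ?thesis
      using cl Mc Nc x by (metis N.add.r_cancel)
  qed
qed

text \<open>An abelian group, given by the additive part of a ring-like record, as a \<open>\<Z>\<close>-module.\<close>

definition int_module :: "('b, 's) ring_scheme \<Rightarrow> (int, 'b) module" where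
  "int_module G = \<lparr>carrier = carrier G, monoid.mult = undefined, one = undefined,
     zero = \<zero>\<^bsub>G\<^esub>, add = add G, smult = (\<lambda>n x. [n] \<cdot>\<^bsub>G\<^esub> x)\<rparr>"

lemma int_module_simps [simp]:
  "carrier (int_module G) = carrier G" "\<zero>\<^bsub>int_module G\<^esub> = \<zero>\<^bsub>G\<^esub>"
  "x \<oplus>\<^bsub>int_module G\<^esub> y = x \<oplus>\<^bsub>G\<^esub> y" "n \<odot>\<^bsub>int_module G\<^esub> x = [n] \<cdot>\<^bsub>G\<^esub> x"
  by (simp_all add: int_module_def)

lemma int_module_is_module:
  assumes "abelian_group G"
  shows "module \<Z> (int_module G)"
proof -
  interpret abelian_group G by fact
  show ?thesis
  proof (intro moduleI int_is_cring)
    show "abelian_group (int_module G)"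
      by (rule abelian_groupI) (auto simp: a_ac intro: bexI[of _ "\<ominus>\<^bsub>G\<^esub> x" for x] l_neg)
  qed (auto simp: add.int_pow_mult add.int_pow_distrib add.int_pow_pow mult.commute)
qed

text \<open>The circle group \<open>S\<^sup>1\<close>, written additively as a \<open>\<Z>\<close>-module: its zero is \<open>1\<close>, and scalar
  multiplication is exponentiation. It serves as an injective cogenerator of abelian groups.\<close>

definition circle :: "(int, complex) module" where
  "circle = \<lparr>carrier = {z. norm z = 1}, monoid.mult = undefined, one = undefined,
     zero = 1, add = (*), smult = (\<lambda>n z. z powi n)\<rparr>"

lemma circle_simps [simp]:
  "carrier circle = {z. norm z = 1}" "\<zero>\<^bsub>circle\<^esub> = 1"
  "x \<oplus>\<^bsub>circle\<^esub> y = x * y" "n \<odot>\<^bsub>circle\<^esub> x = x powi n"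
  by (simp_all add: circle_def)

lemma circle_is_module: "module \<Z> circle"
proof (intro moduleI int_is_cring)
  show "abelian_group circle"
  proof (rule abelian_groupI)
    fix x assume "x \<in> carrier circle"
    then have "x \<noteq> 0" "norm x = 1" by auto
    then show "\<exists>y\<in>carrier circle. y \<oplus>\<^bsub>circle\<^esub> x = \<zero>\<^bsub>circle\<^esub>"
      by (intro bexI[of _ "inverse x"]) (auto simp: norm_inverse)
  qed (auto simp: norm_mult)
  fix a b x assume x: "x \<in> carrier circle"
  then have "x \<noteq> 0" by auto
  then show "(a \<oplus>\<^bsub>\<Z>\<^esub> b) \<odot>\<^bsub>circle\<^esub> x = a \<odot>\<^bsub>circle\<^esub> x \<oplus>\<^bsub>circle\<^esub> b \<odot>\<^bsub>circle\<^esub> x"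
    by (simp add: power_int_add)
  show "(a \<otimes>\<^bsub>\<Z>\<^esub> b) \<odot>\<^bsub>circle\<^esub> x = a \<odot>\<^bsub>circle\<^esub> (b \<odot>\<^bsub>circle\<^esub> x)"
    by (simp flip: power_int_mult add: mult.commute)
qed (auto simp: norm_power_int power_int_mult_distrib)

text \<open>The circle is divisible: a homomorphism on \<open>k\<int>\<close> is determined by the image \<open>cis t\<close> of \<open>k\<close> and
  is extended by means of the root \<open>cis (t / k)\<close>.\<close>

lemma baer_circle: "baer \<Z> circle"
  unfolding baer_def
proof (intro allI impI, elim conjE)
  fix I f assume "ideal I \<Z>" and f: "f \<in> module_hom \<Z> (ideal_module \<Z> I) circle"
  interpret I: ideal I \<Z> by fact
  have mI: "module \<Z> (ideal_module \<Z> I)"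
    by (rule ideal_module_is_module[OF int_is_cring]) fact
  have f0: "f 0 = 1" using module_hom_zero[OF mI circle_is_module f] by simp
  have norm_f: "norm (f a) = 1" if "a \<in> I" for a
    using module_homD(1)[OF f] that by simp
  have f_mult: "f (n * a) = f a powi n" if "a \<in> I" for n a
    using module_homD(3)[OF f, of n a] that by simp
  have I_mult: "n * a \<in> I" if "a \<in> I" for n a
    using I.I_l_closed[OF that, of n] by simp
  have I_add: "a + b \<in> I" if "a \<in> I" "b \<in> I" for a b
    using I.a_closed[OF that] by simp
  show "\<exists>e\<in>carrier circle. \<forall>a\<in>I. f a = a \<odot>\<^bsub>circle\<^esub> e"
  proof (cases "\<exists>k>0. int k \<in> I")
    case False
    have "a = 0" if "a \<in> I" for a
    proof (rule ccontr)
      assume "a \<noteq> 0"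
      moreover have "\<bar>a\<bar> \<in> I" using I_mult[OF that, of "sgn a"] by (simp add: sgn_mult_self_eq abs_sgn mult.commute)
      ultimately show False using False by (metis zero_less_abs_iff zero_less_imp_eq_int)
    qed
    then show ?thesis using f0 by (intro bexI[of _ 1]) auto
  next
    case True
    define k where "k = (LEAST k. k > 0 \<and> int k \<in> I)"
    have k: "k > 0" "int k \<in> I" using LeastI_ex[OF True] by (auto simp: k_def)
    have k_min: "k \<le> l" if "l > 0" "int l \<in> I" for l
      unfolding k_def by (rule Least_le) (use that in auto)
    have dvd: "int k dvd a" if "a \<in> I" for a
    proof (rule ccontr)
      assume "\<not> int k dvd a"
      then have "a mod int k > 0" using k by (metis dvd_eq_mod_eq_0 of_nat_0_less_iff order_le_less pos_mod_sign)
      moreover have "a + (- (a div int k)) * int k \<in> I" by (intro I_add I_mult that k)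
      then have "a mod int k \<in> I" by (simp add: minus_div_mult_eq_mod[symmetric])
      ultimately have "k \<le> nat (a mod int k)" by (intro k_min) auto
      then show False using k by (metis nat_less_iff not_le of_nat_0_less_iff pos_mod_bound pos_mod_sign)
    qed
    obtain t where t: "f (int k) = cis t"
      using norm_f[OF k(2)] by (metis cis_Arg norm_zero sgn_div_norm inverse_1 scaleR_one zero_neq_one)
    have "f a = cis (t / k) powi a" if a: "a \<in> I" for a
    proof -
      obtain q where q: "a = int k * q" using dvd[OF a] by blast
      have "f a = cis t powi q" using f_mult[OF k(2), of q] t q by (simp add: mult.commute)
      also have "cis t = cis (t / k) powi int k" using k by (simp add: Complex.DeMoivre)
      finally show ?thesis by (simp add: q power_int_mult)
    qed
    then show ?thesis by (intro bexI[of _ "cis (t / k)"]) auto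
  qed
qed

text \<open>Characters separate the elements of an abelian group: on the cyclic group generated by \<open>x\<close> there
  is a nontrivial character, and it extends.\<close>

lemma exists_character:
  fixes G (structure)
  assumes G: "abelian_group G" and x: "x \<in> carrier G" "x \<noteq> \<zero>"
  obtains \<chi> where "\<chi> \<in> module_hom \<Z> (int_module G) circle" "\<chi> x \<noteq> 1"
proof -
  interpret abelian_group G by fact
  note mG = int_module_is_module[OF G]
  have pow_add: "[(n + m)] \<cdot> x = [n] \<cdot> x \<oplus> [m] \<cdot> x" for n m :: int
    using add.int_pow_mult[OF x(1)] .
  have pow_mult: "[(n * m)] \<cdot> x = [m] \<cdot> ([n] \<cdot> x)" for n m :: int
    using add.int_pow_pow[OF x(1)] by metis
  obtain w :: complex where w: "norm w = 1" "w \<noteq> 1" "\<And>n::int. [n] \<cdot> x = \<zero> \<Longrightarrow> w powi n = 1"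
  proof (cases "\<exists>k>0. [int k] \<cdot> x = \<zero>")
    case False
    have "n = 0" if n: "[n] \<cdot> x = \<zero>" for n :: int
    proof (rule ccontr)
      assume "n \<noteq> 0"
      moreover have "[\<bar>n\<bar>] \<cdot> x = \<zero>"
        using pow_mult[of n "sgn n"] n by (simp add: abs_sgn)
      ultimately show False using False by (metis zero_less_abs_iff zero_less_imp_eq_int)
    qed
    then have "(-1::complex) powi n = 1" if "[n] \<cdot> x = \<zero>" for n :: int
      using that by fastforce
    then show ?thesis by (intro that[of "-1"]) auto
  next
    case True
    define k where "k = (LEAST k. k > 0 \<and> [int k] \<cdot> x = \<zero>)"
    have k: "k > 0" "[int k] \<cdot> x = \<zero>" using LeastI_ex[OF True] by (auto simp: k_def)
    have k_min: "k \<le> l" if "l > 0" "[int l] \<cdot> x = \<zero>" for l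
      unfolding k_def by (rule Least_le) (use that in auto)
    have "k \<noteq> 1" using k x by auto
    then have "card {z::complex. z ^ k = 1} > 1"
      using k(1) card_roots_unity_eq[OF k(1)] by linarith
    then have "\<not> {z::complex. z ^ k = 1} \<subseteq> {1}"
      using card_mono[of "{1::complex}" "{z. z ^ k = 1}"] by fastforce
    then obtain w :: complex where w: "w ^ k = 1" "w \<noteq> 1" by auto
    then have nw: "norm w = 1" using k 
      by (metis norm_power norm_one power_eq_1_iff norm_ge_zero neq0_conv)
    show ?thesis
    proof (rule that[OF nw w(2)])
      fix n :: int assume n: "[n] \<cdot> x = \<zero>"
      have "int k dvd n"
      proof (rule ccontr)
        assume "\<not> int k dvd n"
        then have "n mod int k > 0" using k by (metis dvd_eq_mod_eq_0 of_nat_0_less_iff order_le_less pos_mod_sign)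
        moreover have "[(n + int k * (- (n div int k)))] \<cdot> x = \<zero>"
          unfolding pow_add pow_mult n k(2) by simp
        then have "[(n mod int k)] \<cdot> x = \<zero>" by (simp add: minus_mult_div_eq_mod[symmetric])
        ultimately have "k \<le> nat (n mod int k)" by (intro k_min) auto
        then show False using k by (metis nat_less_iff not_le of_nat_0_less_iff pos_mod_bound pos_mod_sign)
      qed
      then show "w powi n = 1" using w(1) by (auto simp: power_int_mult)
    qed
  qed
  have w0: "w \<noteq> 0" using w(1) by auto
  define H where "H = {([n] \<cdot> x, w powi n) | n::int. True}"
  have HI: "(y, v) \<in> H" if "y = [n] \<cdot> x" "v = w powi n" for y v and n :: int
    using that by (auto simp: H_def)
  have "linear_graph \<Z> (int_module G) circle H"
    unfolding linear_graph_def
  proof (intro conjI allI impI ballI)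
    show "H \<subseteq> carrier (int_module G) \<times> carrier circle"
      using x w by (auto simp: H_def norm_power_int)
    show "(\<zero>\<^bsub>int_module G\<^esub>, \<zero>\<^bsub>circle\<^esub>) \<in> H"
      by (rule HI[of _ 0]) (auto simp: add_pow_def)
    show "(y \<oplus>\<^bsub>int_module G\<^esub> z, u \<oplus>\<^bsub>circle\<^esub> v) \<in> H" if "(y, u) \<in> H \<and> (z, v) \<in> H" for y u z v
    proof -
      obtain n m :: int where "y = [n] \<cdot> x" "u = w powi n" "z = [m] \<cdot> x" "v = w powi m"
        using \<open>(y, u) \<in> H \<and> (z, v) \<in> H\<close> by (auto simp: H_def)
      then show ?thesis using w0 by (intro HI[of _ "n + m"]) (simp_all add: pow_add power_int_add)
    qed
    show "(a \<odot>\<^bsub>int_module G\<^esub> y, a \<odot>\<^bsub>circle\<^esub> u) \<in> H" if yu: "(y, u) \<in> H" for a y u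
    proof -
      obtain n :: int where "y = [n] \<cdot> x" "u = w powi n"
        using yu by (auto simp: H_def)
      then show ?thesis by (intro HI[of _ "n * a"]) (simp_all add: pow_mult power_int_mult)
    qed
    show "u = \<zero>\<^bsub>circle\<^esub>" if "(\<zero>\<^bsub>int_module G\<^esub>, u) \<in> H" for u
      using that w(3) by (auto simp: H_def)
  qed
  then obtain g where g: "g \<in> module_hom \<Z> (int_module G) circle" "\<And>y u. (y, u) \<in> H \<Longrightarrow> g y = u"
    using linear_graph_extends[OF mG circle_is_module baer_circle] by metis
  have "g x = w" by (rule g(2)) (rule HI[of _ 1], use x in auto)
  with g w show thesis by (intro that[of g]) auto
qed

section \<open>The character module\<close>

text \<open>The product of copies of \<open>Hom\<^sub>\<int>(R, S\<^sup>1)\<close> indexed by the whole type \<open>'i\<close>, with \<open>R\<close> acting by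
  \<open>(a F) i r = F i (r a)\<close>. Elements are normalised to have the value \<open>1\<close> off the carrier of \<open>R\<close>.\<close>

definition character_module :: "('a, 'r) ring_scheme \<Rightarrow> ('a, 'i \<Rightarrow> 'a \<Rightarrow> complex) module" where
  "character_module R = \<lparr>carrier = {F. \<forall>i. F i \<in> module_hom \<Z> (int_module R) circle \<and>
       (\<forall>r. r \<notin> carrier R \<longrightarrow> F i r = 1)},
     monoid.mult = undefined, one = undefined,
     zero = (\<lambda>i r. 1), add = (\<lambda>F G i r. F i r * G i r),
     smult = (\<lambda>a F i r. if r \<in> carrier R then F i (r \<otimes>\<^bsub>R\<^esub> a) else 1)\<rparr>"

lemma character_module_simps [simp]:
  "\<zero>\<^bsub>character_module R\<^esub> = (\<lambda>i r. 1)"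
  "F \<oplus>\<^bsub>character_module R\<^esub> G = (\<lambda>i r. F i r * G i r)"
  "a \<odot>\<^bsub>character_module R\<^esub> F = (\<lambda>i r. if r \<in> carrier R then F i (r \<otimes>\<^bsub>R\<^esub> a) else 1)"
  by (simp_all add: character_module_def)

lemma character_homI:
  assumes "abelian_group G" "\<And>r. r \<in> carrier G \<Longrightarrow> norm (h r) = 1"
    "\<And>r s. r \<in> carrier G \<Longrightarrow> s \<in> carrier G \<Longrightarrow> h (r \<oplus>\<^bsub>G\<^esub> s) = h r * h s"
  shows "h \<in> module_hom \<Z> (int_module G) circle"
  using additive_imp_int_linear[OF int_module_is_module[OF assms(1)] circle_is_module, of h] assms
  by simp

lemma character_homD:
  assumes "h \<in> module_hom \<Z> (int_module G) circle"
  shows "r \<in> carrier G \<Longrightarrow> norm (h r) = 1"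
    "r \<in> carrier G \<Longrightarrow> s \<in> carrier G \<Longrightarrow> h (r \<oplus>\<^bsub>G\<^esub> s) = h r * h s"
  using module_homD(1,2)[OF assms] by auto

lemma character_moduleI:
  assumes "cring R" "\<And>i r. r \<in> carrier R \<Longrightarrow> norm (F i r) = 1"
    "\<And>i r s. r \<in> carrier R \<Longrightarrow> s \<in> carrier R \<Longrightarrow> F i (r \<oplus>\<^bsub>R\<^esub> s) = F i r * F i s"
    "\<And>i r. r \<notin> carrier R \<Longrightarrow> F i r = 1"
  shows "F \<in> carrier (character_module R)"
proof -
  interpret cring R by fact
  show ?thesis
    using assms by (auto simp: character_module_def intro!: character_homI is_abelian_group)
qed

lemma character_moduleD:
  assumes "F \<in> carrier (character_module R)"
  shows "r \<in> carrier R \<Longrightarrow> norm (F i r) = 1"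
    "r \<in> carrier R \<Longrightarrow> s \<in> carrier R \<Longrightarrow> F i (r \<oplus>\<^bsub>R\<^esub> s) = F i r * F i s"
    "r \<notin> carrier R \<Longrightarrow> F i r = 1"
  using assms character_homD[of "F i" R] by (auto simp: character_module_def)

lemma character_module_is_module:
  assumes "cring R"
  shows "module R (character_module R :: ('a, 'i \<Rightarrow> 'a \<Rightarrow> complex) module)"
proof -
  interpret cring R by fact
  let ?J = "character_module R :: ('a, 'i \<Rightarrow> 'a \<Rightarrow> complex) module"
  note D = character_moduleD
  show ?thesis
  proof (intro moduleI abelian_groupI assms)
    fix F assume F: "F \<in> carrier ?J"
    have "(\<lambda>i r. inverse (F i r)) \<in> carrier ?J"
      by (rule character_moduleI[OF assms]) (use D[OF F] in \<open>auto simp: norm_inverse\<close>)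
    moreover have "inverse (F i r) * F i r = 1" for i r
    proof -
      have "norm (F i r) = 1" using D[OF F, of r] by (cases "r \<in> carrier R") auto
      then have "F i r \<noteq> 0" by auto
      then show ?thesis by simp
    qed
    ultimately show "\<exists>G\<in>carrier ?J. G \<oplus>\<^bsub>?J\<^esub> F = \<zero>\<^bsub>?J\<^esub>"
      by (intro bexI[of _ "\<lambda>i r. inverse (F i r)"]) auto
  next
    fix F G assume "F \<in> carrier ?J" "G \<in> carrier ?J"
    then show "F \<oplus>\<^bsub>?J\<^esub> G \<in> carrier ?J"
      using D[of F R] D[of G R] by (intro character_moduleI[OF assms]) (auto simp: norm_mult)
  next
    show "\<zero>\<^bsub>?J\<^esub> \<in> carrier ?J" by (rule character_moduleI[OF assms]) auto
  next
    fix a F assume "a \<in> carrier R" "F \<in> carrier ?J"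
    then show "a \<odot>\<^bsub>?J\<^esub> F \<in> carrier ?J"
      using D[of F R] by (intro character_moduleI[OF assms]) (auto simp: l_distr)
  next
    fix a b F assume "a \<in> carrier R" "b \<in> carrier R" "F \<in> carrier ?J"
    then show "(a \<oplus>\<^bsub>R\<^esub> b) \<odot>\<^bsub>?J\<^esub> F = a \<odot>\<^bsub>?J\<^esub> F \<oplus>\<^bsub>?J\<^esub> b \<odot>\<^bsub>?J\<^esub> F"
      using D[of F R] by (auto simp: r_distr fun_eq_iff)
  next
    fix F assume "F \<in> carrier ?J"
    then show "\<one>\<^bsub>R\<^esub> \<odot>\<^bsub>?J\<^esub> F = F"
      using D[of F R] by (auto simp: fun_eq_iff)
  qed (auto simp: fun_eq_iff m_assoc mult_ac)
qed

text \<open>The adjunction between \<open>R\<close>-linear maps to \<open>Hom\<^sub>\<int>(R, S\<^sup>1)\<close> and additive maps to \<open>S\<^sup>1\<close>,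
  given by evaluation at \<open>1\<close>, reduces the condition to the extension of characters from \<open>I\<close> to \<open>R\<close>.\<close>

lemma baer_character_module:
  fixes R (structure)
  assumes "cring R"
  shows "baer R (character_module R :: ('a, 'i \<Rightarrow> 'a \<Rightarrow> complex) module)"
  unfolding baer_def
proof (intro allI impI, elim conjE)
  interpret cring R by fact
  let ?J = "character_module R :: ('a, 'i \<Rightarrow> 'a \<Rightarrow> complex) module"
  fix I f assume I: "ideal I R" and f: "f \<in> module_hom R (ideal_module R I) ?J"
  interpret I: ideal I R by fact
  note f' = module_homD[OF f, simplified]
  note D = character_moduleD[OF f'(1)]
  note mR = int_module_is_module[OF is_abelian_group]
  have Ic: "a \<in> carrier R" if "a \<in> I" for a using that I.a_subset by auto
  have f0: "f \<zero>\<^bsub>R\<^esub> = (\<lambda>i r. 1)"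
    using module_hom_zero[OF ideal_module_is_module[OF assms I] character_module_is_module[OF assms] f] by simp
  have "\<exists>g. g \<in> module_hom \<Z> (int_module R) circle \<and> (\<forall>a\<in>I. g a = f a i \<one>)" for i
  proof -
    define H where "H = (\<lambda>a. (a, f a i \<one>)) ` I"
    have mI: "module \<Z> (int_module (ideal_module R I))"
      using ideal_module_is_module[OF assms I] by (intro int_module_is_module) (simp add: module_def)
    have "(\<lambda>a. f a i \<one>) \<in> module_hom \<Z> (int_module (ideal_module R I)) circle"
      by (rule additive_imp_int_linear[OF mI circle_is_module]) (use D f' in auto)
    note lin = module_homD(3)[OF this, simplified]
    have IZ: "[n] \<cdot>\<^bsub>ideal_module R I\<^esub> a = [n] \<cdot>\<^bsub>R\<^esub> a" "[n] \<cdot>\<^bsub>R\<^esub> a \<in> I" if "a \<in> I" for n :: int and a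
    proof -
      have "(\<lambda>a. a) \<in> module_hom \<Z> (int_module (ideal_module R I)) (int_module R)"
        by (rule additive_imp_int_linear[OF mI mR]) (use Ic in auto)
      from module_homD(3)[OF this] that show 1: "[n] \<cdot>\<^bsub>ideal_module R I\<^esub> a = [n] \<cdot>\<^bsub>R\<^esub> a" by simp
      show "[n] \<cdot>\<^bsub>R\<^esub> a \<in> I" using module.smult_closed[OF mI, of n a] that by (simp add: 1)
    qed
    have "linear_graph \<Z> (int_module R) circle H"
      unfolding linear_graph_def
    proof (intro conjI allI impI ballI)
      show "H \<subseteq> carrier (int_module R) \<times> carrier circle"
        using Ic D by (auto simp: H_def)
      show "(\<zero>\<^bsub>int_module R\<^esub>, \<zero>\<^bsub>circle\<^esub>) \<in> H"
        unfolding H_def using f0 by (auto intro!: image_eqI[of _ _ "\<zero>"])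
      show "(x \<oplus>\<^bsub>int_module R\<^esub> y, u \<oplus>\<^bsub>circle\<^esub> v) \<in> H" if "(x, u) \<in> H \<and> (y, v) \<in> H" for x u y v
        using that f' unfolding H_def by (auto intro!: image_eqI[of _ _ "x \<oplus> y"])
      show "(a \<odot>\<^bsub>int_module R\<^esub> x, a \<odot>\<^bsub>circle\<^esub> u) \<in> H" if "(x, u) \<in> H" for a x u
        using that lin[of x a] IZ[of x a] unfolding H_def by (auto intro!: image_eqI[of _ _ "[a] \<cdot> x"])
      show "u = \<zero>\<^bsub>circle\<^esub>" if "(\<zero>\<^bsub>int_module R\<^esub>, u) \<in> H" for u
        using that f0 by (auto simp: H_def)
    qed
    then obtain g where "g \<in> module_hom \<Z> (int_module R) circle" "\<And>y u. (y, u) \<in> H \<Longrightarrow> g y = u"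
      using linear_graph_extends[OF mR circle_is_module baer_circle] by metis
    then show ?thesis by (auto simp: H_def)
  qed
  then obtain g where g: "\<And>i. g i \<in> module_hom \<Z> (int_module R) circle" "\<And>i a. a \<in> I \<Longrightarrow> g i a = f a i \<one>"
    by metis
  define e where "e = (\<lambda>i r. if r \<in> carrier R then g i r else 1)"
  have "e \<in> carrier ?J"
    by (rule character_moduleI[OF assms]) (use character_homD[OF g(1)] in \<open>auto simp: e_def\<close>)
  moreover have "f a = a \<odot>\<^bsub>?J\<^esub> e" if a: "a \<in> I" for a
  proof (intro ext)
    fix i r
    show "f a i r = (a \<odot>\<^bsub>?J\<^esub> e) i r"
    proof (cases "r \<in> carrier R")
      case True
      then have "(a \<odot>\<^bsub>?J\<^esub> e) i r = g i (r \<otimes> a)" using Ic[OF a] by (simp add: e_def)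
      also have "\<dots> = f (r \<otimes> a) i \<one>" using True a by (simp add: g I.I_l_closed)
      also have "f (r \<otimes> a) = r \<odot>\<^bsub>?J\<^esub> f a" using True a by (simp add: f')
      also have "(r \<odot>\<^bsub>?J\<^esub> f a) i \<one> = f a i r" using True by simp
      finally show ?thesis by simp
    qed (use D[OF a] in simp)
  qed
  ultimately show "\<exists>e\<in>carrier ?J. \<forall>a\<in>I. f a = a \<odot>\<^bsub>?J\<^esub> e" by blast
qed

lemma embeds_in_character_module:
  fixes X :: "('a, 'm) module"
  assumes "module R X"
  obtains h where
    "h \<in> module_hom R X (character_module R :: ('a, ('m \<Rightarrow> complex) \<Rightarrow> 'a \<Rightarrow> complex) module)"
    "inj_on h (carrier X)"
proof -
  interpret module R X by fact
  let ?J = "character_module R :: ('a, ('m \<Rightarrow> complex) \<Rightarrow> 'a \<Rightarrow> complex) module"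
  note mJ = character_module_is_module[OF R.is_cring, where 'i = "'m \<Rightarrow> complex"]
  \<comment> \<open>the coordinate of \<open>h x\<close> at a character \<open>\<chi>\<close> is \<open>r \<mapsto> \<chi> (r x)\<close>; at all other indices it is trivial\<close>
  define Ch where "Ch = module_hom \<Z> (int_module X) circle"
  define h where "h x = (\<lambda>\<chi> r. if \<chi> \<in> Ch \<and> r \<in> carrier R then \<chi> (r \<odot>\<^bsub>X\<^esub> x) else 1)" for x
  note Ch = character_homD[of _ X, folded Ch_def]
  have h: "h \<in> module_hom R X ?J"
  proof (rule module_homI)
    show "h x \<in> carrier ?J" if "x \<in> carrier X" for x
      by (rule character_moduleI[OF R.is_cring]) (use that Ch in \<open>auto simp: h_def smult_l_distr\<close>)
  qed (auto simp: h_def fun_eq_iff Ch smult_r_distr smult_assoc1)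
  moreover have "x = \<zero>\<^bsub>X\<^esub>" if x: "x \<in> carrier X" and hx: "h x = \<zero>\<^bsub>?J\<^esub>" for x
  proof (rule ccontr)
    assume "x \<noteq> \<zero>\<^bsub>X\<^esub>"
    then obtain \<chi> where \<chi>: "\<chi> \<in> Ch" "\<chi> x \<noteq> 1"
      using exists_character[OF M.abelian_group_axioms x] unfolding Ch_def by metis
    have "h x \<chi> \<one>\<^bsub>R\<^esub> = 1" using hx by simp
    with \<chi> x show False by (simp add: h_def)
  qed
  ultimately show thesis
    using module_hom_inj_iff[OF assms mJ h] by (intro that) auto
qed

section \<open>Transport of structure\<close>

text \<open>The module structure carried over along a map \<open>k\<close> that is injective on the carrier.\<close>

definition transport_module ::
    "('a, 'm) module \<Rightarrow> ('m \<Rightarrow> 'n) \<Rightarrow> ('a, 'n) module" where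
  "transport_module M k = (let l = the_inv_into (carrier M) k in
     \<lparr>carrier = k ` carrier M, monoid.mult = undefined, one = undefined, zero = k \<zero>\<^bsub>M\<^esub>,
      add = (\<lambda>x y. k (l x \<oplus>\<^bsub>M\<^esub> l y)), smult = (\<lambda>a x. k (a \<odot>\<^bsub>M\<^esub> l x))\<rparr>)"

lemma transport_module_simps [simp]:
  "carrier (transport_module M k) = k ` carrier M"
  "\<zero>\<^bsub>transport_module M k\<^esub> = k \<zero>\<^bsub>M\<^esub>"
  by (simp_all add: transport_module_def Let_def)

lemma transport_module_ops:
  assumes "inj_on k (carrier M)"
  shows "x \<in> carrier M \<Longrightarrow> y \<in> carrier M \<Longrightarrow> k x \<oplus>\<^bsub>transport_module M k\<^esub> k y = k (x \<oplus>\<^bsub>M\<^esub> y)"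
    and "x \<in> carrier M \<Longrightarrow> a \<odot>\<^bsub>transport_module M k\<^esub> k x = k (a \<odot>\<^bsub>M\<^esub> x)"
  using the_inv_into_f_f[OF assms] by (simp_all add: transport_module_def Let_def)

lemma transport_module_is_module:
  assumes "module R M" "inj_on k (carrier M)"
  shows "module R (transport_module M k)"
proof -
  interpret module R M by fact
  note ops = transport_module_ops[OF assms(2)]
  show ?thesis
  proof (intro moduleI abelian_groupI R.is_cring)
    fix x assume "x \<in> carrier (transport_module M k)"
    then obtain x' where "x' \<in> carrier M" "x = k x'" by auto
    then show "\<exists>y\<in>carrier (transport_module M k).
        y \<oplus>\<^bsub>transport_module M k\<^esub> x = \<zero>\<^bsub>transport_module M k\<^esub>"
      by (intro bexI[of _ "k (\<ominus>\<^bsub>M\<^esub> x')"]) (auto simp: ops M.l_neg)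
  qed (auto simp: ops M.a_ac smult_l_distr smult_r_distr smult_assoc1)
qed

lemma transport_module_hom:
  assumes "module R M" "inj_on k (carrier M)"
  shows "k \<in> module_hom R M (transport_module M k)"
    and "the_inv_into (carrier M) k \<in> module_hom R (transport_module M k) M"
proof -
  interpret module R M by fact
  note ops = transport_module_ops[OF assms(2)]
  show "k \<in> module_hom R M (transport_module M k)"
    by (rule module_homI) (auto simp: ops)
  show "the_inv_into (carrier M) k \<in> module_hom R (transport_module M k) M"
    by (rule module_homI) (auto simp: ops the_inv_into_f_f[OF assms(2)])
qed

lemma baer_transport_module:
  assumes "module R M" "inj_on k (carrier M)" "baer R M"
  shows "baer R (transport_module M k)"
  unfolding baer_def
proof (intro allI impI, elim conjE)
  fix I f
  assume I: "ideal I R" and f: "f \<in> module_hom R (ideal_module R I) (transport_module M k)"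
  have "the_inv_into (carrier M) k \<circ> f \<in> module_hom R (ideal_module R I) M"
    by (rule module_hom_comp[OF f transport_module_hom(2)[OF assms(1,2)]])
  with I assms(3) obtain e where e: "e \<in> carrier M"
    "\<And>a. a \<in> I \<Longrightarrow> (the_inv_into (carrier M) k \<circ> f) a = a \<odot>\<^bsub>M\<^esub> e"
    unfolding baer_def by blast
  show "\<exists>e\<in>carrier (transport_module M k). \<forall>a\<in>I. f a = a \<odot>\<^bsub>transport_module M k\<^esub> e"
  proof (intro bexI[of _ "k e"] ballI)
    fix a assume a: "a \<in> I"
    then have "f a \<in> k ` carrier M" using module_homD(1)[OF f] by simp
    then have "f a = k (the_inv_into (carrier M) k (f a))"
      by (simp add: f_the_inv_into_f[OF assms(2)])
    also have "\<dots> = a \<odot>\<^bsub>transport_module M k\<^esub> k e"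
      using e(2)[OF a] by (simp add: transport_module_ops[OF assms(2)] e)
    finally show "f a = a \<odot>\<^bsub>transport_module M k\<^esub> k e" .
  qed (use e in simp)
qed

section \<open>Injective modules of bounded cardinality\<close>

lemma ideal_hom_determined_on_generators:
  fixes R (structure)
  assumes "module R E" and A: "A \<subseteq> carrier R"
    and f: "f \<in> module_hom R (ideal_module R (genideal R A)) E"
    and e: "e \<in> carrier E" "\<And>a. a \<in> A \<Longrightarrow> f a = a \<odot>\<^bsub>E\<^esub> e"
    and a: "a \<in> genideal R A"
  shows "f a = a \<odot>\<^bsub>E\<^esub> e"
proof -
  interpret E: module R E by fact
  let ?I = "genideal R A"
  have I: "ideal ?I R" by (rule E.R.genideal_ideal[OF A])
  interpret I: ideal ?I R by fact
  note mI = ideal_module_is_module[OF E.R.is_cring I]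
  note f' = module_homD[OF f, simplified]
  have Ic: "a \<in> carrier R" if "a \<in> ?I" for a using that I.a_subset by auto
  have f0: "f \<zero> = \<zero>\<^bsub>E\<^esub>" using module_hom_zero[OF mI assms(1) f] by simp
  define L where "L = {a \<in> ?I. f a = a \<odot>\<^bsub>E\<^esub> e}"
  have sm: "x \<otimes> a \<in> L" if "a \<in> L" "x \<in> carrier R" for a x
    using that Ic e f' by (auto simp: L_def I.I_l_closed E.smult_assoc1)
  have "ideal L R"
  proof (rule idealI)
    show "subgroup L (add_monoid R)"
    proof (rule E.R.add.subgroupI)
      show "L \<subseteq> carrier R" using Ic by (auto simp: L_def)
      have "\<zero> \<in> L" using e f0 by (simp add: L_def)
      then show "L \<noteq> {}" by auto
      show "\<ominus> a \<in> L" if "a \<in> L" for a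
        using sm[OF that, of "\<ominus> \<one>"] that Ic by (simp add: E.R.l_minus L_def)
      show "a \<oplus> c \<in> L" if "a \<in> L" "c \<in> L" for a c
        using that Ic e f' by (auto simp: L_def E.smult_l_distr)
    qed
    show "x \<otimes> a \<in> L" if "a \<in> L" "x \<in> carrier R" for a x by (rule sm[OF that])
    then show "a \<otimes> x \<in> L" if "a \<in> L" "x \<in> carrier R" for a x
      using that Ic by (metis (no_types, lifting) E.R.m_comm L_def mem_Collect_eq)
  qed (rule E.R.ring_axioms)
  moreover have "A \<subseteq> L" using e E.R.genideal_self[OF A] by (auto simp: L_def)
  ultimately have "?I \<subseteq> L" by (rule E.R.genideal_minimal)
  with a show ?thesis by (auto simp: L_def)
qed

text \<open>A sequence read as a sequence of sequences, by means of the pairing function on \<open>nat\<close>.\<close>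

definition unzip_seq :: "(nat \<Rightarrow> 'c) \<Rightarrow> nat \<Rightarrow> nat \<Rightarrow> 'c" where
  "unzip_seq t k = (\<lambda>j. t (prod_encode (k, j)))"

lemma unzip_seq_surj: "\<exists>t. unzip_seq t = s"
  by (intro exI[of _ "\<lambda>n. s (fst (prod_decode n)) (snd (prod_decode n))"])
    (simp add: unzip_seq_def fun_eq_iff)

text \<open>Stage \<open>n\<close> of the closure of the range of \<open>g\<close> in \<open>J\<close> under solving countable systems of equations
  \<open>a\<^sub>i e = b\<^sub>i y\<^sub>i + z\<^sub>i\<close> in one unknown \<open>e\<close>. A stage is not a set but a map that enumerates it: an
  index \<open>t\<close> codes the coefficients \<open>a\<close>, \<open>b\<close> and indices for \<open>y\<close>, \<open>z\<close> at the previous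
  stage. The constant systems \<open>1 e = b y + z\<close> yield closure under the module operations, the
  systems \<open>a\<^sub>i e = y\<^sub>i\<close> Baer's condition. An index that codes an unsolvable system gives \<open>0\<close>.\<close>

fun closure_stage ::
    "('a, 'e) module \<Rightarrow> ((nat \<Rightarrow> 'a + 'm) \<Rightarrow> 'e) \<Rightarrow> nat \<Rightarrow> (nat \<Rightarrow> 'a + 'm) \<Rightarrow> 'e" where
  "closure_stage J g 0 = g"
| "closure_stage J g (Suc n) = (\<lambda>t.
    let s = unzip_seq t;
        a = (\<lambda>i. projl (unzip_seq (s 0) i 0)); b = (\<lambda>i. projl (unzip_seq (s 1) i 0));
        y = (\<lambda>i. closure_stage J g n (unzip_seq (s 2) i));
        z = (\<lambda>i. closure_stage J g n (unzip_seq (s 3) i));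
        P = (\<lambda>e. e \<in> carrier J \<and> (\<forall>i. a i \<odot>\<^bsub>J\<^esub> e = b i \<odot>\<^bsub>J\<^esub> y i \<oplus>\<^bsub>J\<^esub> z i))
    in if Ex P then Eps P else \<zero>\<^bsub>J\<^esub>)"

lemma closure_stage_carrier:
  assumes "module R J" "range g \<subseteq> carrier J"
  shows "closure_stage J g n t \<in> carrier J"
proof (cases n)
  case 0
  then show ?thesis using assms by auto
next
  case (Suc k)
  interpret module R J by fact
  have *: "(if Ex P then Eps P else \<zero>\<^bsub>J\<^esub>) \<in> carrier J" if "\<And>e. P e \<Longrightarrow> e \<in> carrier J" for P
    using that someI_ex[of P] by auto
  show ?thesis unfolding Suc closure_stage.simps Let_def by (rule *) blast
qed

lemma closure_stage_solve:
  fixes a b :: "nat \<Rightarrow> 'a" and g :: "(nat \<Rightarrow> 'a + 'm) \<Rightarrow> 'e"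
  assumes y: "\<And>i. y i \<in> range (closure_stage J g n)" and z: "\<And>i. z i \<in> range (closure_stage J g n)"
    and ex: "e \<in> carrier J" "\<And>i. a i \<odot>\<^bsub>J\<^esub> e = b i \<odot>\<^bsub>J\<^esub> y i \<oplus>\<^bsub>J\<^esub> z i"
  obtains e' where "e' \<in> range (closure_stage J g (Suc n))" "e' \<in> carrier J"
    "\<And>i. a i \<odot>\<^bsub>J\<^esub> e' = b i \<odot>\<^bsub>J\<^esub> y i \<oplus>\<^bsub>J\<^esub> z i"
proof -
  obtain y' where y': "\<And>i. y i = closure_stage J g n (y' i)"
    using y unfolding image_iff by metis
  obtain z' where z': "\<And>i. z i = closure_stage J g n (z' i)"
    using z unfolding image_iff by metis
  obtain a' where a': "unzip_seq a' = (\<lambda>i _. Inl (a i) :: 'a + 'm)" using unzip_seq_surj by blast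
  obtain b' where b': "unzip_seq b' = (\<lambda>i _. Inl (b i) :: 'a + 'm)" using unzip_seq_surj by blast
  obtain y'' where y'': "unzip_seq y'' = y'" using unzip_seq_surj by blast
  obtain z'' where z'': "unzip_seq z'' = z'" using unzip_seq_surj by blast
  obtain t where t: "unzip_seq t = (\<lambda>k. if k = 0 then a' else if k = 1 then b' else if k = 2 then y'' else z'')"
    using unzip_seq_surj by blast
  let ?P = "\<lambda>e. e \<in> carrier J \<and> (\<forall>i. a i \<odot>\<^bsub>J\<^esub> e = b i \<odot>\<^bsub>J\<^esub> y i \<oplus>\<^bsub>J\<^esub> z i)"
  have P: "Ex ?P" using ex by blast
  have "closure_stage J g (Suc n) t = (if Ex ?P then Eps ?P else \<zero>\<^bsub>J\<^esub>)"
    by (simp add: Let_def t a' b' y'' z'' y' z' split del: if_split cong del: if_weak_cong)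
  then have eq: "closure_stage J g (Suc n) t = Eps ?P" using P by simp
  have sat: "?P (Eps ?P)" using P by (rule someI_ex)
  show thesis
  proof (rule that)
    show "Eps ?P \<in> range (closure_stage J g (Suc n))" using eq by (metis rangeI)
  qed (use sat in auto)
qed

text \<open>The union \<open>C\<close> of the stages. A homomorphism from an ideal to \<open>C\<close> is determined by the images of
  finitely many generators, which occur at a common stage, so an extending element occurs at the
  next one. All of \<open>C\<close> is enumerated by indices again, as an index can also code the stage.\<close>

lemma injective_closure:
  fixes J :: "('a, 'e) module" and g :: "(nat \<Rightarrow> 'a + 'm) \<Rightarrow> 'e"
  assumes noeth: "noetherian_ring R" and J: "module R J" and baer: "baer R J"
    and g: "range g \<subseteq> carrier J" "\<zero>\<^bsub>J\<^esub> \<in> range g"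
  obtains C and h :: "(nat \<Rightarrow> 'a + 'm) \<Rightarrow> 'e" where
    "range g \<subseteq> C" "submodule C R J" "C \<subseteq> range h" "baer R (J\<lparr>carrier := C\<rparr>)"
proof -
  interpret J: module R J by fact
  let ?S = "closure_stage J g"
  define C where "C = (\<Union>n. range (?S n))"
  note Sc = closure_stage_carrier[OF J g(1)]
  have mono1: "range (?S n) \<subseteq> range (?S (Suc n))" for n
  proof
    fix x assume x: "x \<in> range (?S n)"
    then have xc: "x \<in> carrier J" using Sc by blast
    obtain e where "e \<in> range (?S (Suc n))" "e \<in> carrier J"
      "\<one>\<^bsub>R\<^esub> \<odot>\<^bsub>J\<^esub> e = \<zero>\<^bsub>R\<^esub> \<odot>\<^bsub>J\<^esub> x \<oplus>\<^bsub>J\<^esub> x"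
      by (rule closure_stage_solve[of "\<lambda>_. x" J g n "\<lambda>_. x" x "\<lambda>_. \<one>\<^bsub>R\<^esub>" "\<lambda>_. \<zero>\<^bsub>R\<^esub>"])
        (use x xc in simp_all)
    then show "x \<in> range (?S (Suc n))" using xc by simp
  qed
  have mono: "range (?S n) \<subseteq> range (?S m)" if "n \<le> m" for n m
    using that by (rule lift_Suc_mono_le[of "\<lambda>n. range (?S n)", OF mono1])
  have fin: "\<exists>n. F \<subseteq> range (?S n)" if "finite F" "F \<subseteq> C" for F
    using that
  proof (induction F)
    case (insert x F)
    then obtain n m where "F \<subseteq> range (?S n)" "x \<in> range (?S m)" by (auto simp: C_def)
    then show ?case using mono[of n "max n m"] mono[of m "max n m"]
      by (intro exI[of _ "max n m"]) auto
  qed auto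
  have Cc: "C \<subseteq> carrier J" using Sc by (auto simp: C_def)
  have comb: "b \<odot>\<^bsub>J\<^esub> y \<oplus>\<^bsub>J\<^esub> z \<in> C" if byz: "b \<in> carrier R" "y \<in> C" "z \<in> C" for b y z
  proof -
    obtain n where n: "{y, z} \<subseteq> range (?S n)" using fin[of "{y, z}"] byz by blast
    have c: "y \<in> carrier J" "z \<in> carrier J" using byz Cc by auto
    obtain e where "e \<in> range (?S (Suc n))" "e \<in> carrier J"
      "\<one>\<^bsub>R\<^esub> \<odot>\<^bsub>J\<^esub> e = b \<odot>\<^bsub>J\<^esub> y \<oplus>\<^bsub>J\<^esub> z"
      by (rule closure_stage_solve[of "\<lambda>_. y" J g n "\<lambda>_. z" "b \<odot>\<^bsub>J\<^esub> y \<oplus>\<^bsub>J\<^esub> z" "\<lambda>_. \<one>\<^bsub>R\<^esub>" "\<lambda>_. b"])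
        (use n c byz in simp_all)
    then show ?thesis unfolding C_def by (metis J.smult_one UN_I UNIV_I)
  qed
  have gC: "range g \<subseteq> C" using UN_upper[of 0 UNIV "\<lambda>n. range (?S n)"] by (simp add: C_def)
  then have C0: "\<zero>\<^bsub>J\<^esub> \<in> C" using g(2) by blast
  have Csm: "b \<odot>\<^bsub>J\<^esub> y \<in> C" if "b \<in> carrier R" "y \<in> C" for b y
    using comb[OF that C0] that Cc by auto
  have sub: "submodule C R J"
  proof (rule J.submoduleI[OF Cc C0])
    show "\<ominus>\<^bsub>J\<^esub> x \<in> C" if "x \<in> C" for x
      using Csm[of "\<ominus>\<^bsub>R\<^esub> \<one>\<^bsub>R\<^esub>" x] that Cc by (auto simp: J.smult_l_minus)
    show "x \<oplus>\<^bsub>J\<^esub> y \<in> C" if "x \<in> C" "y \<in> C" for x y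
      using comb[of "\<one>\<^bsub>R\<^esub>" x y] that Cc by auto
  qed (rule Csm)
  have mC: "module R (J\<lparr>carrier := C\<rparr>)"
    using submodule.submodule_is_module[OF sub J] .
  have baerC: "baer R (J\<lparr>carrier := C\<rparr>)"
    unfolding baer_def
  proof (intro allI impI, elim conjE)
    fix I f assume I: "ideal I R" and f: "f \<in> module_hom R (ideal_module R I) (J\<lparr>carrier := C\<rparr>)"
    obtain A where A: "A \<subseteq> carrier R" "finite A" "I = genideal R A"
      using noetherian_ring.finetely_gen[OF noeth I] by blast
    have AI: "A \<subseteq> I" using J.R.genideal_self[OF A(1)] A by simp
    have I0: "\<zero>\<^bsub>R\<^esub> \<in> I" using I by (simp add: additive_subgroup.zero_closed ideal.axioms(1))
    have f0: "f \<zero>\<^bsub>R\<^esub> = \<zero>\<^bsub>J\<^esub>"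
      using module_hom_zero[OF ideal_module_is_module[OF J.R.is_cring I] mC f] by simp
    have fC: "f a \<in> C" if "a \<in> I" for a using module_homD(1)[OF f] that by simp
    have "f \<in> module_hom R (ideal_module R I) J"
      using f Cc by (auto simp: module_hom_def)
    with I baer obtain e0 where e0: "e0 \<in> carrier J" "\<And>a. a \<in> I \<Longrightarrow> f a = a \<odot>\<^bsub>J\<^esub> e0"
      unfolding baer_def by blast
    obtain l where l: "set l = A" using finite_list[OF A(2)] by blast
    \<comment> \<open>the finite list of generators, continued by zeros to a sequence\<close>
    define a where "a i = (if i < length l then l ! i else \<zero>\<^bsub>R\<^esub>)" for i
    have aA: "a i \<in> insert \<zero>\<^bsub>R\<^esub> A" for i using l by (auto simp: a_def)
    have aI: "a i \<in> I" for i using aA[of i] AI I0 by auto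
    obtain n where n: "f ` insert \<zero>\<^bsub>R\<^esub> A \<subseteq> range (?S n)"
      using fin[of "f ` insert \<zero>\<^bsub>R\<^esub> A"] A(2) AI I0 fC by auto
    have "f (a i) \<in> range (?S n)" for i using n aA by blast
    moreover have "a i \<odot>\<^bsub>J\<^esub> e0 = \<zero>\<^bsub>R\<^esub> \<odot>\<^bsub>J\<^esub> f (a i) \<oplus>\<^bsub>J\<^esub> f (a i)" for i
      using fC[OF aI[of i]] Cc e0(2)[OF aI[of i]] by (simp add: subset_iff)
    ultimately obtain e where e: "e \<in> range (?S (Suc n))" "e \<in> carrier J"
      "\<And>i. a i \<odot>\<^bsub>J\<^esub> e = \<zero>\<^bsub>R\<^esub> \<odot>\<^bsub>J\<^esub> f (a i) \<oplus>\<^bsub>J\<^esub> f (a i)"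
      using closure_stage_solve[of "\<lambda>i. f (a i)" J g n "\<lambda>i. f (a i)" e0 a "\<lambda>_. \<zero>\<^bsub>R\<^esub>"] e0(1) by metis
    have eC: "e \<in> C" using e(1) unfolding C_def by blast
    have "f x = x \<odot>\<^bsub>J\<^esub> e" if xA: "x \<in> A" for x
    proof -
      obtain i where "i < length l" "l ! i = x" using xA l by (metis in_set_conv_nth)
      then have "a i = x" by (simp add: a_def)
      then show ?thesis using e(3)[of i] fC[OF aI, of i] Cc by (auto simp: subset_iff)
    qed
    then have "f x = x \<odot>\<^bsub>J\<^esub> e" if "x \<in> I" for x
      using ideal_hom_determined_on_generators[OF mC A(1), of f e x] f eC that A(3) by simp
    then show "\<exists>e\<in>carrier (J\<lparr>carrier := C\<rparr>). \<forall>a\<in>I. f a = a \<odot>\<^bsub>J\<lparr>carrier := C\<rparr>\<^esub> e"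
      using eC by auto
  qed
  \<comment> \<open>the first component of an index codes the stage, as the position of its first left entry\<close>
  define h where "h t = ?S (LEAST j. isl (unzip_seq t 0 j)) (unzip_seq t 1)" for t
  have "C \<subseteq> range h"
  proof
    fix c assume "c \<in> C"
    then obtain n s where c: "c = ?S n s" by (auto simp: C_def)
    obtain t where t: "unzip_seq t = (\<lambda>k. if k = 0 then (\<lambda>j. if j = n then Inl undefined else Inr undefined) else s)"
      using unzip_seq_surj by metis
    have "(LEAST j. isl (unzip_seq t 0 j)) = n"
      by (rule Least_equality) (auto simp: t split: if_splits)
    then have "h t = c" by (simp add: h_def c t)
    then show "c \<in> range h" by blast
  qed
  then show thesis using that gC sub baerC by blast
qed

text \<open>An injective embedding that stays within the type prescribed for injective resolutions. The
  element type of \<open>X\<close> is arbitrary, provided that its carrier injects into that type; this covers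
  both the module to be resolved and the cokernels that arise in the resolution.\<close>

lemma embeds_in_injective:
  fixes X :: "('a, 'q) module" and j :: "'q \<Rightarrow> (nat \<Rightarrow> 'a + 'm)"
  assumes noeth: "noetherian_ring R" and X: "module R X" and j: "inj_on j (carrier X)"
  obtains E :: "('a, nat \<Rightarrow> 'a + 'm) module" and h where
    "injective_module R E" "h \<in> module_hom R X E" "inj_on h (carrier X)"
proof -
  interpret X: module R X by fact
  let ?J = "character_module R :: ('a, ('q \<Rightarrow> complex) \<Rightarrow> 'a \<Rightarrow> complex) module"
  have mJ: "module R ?J" by (rule character_module_is_module[OF X.R.is_cring])
  interpret J: module R ?J by fact
  obtain \<iota> where \<iota>: "\<iota> \<in> module_hom R X ?J" "inj_on \<iota> (carrier X)"
    using embeds_in_character_module[OF X] .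
  define g where "g t = (if t \<in> j ` carrier X then \<iota> (the_inv_into (carrier X) j t) else \<zero>\<^bsub>?J\<^esub>)" for t
  have gj: "g (j x) = \<iota> x" if "x \<in> carrier X" for x
    using that by (simp add: g_def the_inv_into_f_f[OF j])
  have gr: "range g \<subseteq> carrier ?J"
  proof
    fix y assume "y \<in> range g"
    then obtain t where t: "y = g t" by blast
    show "y \<in> carrier ?J"
    proof (cases "t \<in> j ` carrier X")
      case True
      then show ?thesis using gj t module_homD(1)[OF \<iota>(1)] by auto
    qed (use t J.zero_closed in \<open>simp add: g_def\<close>)
  qed
  have "\<zero>\<^bsub>?J\<^esub> \<in> range g"
    using gj[OF X.zero_closed] module_hom_zero[OF X mJ \<iota>(1)] by (metis rangeI)
  then obtain C and h :: "(nat \<Rightarrow> 'a + 'm) \<Rightarrow> ('q \<Rightarrow> complex) \<Rightarrow> 'a \<Rightarrow> complex" where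
    C: "range g \<subseteq> C" "submodule C R ?J" "C \<subseteq> range h" "baer R (?J\<lparr>carrier := C\<rparr>)"
    using injective_closure[OF noeth mJ baer_character_module[OF X.R.is_cring] gr] by blast
  let ?C = "?J\<lparr>carrier := C\<rparr>"
  have mC: "module R ?C" using submodule.submodule_is_module[OF C(2) mJ] .
  define k where "k = inv_into UNIV h"
  have k: "inj_on k (carrier ?C)"
    unfolding k_def using C(3) by (simp add: inj_on_inv_into)
  show thesis
  proof
    show "injective_module R (transport_module ?C k)"
      by (intro baer_imp_injective transport_module_is_module baer_transport_module mC k C(4))
    have \<iota>C: "\<iota> x \<in> C" if "x \<in> carrier X" for x
      using gj[OF that] C(1) by (metis rangeI subsetD)
    have "\<iota> \<in> module_hom R X ?C"
      using \<iota>(1) \<iota>C by (auto simp: module_hom_def)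
    then show "k \<circ> \<iota> \<in> module_hom R X (transport_module ?C k)"
      by (rule module_hom_comp[OF _ transport_module_hom(1)[OF mC k]])
    show "inj_on (k \<circ> \<iota>) (carrier X)"
      using \<iota>(2) \<iota>C by (intro comp_inj_on inj_on_subset[OF k]) auto
  qed
qed

section \<open>Submodules and quotient modules\<close>

lemma submodule_abelian_subgroup:
  assumes "module R M" "submodule K R M"
  shows "abelian_subgroup K M"
  using assms
  by (intro abelian_subgroupI3 additive_subgroup.intro) (simp_all add: module_def submodule_def)

lemma submodule_subset: "submodule K R M \<Longrightarrow> x \<in> K \<Longrightarrow> x \<in> carrier M"
  using subgroup.mem_carrier[of K "add_monoid M" x] by (simp add: submodule_def)

lemma submodule_zero: "submodule K R M \<Longrightarrow> \<zero>\<^bsub>M\<^esub> \<in> K"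
  using subgroup.one_closed[of K "add_monoid M"] by (simp add: submodule_def)

lemma quot_module_simps [simp]:
  "carrier (quot_module R M K) = (\<lambda>x. K +>\<^bsub>M\<^esub> x) ` carrier M"
  "\<zero>\<^bsub>quot_module R M K\<^esub> = K"
  by (auto simp: quot_module_def A_RCOSETS_def')

lemma quot_module_zero_iff:
  assumes "module R M" "submodule K R M" "x \<in> carrier M"
  shows "K +>\<^bsub>M\<^esub> x = K \<longleftrightarrow> x \<in> K"
proof -
  interpret abelian_subgroup K M by (rule submodule_abelian_subgroup[OF assms(1,2)])
  show ?thesis using a_rcos_self[OF assms(3)] a_rcos_const by blast
qed

lemma quot_module_ops:
  assumes M: "module R M" and K: "submodule K R M"
  shows "x \<in> carrier M \<Longrightarrow> y \<in> carrier M \<Longrightarrow>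
      (K +>\<^bsub>M\<^esub> x) \<oplus>\<^bsub>quot_module R M K\<^esub> (K +>\<^bsub>M\<^esub> y) = K +>\<^bsub>M\<^esub> (x \<oplus>\<^bsub>M\<^esub> y)"
    and "a \<in> carrier R \<Longrightarrow> x \<in> carrier M \<Longrightarrow>
      a \<odot>\<^bsub>quot_module R M K\<^esub> (K +>\<^bsub>M\<^esub> x) = K +>\<^bsub>M\<^esub> (a \<odot>\<^bsub>M\<^esub> x)"
proof -
  interpret M: module R M by fact
  interpret K: abelian_subgroup K M by (rule submodule_abelian_subgroup[OF assms])
  show "x \<in> carrier M \<Longrightarrow> y \<in> carrier M \<Longrightarrow>
      (K +>\<^bsub>M\<^esub> x) \<oplus>\<^bsub>quot_module R M K\<^esub> (K +>\<^bsub>M\<^esub> y) = K +>\<^bsub>M\<^esub> (x \<oplus>\<^bsub>M\<^esub> y)"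
    by (simp add: quot_module_def K.a_rcos_sum)
  assume a: "a \<in> carrier R" and x: "x \<in> carrier M"
  have "K +>\<^bsub>M\<^esub> (a \<odot>\<^bsub>M\<^esub> y) = K +>\<^bsub>M\<^esub> (a \<odot>\<^bsub>M\<^esub> x)" if "y \<in> K +>\<^bsub>M\<^esub> x" for y
  proof -
    from that obtain k where k: "k \<in> K" "y = k \<oplus>\<^bsub>M\<^esub> x" by (auto simp: a_r_coset_def')
    have "a \<odot>\<^bsub>M\<^esub> k \<in> K" using submodule.smult_closed[OF K a k(1)] .
    then have "a \<odot>\<^bsub>M\<^esub> y \<in> K +>\<^bsub>M\<^esub> (a \<odot>\<^bsub>M\<^esub> x)"
      using k a x submodule_subset[OF K k(1)] by (auto simp: a_r_coset_def' M.smult_r_distr)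
    then show ?thesis using K.a_repr_independence' a x by blast
  qed
  then have "(\<Union>y\<in>K +>\<^bsub>M\<^esub> x. K +>\<^bsub>M\<^esub> (a \<odot>\<^bsub>M\<^esub> y)) = (\<Union>y\<in>K +>\<^bsub>M\<^esub> x. K +>\<^bsub>M\<^esub> (a \<odot>\<^bsub>M\<^esub> x))"
    by (rule SUP_cong[OF refl])
  also have "\<dots> = K +>\<^bsub>M\<^esub> (a \<odot>\<^bsub>M\<^esub> x)"
    using K.a_rcos_self[OF x] by (intro cSUP_const) blast
  finally show "a \<odot>\<^bsub>quot_module R M K\<^esub> (K +>\<^bsub>M\<^esub> x) = K +>\<^bsub>M\<^esub> (a \<odot>\<^bsub>M\<^esub> x)"
    by (simp add: quot_module_def)
qed

lemma quot_module_is_module: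
  assumes M: "module R M" and K: "submodule K R M"
  shows "module R (quot_module R M K)"
proof -
  interpret M: module R M by fact
  note ops = quot_module_ops[OF assms]
  have z: "K = K +>\<^bsub>M\<^esub> \<zero>\<^bsub>M\<^esub>"
    using quot_module_zero_iff[OF assms M.zero_closed] submodule_zero[OF K] by simp
  show ?thesis
  proof (intro moduleI abelian_groupI M.R.is_cring)
    show "\<zero>\<^bsub>quot_module R M K\<^esub> \<in> carrier (quot_module R M K)"
      using z by auto
    fix x assume "x \<in> carrier (quot_module R M K)"
    then obtain x' where x': "x' \<in> carrier M" "x = K +>\<^bsub>M\<^esub> x'" by auto
    have "K \<oplus>\<^bsub>quot_module R M K\<^esub> x = x"
      by (subst z) (simp add: x' ops del: M.add.coset_mult_one)
    then show "\<zero>\<^bsub>quot_module R M K\<^esub> \<oplus>\<^bsub>quot_module R M K\<^esub> x = x" by simp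
    have "(K +>\<^bsub>M\<^esub> (\<ominus>\<^bsub>M\<^esub> x')) \<oplus>\<^bsub>quot_module R M K\<^esub> x = K"
      by (subst (3) z) (simp add: x' ops M.l_neg)
    then show "\<exists>y\<in>carrier (quot_module R M K).
        y \<oplus>\<^bsub>quot_module R M K\<^esub> x = \<zero>\<^bsub>quot_module R M K\<^esub>"
      using x' by (intro bexI[of _ "K +>\<^bsub>M\<^esub> (\<ominus>\<^bsub>M\<^esub> x')"]) auto
  qed (auto simp: ops M.a_ac M.smult_l_distr M.smult_r_distr M.smult_assoc1)
qed

lemma quot_module_proj_hom:
  assumes M: "module R M" and K: "submodule K R M"
  shows "(\<lambda>x. K +>\<^bsub>M\<^esub> x) \<in> module_hom R M (quot_module R M K)"
  using quot_module_ops[OF assms] by (intro module_homI) auto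

lemma nonzero_quot_module_iff:
  assumes M: "module R M" and K: "submodule K R M"
  shows "nonzero_module (quot_module R M K) \<longleftrightarrow> \<not> carrier M \<subseteq> K"
proof -
  interpret M: module R M by fact
  have "(\<lambda>x. K +>\<^bsub>M\<^esub> x) ` carrier M = {K} \<longleftrightarrow> (\<forall>x\<in>carrier M. K +>\<^bsub>M\<^esub> x = K)"
    using M.zero_closed by blast
  then show ?thesis
    using quot_module_zero_iff[OF assms] by (auto simp: nonzero_module_def)
qed

lemma quot_module_eqI:
  assumes M: "module R M" and K: "submodule K R M" and x: "x \<in> carrier M" and y: "y \<in> carrier M"
    and xy: "x \<ominus>\<^bsub>M\<^esub> y \<in> K"
  shows "K +>\<^bsub>M\<^esub> x = K +>\<^bsub>M\<^esub> y"
proof -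
  interpret K: abelian_subgroup K M by (rule submodule_abelian_subgroup[OF M K])
  show ?thesis
    using K.a_rcos_module[OF y x] xy K.a_repr_independence'[of x y] y by (simp add: a_minus_def)
qed

lemma quot_module_lift:
  assumes M: "module R M" and K: "submodule K R M" and W: "module R W"
    and f: "f \<in> module_hom R M W" and fK: "\<And>x. x \<in> K \<Longrightarrow> f x = \<zero>\<^bsub>W\<^esub>"
  obtains h where "h \<in> module_hom R (quot_module R M K) W"
    "\<And>x. x \<in> carrier M \<Longrightarrow> h (K +>\<^bsub>M\<^esub> x) = f x"
proof -
  interpret M: module R M by fact
  interpret W: module R W by fact
  interpret K: abelian_subgroup K M by (rule submodule_abelian_subgroup[OF M K])
  note f' = module_homD[OF f]
  define h where "h C = f (SOME c. c \<in> C)" for C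
  have h: "h (K +>\<^bsub>M\<^esub> x) = f x" if x: "x \<in> carrier M" for x
  proof -
    have "(SOME c. c \<in> K +>\<^bsub>M\<^esub> x) \<in> K +>\<^bsub>M\<^esub> x"
      using K.a_rcos_self[OF x] by (rule someI)
    then obtain k where k: "k \<in> K" "(SOME c. c \<in> K +>\<^bsub>M\<^esub> x) = k \<oplus>\<^bsub>M\<^esub> x"
      by (auto simp: a_r_coset_def')
    then show ?thesis
      using f' fK[OF k(1)] submodule_subset[OF K k(1)] x by (simp add: h_def)
  qed
  have "h \<in> module_hom R (quot_module R M K) W"
    by (rule module_homI) (auto simp: h f' quot_module_ops[OF M K])
  with h show thesis by (intro that)
qed

lemma kernel_submodule:
  assumes "module R M" "module R N" "f \<in> module_hom R M N"
  shows "submodule {x \<in> carrier M. f x = \<zero>\<^bsub>N\<^esub>} R M"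
proof -
  interpret M: module R M by fact
  interpret N: module R N by fact
  show ?thesis
    using module_homD[OF assms(3)] module_hom_zero[OF assms] module_hom_minus[OF assms]
    by (intro M.submoduleI) auto
qed

lemma image_submodule:
  assumes "module R M" "module R N" "f \<in> module_hom R M N" and K: "submodule K R M"
  shows "submodule (f ` K) R N"
proof -
  interpret M: module R M by fact
  interpret N: module R N by fact
  note f = module_homD[OF assms(3)] and m = module_hom_minus[OF assms(1-3)]
  note Kc = submodule_subset[OF K] and K' = M.submoduleE[OF K]
  show ?thesis
  proof (rule N.submoduleI)
    show "\<zero>\<^bsub>N\<^esub> \<in> f ` K"
      using module_hom_zero[OF assms(1-3)] submodule_zero[OF K] by (metis imageI)
    show "\<ominus>\<^bsub>N\<^esub> y \<in> f ` K" if "y \<in> f ` K" for y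
      using that K' by (auto simp: Kc simp flip: m intro!: imageI)
    show "y \<oplus>\<^bsub>N\<^esub> z \<in> f ` K" if "y \<in> f ` K" "z \<in> f ` K" for y z
      using that K' by (auto simp: Kc simp flip: f(2) intro!: imageI)
    show "a \<odot>\<^bsub>N\<^esub> y \<in> f ` K" if "a \<in> carrier R" "y \<in> f ` K" for a y
      using that K' by (auto simp: Kc simp flip: f(3) intro!: imageI)
  qed (use f Kc in auto)
qed

lemma submodule_Int:
  assumes "module R M" "submodule A R M" "submodule B R M"
  shows "submodule (A \<inter> B) R M"
proof -
  interpret M: module R M by fact
  show ?thesis
    using M.submoduleE[OF assms(2)] M.submoduleE[OF assms(3)] submodule_zero[OF assms(2)]
      submodule_zero[OF assms(3)]
    by (intro M.submoduleI) auto
qed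

lemma submodule_span_submodule:
  assumes "module R M" "S \<subseteq> carrier M"
  shows "submodule (submodule_span R M S) R M"
proof -
  interpret M: module R M by fact
  have 1: "submodule_span R M S \<subseteq> carrier M"
    unfolding submodule_span_def using M.carrier_is_submodule assms(2) by blast
  show ?thesis
    by (rule M.submoduleI[OF 1])
      (auto simp: submodule_span_def submodule_zero M.submoduleE(3,5) submodule.smult_closed)
qed

lemma submodule_span_superset: "S \<subseteq> submodule_span R M S"
  by (auto simp: submodule_span_def)

lemma submodule_span_minimal: "submodule H R M \<Longrightarrow> S \<subseteq> H \<Longrightarrow> submodule_span R M S \<subseteq> H"
  by (auto simp: submodule_span_def)

section \<open>Existence of injective resolutions\<close>

text \<open>The quotient \<open>E/K\<close> injects into the element type of \<open>E\<close> by choice of representatives.\<close>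

lemma injective_resolution_step:
  fixes E :: "('a, nat \<Rightarrow> 'a + 'm) module"
  assumes noeth: "noetherian_ring R" and E: "module R E" and K: "submodule K R E"
  obtains E' :: "('a, nat \<Rightarrow> 'a + 'm) module" and d where
    "injective_module R E'" "d \<in> module_hom R E E'" "{x \<in> carrier E. d x = \<zero>\<^bsub>E'\<^esub>} = K"
proof -
  let ?Q = "quot_module R E K"
  interpret K: abelian_subgroup K E by (rule submodule_abelian_subgroup[OF E K])
  have mQ: "module R ?Q" by (rule quot_module_is_module[OF E K])
  have self: "(SOME x. x \<in> C) \<in> C" if "C \<in> carrier ?Q" for C
    using that K.a_rcos_self by (auto simp: some_in_eq)
  have "inj_on (\<lambda>C. SOME x. x \<in> C) (carrier ?Q)"
  proof (rule inj_onI)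
    fix C D assume CD: "C \<in> carrier ?Q" "D \<in> carrier ?Q" "(SOME x. x \<in> C) = (SOME x. x \<in> D)"
    define y where "y = (SOME x. x \<in> C)"
    have y: "y \<in> C" "y \<in> D" using self[OF CD(1)] self[OF CD(2)] CD(3) by (auto simp: y_def)
    obtain c e where "c \<in> carrier E" "C = K +>\<^bsub>E\<^esub> c" "e \<in> carrier E" "D = K +>\<^bsub>E\<^esub> e"
      using CD by auto
    then show "C = D" using y K.a_repr_independence' by blast
  qed
  then obtain E' :: "('a, nat \<Rightarrow> 'a + 'm) module" and h where
    E': "injective_module R E'" "h \<in> module_hom R ?Q E'" "inj_on h (carrier ?Q)"
    using embeds_in_injective[OF noeth mQ] by blast
  have mE': "module R E'" using E'(1) by (simp add: injective_module_def)
  have inj: "C = K" if "C \<in> carrier ?Q" "h C = \<zero>\<^bsub>E'\<^esub>" for C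
    using module_hom_inj_iff[OF mQ mE' E'(2)] E'(3) that by auto
  have hK: "h K = \<zero>\<^bsub>E'\<^esub>" using module_hom_zero[OF mQ mE' E'(2)] by simp
  have zero_iff: "h (K +>\<^bsub>E\<^esub> x) = \<zero>\<^bsub>E'\<^esub> \<longleftrightarrow> x \<in> K" if x: "x \<in> carrier E" for x
  proof -
    have "K +>\<^bsub>E\<^esub> x \<in> carrier ?Q" using x by simp
    then show ?thesis using inj[of "K +>\<^bsub>E\<^esub> x"] hK quot_module_zero_iff[OF E K x] by metis
  qed
  let ?d = "h \<circ> (\<lambda>x. K +>\<^bsub>E\<^esub> x)"
  show thesis
  proof
    show "?d \<in> module_hom R E E'"
      by (rule module_hom_comp[OF quot_module_proj_hom[OF E K] E'(2)])
    show "{x \<in> carrier E. ?d x = \<zero>\<^bsub>E'\<^esub>} = K"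
      using zero_iff submodule_subset[OF K] by auto
  qed fact
qed

lemma injective_resolution_exists:
  fixes X :: "('a, 'm) module"
  assumes noeth: "noetherian_ring R" and X: "module R X"
  obtains \<epsilon> and E :: "nat \<Rightarrow> ('a, nat \<Rightarrow> 'a + 'm) module" and d
    where "is_injective_resolution R X \<epsilon> E d"
proof -
  have "inj_on (\<lambda>x (_::nat). Inr x :: 'a + 'm) (carrier X)"
    by (auto simp: inj_on_def fun_eq_iff)
  then obtain E0 :: "('a, nat \<Rightarrow> 'a + 'm) module" and \<epsilon> where
    E0: "injective_module R E0" "\<epsilon> \<in> module_hom R X E0" "inj_on \<epsilon> (carrier X)"
    using embeds_in_injective[OF noeth X] by blast
  have m: "module R E" if "injective_module R E" for E :: "('a, nat \<Rightarrow> 'a + 'm) module"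
    using that by (simp add: injective_module_def)
  interpret X: module R X by fact
  define P where "P = (\<lambda>(n::nat) p. injective_module R (fst p) \<and> submodule (snd p) R (fst p) \<and>
    (n = 0 \<longrightarrow> p = (E0 :: ('a, nat \<Rightarrow> 'a + 'm) module, \<epsilon> ` carrier X)))"
  define Q where "Q = (\<lambda>(n::nat) (p :: ('a, nat \<Rightarrow> 'a + 'm) module \<times> (nat \<Rightarrow> 'a + 'm) set)
      (q :: ('a, nat \<Rightarrow> 'a + 'm) module \<times> (nat \<Rightarrow> 'a + 'm) set). \<exists>d. d \<in> module_hom R (fst p) (fst q) \<and>
    {x \<in> carrier (fst p). d x = \<zero>\<^bsub>fst q\<^esub>} = snd p \<and> snd q = d ` carrier (fst p))"
  have "\<exists>f. \<forall>n. P n (f n) \<and> Q n (f n) (f (Suc n))"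
  proof (rule dependent_nat_choice)
    show "\<exists>p. P 0 p"
      using E0 image_submodule[OF X m[OF E0(1)] E0(2) X.carrier_is_submodule]
      by (intro exI[of _ "(E0, \<epsilon> ` carrier X)"]) (simp add: P_def)
    fix p n assume "P n p"
    then have p: "injective_module R (fst p)" "submodule (snd p) R (fst p)" by (auto simp: P_def)
    obtain E' :: "('a, nat \<Rightarrow> 'a + 'm) module" and d where
      d: "injective_module R E'" "d \<in> module_hom R (fst p) E'" "{x \<in> carrier (fst p). d x = \<zero>\<^bsub>E'\<^esub>} = snd p"
      by (rule injective_resolution_step[OF noeth m[OF p(1)] p(2)])
    have "submodule (d ` carrier (fst p)) R E'"
      by (rule image_submodule[OF m[OF p(1)] m[OF d(1)] d(2)
            module.carrier_is_submodule[OF m[OF p(1)]]])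
    with d show "\<exists>q. P (Suc n) q \<and> Q n p q"
      by (intro exI[of _ "(E', d ` carrier (fst p))"]) (auto simp: P_def Q_def)
  qed
  then obtain f where f: "\<And>n. P n (f n)" "\<And>n. Q n (f n) (f (Suc n))" by blast
  define E where "E n = fst (f n)" for n
  have "\<forall>n. \<exists>d. d \<in> module_hom R (E n) (E (Suc n)) \<and>
      {x \<in> carrier (E n). d x = \<zero>\<^bsub>E (Suc n)\<^esub>} = snd (f n) \<and> snd (f (Suc n)) = d ` carrier (E n)"
    using f(2) unfolding Q_def E_def by simp
  from choice[OF this] obtain d where d: "\<And>n. d n \<in> module_hom R (E n) (E (Suc n))"
    "\<And>n. {x \<in> carrier (E n). d n x = \<zero>\<^bsub>E (Suc n)\<^esub>} = snd (f n)"
    "\<And>n. snd (f (Suc n)) = d n ` carrier (E n)"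
    by blast
  have f0: "f 0 = (E0, \<epsilon> ` carrier X)" using f(1)[of 0] by (simp add: P_def)
  then have "E 0 = E0" by (simp add: E_def)
  have "is_injective_resolution R X \<epsilon> E d"
    unfolding is_injective_resolution_def
  proof (intro conjI allI)
    show "injective_module R (E i)" for i using f(1)[of i] by (simp add: P_def E_def)
    show "\<epsilon> ` carrier X = {e \<in> carrier (E 0). d 0 e = \<zero>\<^bsub>E 1\<^esub>}"
      using d(2)[of 0] f0 by simp
    show "d i ` carrier (E i) =
       {e \<in> carrier (E (Suc i)). d (Suc i) e = \<zero>\<^bsub>E (Suc (Suc i))\<^esub>}" for i
      using d(2)[of "Suc i"] d(3)[of i] by simp
  qed (use E0 d(1) \<open>E 0 = E0\<close> in simp_all)
  then show thesis by (rule that)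
qed

lemma injective_resolution_spec:
  fixes X :: "('a, 'm) module"
  assumes "noetherian_ring R" and "module R X"
  obtains \<epsilon> E d where "injective_resolution R X = (E, d)" "is_injective_resolution R X \<epsilon> E d"
proof -
  obtain \<epsilon> and E :: "nat \<Rightarrow> ('a, nat \<Rightarrow> 'a + 'm) module" and d where
    "is_injective_resolution R X \<epsilon> E d"
    by (rule injective_resolution_exists[OF assms])
  then have "\<exists>p :: (nat \<Rightarrow> ('a, nat \<Rightarrow> 'a + 'm) module) \<times> (nat \<Rightarrow> (nat \<Rightarrow> 'a + 'm) \<Rightarrow> nat \<Rightarrow> 'a + 'm).
      (\<lambda>(E, d). \<exists>\<epsilon>. is_injective_resolution R X \<epsilon> E d) p"
    by (intro exI[of _ "(E, d)"]) auto
  then have "(\<lambda>(E, d). \<exists>\<epsilon>. is_injective_resolution R X \<epsilon> E d) (injective_resolution R X)"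
    unfolding injective_resolution_def by (rule someI_ex)
  then show thesis using that by (cases "injective_resolution R X") auto
qed

section \<open>Torsion with respect to an ideal\<close>

text \<open>No nonzero element of \<open>X\<close> is killed by \<open>I\<close>; in other words, \<open>Hom(R/I, X) = 0\<close>.\<close>

definition socle_free :: "('a, 'r) ring_scheme \<Rightarrow> 'a set \<Rightarrow> ('a, 'm) module \<Rightarrow> bool" where
  "socle_free R I X \<longleftrightarrow> (\<forall>x\<in>carrier X. (\<forall>a\<in>I. a \<odot>\<^bsub>X\<^esub> x = \<zero>\<^bsub>X\<^esub>) \<longrightarrow> x = \<zero>\<^bsub>X\<^esub>)"

text \<open>The restriction map from \<open>X = Hom(R, X)\<close> to \<open>Hom(I, X)\<close> is surjective; in other words,
  \<open>Ext\<^sup>1(R/I, X) = 0\<close>.\<close>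

definition homs_are_multiplications ::
    "('a, 'r) ring_scheme \<Rightarrow> 'a set \<Rightarrow> ('a, 'm) module \<Rightarrow> bool" where
  "homs_are_multiplications R I X \<longleftrightarrow>
     (\<forall>f\<in>module_hom R (ideal_module R I) X. \<exists>x\<in>carrier X. \<forall>a\<in>I. f a = a \<odot>\<^bsub>X\<^esub> x)"

lemma ideal_power_simps:
  "I [^]\<^bsub>ideals_set R\<^esub> (0::nat) = carrier R"
  "I [^]\<^bsub>ideals_set R\<^esub> (Suc n) = ideal_prod R (I [^]\<^bsub>ideals_set R\<^esub> n) I"
  "\<one>\<^bsub>ideals_set R\<^esub> = carrier R"
  "I \<otimes>\<^bsub>ideals_set R\<^esub> J = ideal_prod R I J"
  by (simp_all add: nat_pow_def ideals_set_def)

lemma ideal_power_is_ideal: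
  assumes "cring R" "ideal I R"
  shows "ideal (I [^]\<^bsub>ideals_set R\<^esub> (n::nat)) R"
proof -
  interpret cring R by fact
  show ?thesis
    by (induction n) (simp_all add: ideal_power_simps oneideal ideal_prod_is_ideal assms)
qed

lemma ideal_power_antimono:
  assumes "cring R" "ideal I R" "n \<le> m"
  shows "I [^]\<^bsub>ideals_set R\<^esub> (m::nat) \<subseteq> I [^]\<^bsub>ideals_set R\<^esub> n"
proof -
  interpret cring R by fact
  have "I [^]\<^bsub>ideals_set R\<^esub> (Suc k) \<subseteq> I [^]\<^bsub>ideals_set R\<^esub> k" for k
    using ideal_prod_inter[OF ideal_power_is_ideal[OF assms(1,2), of k] assms(2)]
    by (auto simp: ideal_power_simps)
  then show ?thesis
    by (rule lift_Suc_antimono_le[OF _ assms(3)])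
qed

lemma torsion_part_submodule:
  fixes X (structure)
  assumes "module R X" "ideal I R"
  shows "submodule (torsion_part R I X) R X"
proof -
  interpret X: module R X by fact
  let ?P = "\<lambda>n::nat. I [^]\<^bsub>ideals_set R\<^esub> n"
  have Pc: "a \<in> carrier R" if "a \<in> ?P n" for a n
    using ideal.Icarr[OF ideal_power_is_ideal[OF X.R.is_cring assms(2)] that] .
  show ?thesis
  proof (rule X.submoduleI)
    show "\<ominus> x \<in> torsion_part R I X" if "x \<in> torsion_part R I X" for x
    proof -
      from that obtain n where n: "x \<in> carrier X" "\<forall>a\<in>?P n. a \<odot> x = \<zero>"
        by (auto simp: torsion_part_def)
      then have "\<forall>a\<in>?P n. a \<odot> (\<ominus> x) = \<zero>" using Pc by (simp add: X.smult_r_minus)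
      with n show ?thesis unfolding torsion_part_def by blast
    qed
    show "x \<oplus> y \<in> torsion_part R I X" if xy: "x \<in> torsion_part R I X" "y \<in> torsion_part R I X" for x y
    proof -
      obtain n m where n: "x \<in> carrier X" "\<forall>a\<in>?P n. a \<odot> x = \<zero>"
        "y \<in> carrier X" "\<forall>a\<in>?P m. a \<odot> y = \<zero>"
        using xy by (auto simp: torsion_part_def)
      have "?P (max n m) \<subseteq> ?P n" "?P (max n m) \<subseteq> ?P m"
        by (rule ideal_power_antimono[OF X.R.is_cring assms(2)]; simp)+
      then have "\<forall>a\<in>?P (max n m). a \<odot> (x \<oplus> y) = \<zero>"
        using n Pc by (simp add: X.smult_r_distr subset_iff)
      with n show ?thesis unfolding torsion_part_def by blast
    qed
    show "b \<odot> x \<in> torsion_part R I X" if "b \<in> carrier R" "x \<in> torsion_part R I X" for b x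
    proof -
      from that obtain n where n: "x \<in> carrier X" "\<forall>a\<in>?P n. a \<odot> x = \<zero>"
        by (auto simp: torsion_part_def)
      have "a \<odot> (b \<odot> x) = \<zero>" if "a \<in> ?P n" for a
      proof -
        have "a \<odot> (b \<odot> x) = b \<odot> (a \<odot> x)"
          using Pc[OF that] \<open>b \<in> carrier R\<close> n(1)
          by (simp flip: X.smult_assoc1 add: X.R.m_comm)
        then show ?thesis using n(2) that \<open>b \<in> carrier R\<close> by simp
      qed
      then show ?thesis using n(1) that(1) unfolding torsion_part_def by blast
    qed
    show "\<zero> \<in> torsion_part R I X" using Pc by (auto simp: torsion_part_def)
  qed (auto simp: torsion_part_def)
qed

lemma socle_free_imp_torsion_part_zero:
  fixes X (structure)
  assumes X: "module R X" and I: "ideal I R" and sf: "socle_free R I X"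
    and x: "x \<in> torsion_part R I X"
  shows "x = \<zero>"
proof -
  interpret X: module R X by fact
  let ?P = "\<lambda>n::nat. I [^]\<^bsub>ideals_set R\<^esub> n"
  have Pc: "a \<in> carrier R" if "a \<in> ?P n" for a n
    using ideal.Icarr[OF ideal_power_is_ideal[OF X.R.is_cring I] that] .
  have Ic: "a \<in> carrier R" if "a \<in> I" for a using ideal.Icarr[OF I that] .
  have "x = \<zero>" if "\<forall>a\<in>?P n. a \<odot> x = \<zero>" "x \<in> carrier X" for n
    using that
  proof (induction n)
    case 0
    then show ?case by (metis X.R.one_closed X.smult_one ideal_power_simps(1))
  next
    case (Suc n)
    have "a \<odot> x = \<zero>" if a: "a \<in> ?P n" for a
    proof -
      have "b \<odot> (a \<odot> x) = \<zero>" if b: "b \<in> I" for b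
      proof -
        have "a \<otimes>\<^bsub>R\<^esub> b \<in> ?P (Suc n)" by (simp add: ideal_power_simps ideal_prod.prod a b)
        then show ?thesis
          using Suc.prems Pc[OF a] Ic[OF b] by (simp flip: X.smult_assoc1 add: X.R.m_comm)
      qed
      then show ?thesis
        using sf Pc[OF a] Suc.prems(2) by (simp add: socle_free_def)
    qed
    then show ?case using Suc by blast
  qed
  with x show ?thesis by (auto simp: torsion_part_def)
qed

lemma socle_subset_torsion_part:
  assumes X: "module R X" and I: "ideal I R" and x: "x \<in> carrier X" "\<And>a. a \<in> I \<Longrightarrow> a \<odot>\<^bsub>X\<^esub> x = \<zero>\<^bsub>X\<^esub>"
  shows "x \<in> torsion_part R I X"
proof -
  interpret X: module R X by fact
  have "I [^]\<^bsub>ideals_set R\<^esub> Suc 0 \<subseteq> I"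
    unfolding ideal_power_simps using X.R.ideal_prod_inter[OF X.R.oneideal I] by blast
  with x show ?thesis unfolding torsion_part_def by blast
qed

text \<open>The passage from \<open>I\<close> to its powers, needed because the torsion functor involves all of them. A
  homomorphism on \<open>I\<^sup>n I\<close> is, for each \<open>a \<in> I\<^sup>n\<close>, multiplication by a unique element \<open>g a\<close> on \<open>a I\<close>,
  and \<open>g\<close> is a homomorphism on \<open>I\<^sup>n\<close>.\<close>

lemma homs_are_multiplications_power:
  fixes X (structure)
  assumes X: "module R X" and I: "ideal I R" and sf: "socle_free R I X"
    and hm: "homs_are_multiplications R I X"
  shows "homs_are_multiplications R (I [^]\<^bsub>ideals_set R\<^esub> (n::nat)) X"
proof -
  interpret X: module R X by fact
  interpret I: ideal I R by fact
  let ?P = "\<lambda>n::nat. I [^]\<^bsub>ideals_set R\<^esub> n"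
  have Pi: "ideal (?P n) R" for n by (rule ideal_power_is_ideal[OF X.R.is_cring I])
  have Pc: "a \<in> carrier R" if "a \<in> ?P n" for a n using ideal.Icarr[OF Pi that] .
  have Ic: "a \<in> carrier R" if "a \<in> I" for a using ideal.Icarr[OF I that] .
  have uniq: "x = y" if xy: "x \<in> carrier X" "y \<in> carrier X" "\<And>a. a \<in> I \<Longrightarrow> a \<odot> x = a \<odot> y" for x y
  proof -
    have "a \<odot> (x \<oplus> \<ominus> y) = \<zero>" if "a \<in> I" for a
      using xy Ic that by (simp add: X.smult_r_distr X.smult_r_minus X.r_neg)
    then have "x \<oplus> \<ominus> y = \<zero>" using sf xy by (simp add: socle_free_def)
    then show ?thesis using xy by (metis X.minus_equality X.minus_minus X.a_comm X.a_inv_closed)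
  qed
  show ?thesis
  proof (induction n)
    case 0
    show ?case
      unfolding homs_are_multiplications_def ideal_power_simps
    proof (intro ballI)
      fix f assume f: "f \<in> module_hom R (ideal_module R (carrier R)) X"
      note f' = module_homD[OF f, simplified]
      have "f a = a \<odot> f \<one>\<^bsub>R\<^esub>" if "a \<in> carrier R" for a
        using f'(3)[of a "\<one>\<^bsub>R\<^esub>"] that by simp
      then show "\<exists>x\<in>carrier X. \<forall>a\<in>carrier R. f a = a \<odot> x" using f'(1) by blast
    qed
  next
    case (Suc n)
    define Q where "Q = ?P (Suc n)"
    have Q: "Q = ideal_prod R (?P n) I" by (simp add: Q_def ideal_power_simps)
    have Qc: "a \<in> carrier R" if "a \<in> Q" for a using Pc[of a "Suc n"] that by (simp only: Q_def)
    show ?case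
      unfolding homs_are_multiplications_def Q_def[symmetric]
    proof (intro ballI)
      fix f assume f: "f \<in> module_hom R (ideal_module R Q) X"
      note f' = module_homD[OF f, simplified]
      have prod: "a \<otimes>\<^bsub>R\<^esub> t \<in> Q" if "a \<in> ?P n" "t \<in> I" for a t
        using that by (simp add: Q ideal_prod.prod)
      have "\<exists>x\<in>carrier X. \<forall>t\<in>I. f (a \<otimes>\<^bsub>R\<^esub> t) = t \<odot> x" if a: "a \<in> ?P n" for a
      proof -
        have "(\<lambda>t. f (a \<otimes>\<^bsub>R\<^esub> t)) \<in> module_hom R (ideal_module R I) X"
        proof (rule module_homI)
          fix b t assume b: "b \<in> carrier R" and t: "t \<in> carrier (ideal_module R I)"
          then have "a \<otimes>\<^bsub>R\<^esub> (b \<otimes>\<^bsub>R\<^esub> t) = b \<otimes>\<^bsub>R\<^esub> (a \<otimes>\<^bsub>R\<^esub> t)"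
            using Pc[OF a] Ic by (simp add: X.R.m_lcomm)
          then show "f (a \<otimes>\<^bsub>R\<^esub> (b \<odot>\<^bsub>ideal_module R I\<^esub> t)) = b \<odot> f (a \<otimes>\<^bsub>R\<^esub> t)"
            using f'(3)[OF b prod[OF a]] t by simp
        qed (use f' prod[OF a] Pc[OF a] Ic in \<open>auto simp: X.R.r_distr\<close>)
        from bspec[OF hm[unfolded homs_are_multiplications_def] this] show ?thesis by simp
      qed
      then obtain g where g: "\<And>a. a \<in> ?P n \<Longrightarrow> g a \<in> carrier X"
        "\<And>a t. a \<in> ?P n \<Longrightarrow> t \<in> I \<Longrightarrow> f (a \<otimes>\<^bsub>R\<^esub> t) = t \<odot> g a"
        by metis
      have Padd: "a \<oplus>\<^bsub>R\<^esub> b \<in> ?P n" if "a \<in> ?P n" "b \<in> ?P n" for a b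
        using that Pi[of n] by (simp add: additive_subgroup.a_closed ideal.axioms(1))
      have Psm: "c \<otimes>\<^bsub>R\<^esub> a \<in> ?P n" if "a \<in> ?P n" "c \<in> carrier R" for a c
        using ideal.I_l_closed[OF Pi that] .
      have "g \<in> module_hom R (ideal_module R (?P n)) X"
      proof (rule module_homI; simp add: g(1))
        fix a b assume ab: "a \<in> ?P n" "b \<in> ?P n"
        show "g (a \<oplus>\<^bsub>R\<^esub> b) = g a \<oplus> g b"
        proof (rule uniq)
          fix t assume t: "t \<in> I"
          have "t \<odot> g (a \<oplus>\<^bsub>R\<^esub> b) = f (a \<otimes>\<^bsub>R\<^esub> t \<oplus>\<^bsub>R\<^esub> b \<otimes>\<^bsub>R\<^esub> t)"
            using ab t Pc Ic by (simp flip: g(2) add: Padd X.R.l_distr)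
          also have "\<dots> = t \<odot> (g a \<oplus> g b)"
            using ab t Ic by (simp add: f' prod g X.smult_r_distr)
          finally show "t \<odot> g (a \<oplus>\<^bsub>R\<^esub> b) = t \<odot> (g a \<oplus> g b)" .
        qed (use ab g Padd in auto)
      next
        fix c a assume ca: "c \<in> carrier R" "a \<in> ?P n"
        show "g (c \<otimes>\<^bsub>R\<^esub> a) = c \<odot> g a"
        proof (rule uniq)
          fix t assume t: "t \<in> I"
          have "t \<odot> g (c \<otimes>\<^bsub>R\<^esub> a) = f (c \<otimes>\<^bsub>R\<^esub> (a \<otimes>\<^bsub>R\<^esub> t))"
            using ca t Pc Ic by (simp flip: g(2) add: Psm X.R.m_assoc)
          also have "\<dots> = (c \<otimes>\<^bsub>R\<^esub> t) \<odot> g a"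
            using ca t Ic by (simp add: f' prod g X.smult_assoc1)
          also have "\<dots> = t \<odot> (c \<odot> g a)"
            using ca t Ic g by (simp flip: X.smult_assoc1 add: X.R.m_comm)
          finally show "t \<odot> g (c \<otimes>\<^bsub>R\<^esub> a) = t \<odot> (c \<odot> g a)" .
        qed (use ca g Psm in auto)
      qed
      then obtain x where x: "x \<in> carrier X" "\<And>a. a \<in> ?P n \<Longrightarrow> g a = a \<odot> x"
        using Suc.IH unfolding homs_are_multiplications_def by blast
      have "s \<in> Q \<and> f s = s \<odot> x" if "s \<in> ideal_prod R (?P n) I" for s
        using that
      proof (induction rule: ideal_prod.induct)
        case (prod a t)
        have "f (a \<otimes>\<^bsub>R\<^esub> t) = t \<odot> (a \<odot> x)" using prod x g by simp
        also have "\<dots> = (a \<otimes>\<^bsub>R\<^esub> t) \<odot> x"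
          using prod x Pc Ic by (simp flip: X.smult_assoc1 add: X.R.m_comm)
        finally show ?case using prod by (simp add: Q ideal_prod.prod)
      next
        case (sum s1 s2)
        then have "s1 \<oplus>\<^bsub>R\<^esub> s2 \<in> Q"
          by (simp add: Q ideal_prod.sum)
        then show ?case using sum x Qc f' by (simp add: X.smult_l_distr)
      qed
      then show "\<exists>x\<in>carrier X. \<forall>a\<in>Q. f a = a \<odot> x"
        using x(1) by (auto simp: Q)
    qed
  qed
qed

section \<open>Local cohomology in degrees zero and one\<close>

text \<open>The shape of \<open>local_cohomology\<close>: cycles \<open>Z\<close> modulo boundaries \<open>B\<close>, both inside a term \<open>E\<close> of the
  resolution.\<close>

lemma nonzero_cohomology_iff:
  assumes E: "module R E" and Z: "submodule Z R E" and B: "submodule B R E" "B \<subseteq> Z"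
  shows "nonzero_module (quot_module R (E\<lparr>carrier := Z\<rparr>) B) \<longleftrightarrow> \<not> Z \<subseteq> B"
proof -
  interpret E: module R E by fact
  have mZ: "module R (E\<lparr>carrier := Z\<rparr>)" by (rule submodule.submodule_is_module[OF Z E])
  have "module R ((E\<lparr>carrier := Z\<rparr>)\<lparr>carrier := B\<rparr>)"
    using submodule.submodule_is_module[OF B(1) E] by simp
  then have "submodule B R (E\<lparr>carrier := Z\<rparr>)"
    using B(2) by (intro module.module_incl_imp_submodule[OF mZ]) auto
  then show ?thesis using nonzero_quot_module_iff[OF mZ] by simp
qed

lemma module_hom_torsion_part:
  assumes "module R M" "module R N" "ideal I R" "f \<in> module_hom R M N" "x \<in> torsion_part R I M"
  shows "f x \<in> torsion_part R I N"
proof -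
  interpret M: module R M by fact
  obtain n :: nat where n: "x \<in> carrier M" "\<forall>a\<in>I [^]\<^bsub>ideals_set R\<^esub> n. a \<odot>\<^bsub>M\<^esub> x = \<zero>\<^bsub>M\<^esub>"
    using assms(5) by (auto simp: torsion_part_def)
  have "a \<odot>\<^bsub>N\<^esub> f x = \<zero>\<^bsub>N\<^esub>" if a: "a \<in> I [^]\<^bsub>ideals_set R\<^esub> n" for a
  proof -
    have "a \<in> carrier R"
      using ideal.Icarr[OF ideal_power_is_ideal[OF M.R.is_cring assms(3)] a] .
    then have "a \<odot>\<^bsub>N\<^esub> f x = f (a \<odot>\<^bsub>M\<^esub> x)" using module_homD(3)[OF assms(4)] n by simp
    also have "\<dots> = \<zero>\<^bsub>N\<^esub>" using n a module_hom_zero[OF assms(1,2,4)] by simp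
    finally show ?thesis .
  qed
  then show ?thesis using n module_homD(1)[OF assms(4)] unfolding torsion_part_def by blast
qed

text \<open>The vanishing of \<open>H\<^sup>0\<close>, and of \<open>H\<^sup>1\<close> once \<open>H\<^sup>0\<close> vanishes, in elementary terms. With \<open>X\<close>
  regarded as a submodule of \<open>E\<^sup>0\<close>, a cycle of degree one is the image of some \<open>e \<in> E\<^sup>0\<close> with
  \<open>I\<^sup>n e \<subseteq> X\<close>, and it is a boundary iff \<open>e\<close> differs from an element of \<open>X\<close> by a torsion element;
  each such \<open>e\<close> induces the homomorphism \<open>a \<mapsto> a e\<close> from \<open>I\<^sup>n\<close> to \<open>X\<close>.\<close>

lemma local_cohomology_vanishing:
  fixes X :: "('a, 'm) module"
  assumes noeth: "noetherian_ring R" and X: "module R X" and I: "ideal I R"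
  shows "\<not> nonzero_module (local_cohomology R I X 0) \<longleftrightarrow> socle_free R I X"
    and "socle_free R I X \<Longrightarrow>
      \<not> nonzero_module (local_cohomology R I X 1) \<longleftrightarrow> homs_are_multiplications R I X"
proof -
  interpret X: module R X by fact
  have Ic: "a \<in> carrier R" if "a \<in> I" for a using ideal.Icarr[OF I that] .
  obtain \<epsilon> and E :: "nat \<Rightarrow> ('a, nat \<Rightarrow> 'a + 'm) module" and d where
    Ed: "injective_resolution R X = (E, d)" and res: "is_injective_resolution R X \<epsilon> E d"
    by (rule injective_resolution_spec[OF noeth X])
  have inj: "injective_module R (E i)" for i using res by (simp add: is_injective_resolution_def)
  have mE: "module R (E i)" for i using inj by (simp add: injective_module_def)
  interpret E0: module R "E 0" by (rule mE)
  have d: "d i \<in> module_hom R (E i) (E (Suc i))" for i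
    using res by (simp add: is_injective_resolution_def)
  have \<epsilon>: "\<epsilon> \<in> module_hom R X (E 0)" "inj_on \<epsilon> (carrier X)"
    "\<epsilon> ` carrier X = {e \<in> carrier (E 0). d 0 e = \<zero>\<^bsub>E 1\<^esub>}"
    using res by (simp_all add: is_injective_resolution_def)
  have exact: "d 0 ` carrier (E 0) = {e \<in> carrier (E 1). d 1 e = \<zero>\<^bsub>E 2\<^esub>}"
    using res by (simp add: is_injective_resolution_def numeral_2_eq_2)
  have \<epsilon>0: "x = \<zero>\<^bsub>X\<^esub>" if "x \<in> carrier X" "\<epsilon> x = \<zero>\<^bsub>E 0\<^esub>" for x
    using module_hom_inj_iff[OF X mE \<epsilon>(1)] \<epsilon>(2) that by blast
  have \<epsilon>z: "\<epsilon> \<zero>\<^bsub>X\<^esub> = \<zero>\<^bsub>E 0\<^esub>" by (rule module_hom_zero[OF X mE \<epsilon>(1)])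
  note \<epsilon>' = module_homD[OF \<epsilon>(1)] and d0' = module_homD[OF d[of 0], simplified]
  let ?G = "\<lambda>i. torsion_part R I (E i)"
  have G: "submodule (?G i) R (E i)" for i by (rule torsion_part_submodule[OF mE I])
  let ?Z = "\<lambda>i. {z \<in> ?G i. d i z = \<zero>\<^bsub>E (Suc i)\<^esub>}"
  have Z: "submodule (?Z i) R (E i)" for i
  proof -
    have "?Z i = ?G i \<inter> {x \<in> carrier (E i). d i x = \<zero>\<^bsub>E (Suc i)\<^esub>}"
      using submodule_subset[OF G] by auto
    then show ?thesis using submodule_Int[OF mE G kernel_submodule[OF mE mE d]] by simp
  qed
  have H0: "nonzero_module (local_cohomology R I X 0) \<longleftrightarrow> \<not> ?Z 0 \<subseteq> {\<zero>\<^bsub>E 0\<^esub>}"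
  proof -
    have "submodule {\<zero>\<^bsub>E 0\<^esub>} R (E 0)" by (rule E0.submoduleI) auto
    then show ?thesis
      using nonzero_cohomology_iff[OF mE Z, of "{\<zero>\<^bsub>E 0\<^esub>}" 0] submodule_zero[OF Z[of 0]]
      by (simp add: local_cohomology_def Ed)
  qed
  have H1: "nonzero_module (local_cohomology R I X 1) \<longleftrightarrow> \<not> ?Z 1 \<subseteq> d 0 ` ?G 0"
  proof -
    have "submodule (d 0 ` ?G 0) R (E 1)" using image_submodule[OF mE mE d G, of 0] by simp
    moreover have "d 0 ` ?G 0 \<subseteq> ?Z 1"
    proof (intro subsetI CollectI conjI)
      fix z assume "z \<in> d 0 ` ?G 0"
      then obtain g where g: "g \<in> ?G 0" "z = d 0 g" by blast
      then show "z \<in> ?G 1" using module_hom_torsion_part[OF mE mE I d, of g 0] by simp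
      have "z \<in> d 0 ` carrier (E 0)" using g submodule_subset[OF G] by blast
      then show "d 1 z = \<zero>\<^bsub>E (Suc 1)\<^esub>" using exact by (simp add: numeral_2_eq_2)
    qed
    ultimately show ?thesis
      using nonzero_cohomology_iff[OF mE Z, of "d 0 ` ?G 0" 1]
      by (simp add: local_cohomology_def Ed)
  qed
  have \<epsilon>G: "x \<in> torsion_part R I X" if x: "x \<in> carrier X" "\<epsilon> x \<in> ?G 0" for x
  proof -
    obtain n :: nat where n: "\<forall>a\<in>I [^]\<^bsub>ideals_set R\<^esub> n. a \<odot>\<^bsub>E 0\<^esub> \<epsilon> x = \<zero>\<^bsub>E 0\<^esub>"
      using x(2) by (auto simp: torsion_part_def)
    have "a \<odot>\<^bsub>X\<^esub> x = \<zero>\<^bsub>X\<^esub>" if a: "a \<in> I [^]\<^bsub>ideals_set R\<^esub> n" for a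
    proof -
      have ac: "a \<in> carrier R"
        using ideal.Icarr[OF ideal_power_is_ideal[OF X.R.is_cring I] a] .
      show ?thesis using n a x ac by (intro \<epsilon>0) (simp_all add: \<epsilon>')
    qed
    then show ?thesis using x unfolding torsion_part_def by blast
  qed
  show "\<not> nonzero_module (local_cohomology R I X 0) \<longleftrightarrow> socle_free R I X"
    unfolding H0 not_not
  proof
    assume *: "?Z 0 \<subseteq> {\<zero>\<^bsub>E 0\<^esub>}"
    show "socle_free R I X"
      unfolding socle_free_def
    proof (intro ballI impI)
      fix x assume x: "x \<in> carrier X" "\<forall>a\<in>I. a \<odot>\<^bsub>X\<^esub> x = \<zero>\<^bsub>X\<^esub>"
      have "\<epsilon> x \<in> ?G 0"
        using module_hom_torsion_part[OF X mE I \<epsilon>(1) socle_subset_torsion_part[OF X I x(1)]] x by simp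
      moreover have "d 0 (\<epsilon> x) = \<zero>\<^bsub>E 1\<^esub>" using \<epsilon>(3) x by blast
      ultimately have "\<epsilon> x = \<zero>\<^bsub>E 0\<^esub>" using * by auto
      then show "x = \<zero>\<^bsub>X\<^esub>" using \<epsilon>0 x by blast
    qed
  next
    assume sf: "socle_free R I X"
    show "?Z 0 \<subseteq> {\<zero>\<^bsub>E 0\<^esub>}"
    proof
      fix z assume z: "z \<in> ?Z 0"
      then have "z \<in> \<epsilon> ` carrier X" using \<epsilon>(3) submodule_subset[OF G] by auto
      then obtain x where x: "x \<in> carrier X" "z = \<epsilon> x" by blast
      then have "x = \<zero>\<^bsub>X\<^esub>"
        using socle_free_imp_torsion_part_zero[OF X I sf] \<epsilon>G z by auto
      then show "z \<in> {\<zero>\<^bsub>E 0\<^esub>}" using x \<epsilon>z by simp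
    qed
  qed
  assume sf: "socle_free R I X"
  have G0: "x = \<zero>\<^bsub>X\<^esub>" if "x \<in> carrier X" "\<epsilon> x \<in> ?G 0" for x
    using socle_free_imp_torsion_part_zero[OF X I sf] \<epsilon>G that by blast
  show "\<not> nonzero_module (local_cohomology R I X 1) \<longleftrightarrow> homs_are_multiplications R I X"
    unfolding H1 not_not
  proof
    assume *: "?Z 1 \<subseteq> d 0 ` ?G 0"
    show "homs_are_multiplications R I X"
      unfolding homs_are_multiplications_def
    proof
      fix f assume f: "f \<in> module_hom R (ideal_module R I) X"
      note f' = module_homD[OF f, simplified]
      \<comment> \<open>injectivity of \<open>E 0\<close> is tested on a copy of \<open>R\<close> over the element type of \<open>E 0\<close>\<close>
      let ?k = "\<lambda>a (_::nat). Inl a :: 'a + 'm"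
      have k: "inj_on ?k S" for S by (auto simp: inj_on_def fun_eq_iff)
      let ?B = "transport_module (self_module R) ?k"
      have mB: "module R ?B"
        by (rule transport_module_is_module[OF self_module_is_module[OF X.R.is_cring] k])
      note Bops = transport_module_ops[of ?k "self_module R", OF k, simplified]
      interpret B: module R ?B by (rule mB)
      let ?l = "\<lambda>t. projl (t 0)"
      have subB: "submodule (?k ` I) R ?B"
      proof (rule B.submoduleI)
        show "?k ` I \<subseteq> carrier ?B" using Ic by auto
        show "\<zero>\<^bsub>?B\<^esub> \<in> ?k ` I"
          using I by (simp add: additive_subgroup.zero_closed ideal.axioms(1))
        show add: "x \<oplus>\<^bsub>?B\<^esub> y \<in> ?k ` I" if "x \<in> ?k ` I" "y \<in> ?k ` I" for x y
          using that I Ic by (auto simp: Bops additive_subgroup.a_closed ideal.axioms(1))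
        show sm: "a \<odot>\<^bsub>?B\<^esub> x \<in> ?k ` I" if "a \<in> carrier R" "x \<in> ?k ` I" for a x
          using that I Ic by (auto simp: Bops ideal.I_l_closed)
        show "\<ominus>\<^bsub>?B\<^esub> x \<in> ?k ` I" if "x \<in> ?k ` I" for x
        proof -
          have "x \<in> carrier ?B" using that Ic by auto
          then have "\<ominus>\<^bsub>?B\<^esub> x = (\<ominus>\<^bsub>R\<^esub> \<one>\<^bsub>R\<^esub>) \<odot>\<^bsub>?B\<^esub> x" by (simp add: B.smult_l_minus)
          then show ?thesis using sm[of "\<ominus>\<^bsub>R\<^esub> \<one>\<^bsub>R\<^esub>" x] that by simp
        qed
      qed
      have "(\<lambda>t. \<epsilon> (f (?l t))) \<in> module_hom R (?B\<lparr>carrier := ?k ` I\<rparr>) (E 0)"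
        by (rule module_homI) (use Ic in \<open>auto simp: Bops f' \<epsilon>'\<close>)
      then obtain g where g: "g \<in> module_hom R ?B (E 0)" "\<And>a. a \<in> I \<Longrightarrow> g (?k a) = \<epsilon> (f a)"
        using inj[of 0] mB subB unfolding injective_module_def by fastforce
      define e where "e = g (?k \<one>\<^bsub>R\<^esub>)"
      have e: "e \<in> carrier (E 0)" unfolding e_def using module_homD(1)[OF g(1)] by simp
      have ge: "\<epsilon> (f a) = a \<odot>\<^bsub>E 0\<^esub> e" if a: "a \<in> I" for a
      proof -
        have "\<epsilon> (f a) = g (a \<odot>\<^bsub>?B\<^esub> ?k \<one>\<^bsub>R\<^esub>)" using g(2)[OF a] Ic[OF a] by (simp add: Bops)
        also have "\<dots> = a \<odot>\<^bsub>E 0\<^esub> e"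
          unfolding e_def using module_homD(3)[OF g(1), of a "?k \<one>\<^bsub>R\<^esub>"] Ic[OF a] by simp
        finally show ?thesis .
      qed
      have d\<epsilon>: "d 0 (\<epsilon> x) = \<zero>\<^bsub>E 1\<^esub>" if "x \<in> carrier X" for x using \<epsilon>(3) that by blast
      have "a \<odot>\<^bsub>E 1\<^esub> d 0 e = \<zero>\<^bsub>E 1\<^esub>" if "a \<in> I" for a
        using d0'(3)[OF Ic[OF that] e] ge[OF that] d\<epsilon>[OF f'(1)[OF that]] by simp
      then have "d 0 e \<in> ?G 1"
        using d0'(1)[OF e] by (intro socle_subset_torsion_part[OF mE I]) simp_all
      moreover have "d 1 (d 0 e) = \<zero>\<^bsub>E 2\<^esub>" using exact e by blast
      ultimately have "d 0 e \<in> d 0 ` ?G 0" using * by (auto simp: numeral_2_eq_2)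
      then obtain z where z: "z \<in> ?G 0" "d 0 e = d 0 z" by blast
      have zc: "z \<in> carrier (E 0)" using z(1) submodule_subset[OF G] by blast
      interpret E1: module R "E (Suc 0)" by (rule mE)
      have "d 0 (e \<oplus>\<^bsub>E 0\<^esub> \<ominus>\<^bsub>E 0\<^esub> z) = \<zero>\<^bsub>E 1\<^esub>"
        using e zc z(2) d0'(1)[OF zc] module_hom_minus[OF mE mE d zc]
        by (simp add: d0' E1.r_neg)
      then have "e \<oplus>\<^bsub>E 0\<^esub> \<ominus>\<^bsub>E 0\<^esub> z \<in> \<epsilon> ` carrier X" using \<epsilon>(3) e zc by simp
      then obtain x where x: "x \<in> carrier X" "e \<oplus>\<^bsub>E 0\<^esub> \<ominus>\<^bsub>E 0\<^esub> z = \<epsilon> x" by blast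
      have "f a = a \<odot>\<^bsub>X\<^esub> x" if a: "a \<in> I" for a
      proof -
        note ac = Ic[OF a]
        \<comment> \<open>\<open>f a - a x\<close> is mapped to the torsion element \<open>a z\<close>, hence is torsion itself\<close>
        have "\<epsilon> (f a \<oplus>\<^bsub>X\<^esub> \<ominus>\<^bsub>X\<^esub> (a \<odot>\<^bsub>X\<^esub> x)) = a \<odot>\<^bsub>E 0\<^esub> e \<oplus>\<^bsub>E 0\<^esub> \<ominus>\<^bsub>E 0\<^esub> (a \<odot>\<^bsub>E 0\<^esub> \<epsilon> x)"
          using f'(1)[OF a] x(1) ac by (simp add: \<epsilon>' module_hom_minus[OF X mE \<epsilon>(1)] ge[OF a])
        also have "\<dots> = a \<odot>\<^bsub>E 0\<^esub> (e \<oplus>\<^bsub>E 0\<^esub> \<ominus>\<^bsub>E 0\<^esub> (e \<oplus>\<^bsub>E 0\<^esub> \<ominus>\<^bsub>E 0\<^esub> z))"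
          using e zc ac x by (simp add: E0.smult_r_distr E0.smult_r_minus flip: x(2))
        also have "e \<oplus>\<^bsub>E 0\<^esub> \<ominus>\<^bsub>E 0\<^esub> (e \<oplus>\<^bsub>E 0\<^esub> \<ominus>\<^bsub>E 0\<^esub> z) = z"
          using e zc by (simp add: E0.minus_add flip: E0.a_assoc) (simp add: E0.r_neg)
        also have "a \<odot>\<^bsub>E 0\<^esub> z \<in> ?G 0"
          using submodule.smult_closed[OF G ac z(1)] .
        finally have "f a \<oplus>\<^bsub>X\<^esub> \<ominus>\<^bsub>X\<^esub> (a \<odot>\<^bsub>X\<^esub> x) = \<zero>\<^bsub>X\<^esub>"
          using f'(1)[OF a] x(1) ac by (intro G0) auto
        then show ?thesis
          using f'(1)[OF a] x(1) ac
          by (metis X.minus_equality X.minus_minus X.a_comm X.a_inv_closed X.smult_closed)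
      qed
      with x(1) show "\<exists>x\<in>carrier X. \<forall>a\<in>I. f a = a \<odot>\<^bsub>X\<^esub> x" by blast
    qed
  next
    assume hm: "homs_are_multiplications R I X"
    show "?Z 1 \<subseteq> d 0 ` ?G 0"
    proof
      fix z assume z: "z \<in> ?Z 1"
      then have zc: "z \<in> carrier (E 1)" "d 1 z = \<zero>\<^bsub>E 2\<^esub>"
        using submodule_subset[OF G] by (auto simp: numeral_2_eq_2)
      then have "z \<in> d 0 ` carrier (E 0)" using exact by simp
      then obtain e where e: "e \<in> carrier (E 0)" "z = d 0 e" by blast
      obtain n :: nat where n: "\<forall>a\<in>I [^]\<^bsub>ideals_set R\<^esub> n. a \<odot>\<^bsub>E 1\<^esub> z = \<zero>\<^bsub>E 1\<^esub>"
        using z by (auto simp: torsion_part_def)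
      let ?P = "I [^]\<^bsub>ideals_set R\<^esub> n"
      have P: "ideal ?P R" by (rule ideal_power_is_ideal[OF X.R.is_cring I])
      have Pc: "a \<in> carrier R" if "a \<in> ?P" for a using ideal.Icarr[OF P that] .
      have "\<exists>x\<in>carrier X. \<epsilon> x = a \<odot>\<^bsub>E 0\<^esub> e" if a: "a \<in> ?P" for a
      proof -
        have "d 0 (a \<odot>\<^bsub>E 0\<^esub> e) = \<zero>\<^bsub>E 1\<^esub>" using d0'(3)[OF Pc[OF a] e(1)] n a e(2) by simp
        then have "a \<odot>\<^bsub>E 0\<^esub> e \<in> \<epsilon> ` carrier X" using \<epsilon>(3) Pc[OF a] e(1) by simp
        then show ?thesis by force
      qed
      then obtain f where f: "\<And>a. a \<in> ?P \<Longrightarrow> f a \<in> carrier X" "\<And>a. a \<in> ?P \<Longrightarrow> \<epsilon> (f a) = a \<odot>\<^bsub>E 0\<^esub> e"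
        by metis
      have Padd: "a \<oplus>\<^bsub>R\<^esub> b \<in> ?P" if "a \<in> ?P" "b \<in> ?P" for a b
        using that P by (simp add: additive_subgroup.a_closed ideal.axioms(1))
      have Psm: "c \<otimes>\<^bsub>R\<^esub> a \<in> ?P" if "a \<in> ?P" "c \<in> carrier R" for a c
        using ideal.I_l_closed[OF P that] .
      have "f \<in> module_hom R (ideal_module R ?P) X"
      proof (rule module_homI; simp add: f(1))
        fix a b assume ab: "a \<in> ?P" "b \<in> ?P"
        show "f (a \<oplus>\<^bsub>R\<^esub> b) = f a \<oplus>\<^bsub>X\<^esub> f b"
          by (rule inj_onD[OF \<epsilon>(2)])
            (use ab f Padd Pc e in \<open>simp_all add: \<epsilon>' E0.smult_l_distr\<close>)
      next
        fix c a assume ca: "c \<in> carrier R" "a \<in> ?P"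
        show "f (c \<otimes>\<^bsub>R\<^esub> a) = c \<odot>\<^bsub>X\<^esub> f a"
          by (rule inj_onD[OF \<epsilon>(2)])
            (use ca f Psm Pc e in \<open>simp_all add: \<epsilon>' E0.smult_assoc1\<close>)
      qed
      then obtain x where x: "x \<in> carrier X" "\<And>a. a \<in> ?P \<Longrightarrow> f a = a \<odot>\<^bsub>X\<^esub> x"
        using homs_are_multiplications_power[OF X I sf hm, of n]
        unfolding homs_are_multiplications_def by blast
      define g where "g = e \<oplus>\<^bsub>E 0\<^esub> \<ominus>\<^bsub>E 0\<^esub> \<epsilon> x"
      have gc: "g \<in> carrier (E 0)" using e x \<epsilon>'(1) by (simp add: g_def)
      have "a \<odot>\<^bsub>E 0\<^esub> g = \<zero>\<^bsub>E 0\<^esub>" if a: "a \<in> ?P" for a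
      proof -
        have "a \<odot>\<^bsub>E 0\<^esub> \<epsilon> x = a \<odot>\<^bsub>E 0\<^esub> e"
          using f(2)[OF a] x Pc[OF a] by (simp add: x(2)[OF a] \<epsilon>')
        then show ?thesis
          using e x \<epsilon>'(1) Pc[OF a] by (simp add: g_def E0.smult_r_distr E0.smult_r_minus E0.r_neg)
      qed
      then have "g \<in> ?G 0" using gc unfolding torsion_part_def by blast
      moreover have "d 0 g = z"
      proof -
        interpret E1: module R "E (Suc 0)" by (rule mE)
        have "d 0 (\<epsilon> x) = \<zero>\<^bsub>E 1\<^esub>" using \<epsilon>(3) x by blast
        then have "d 0 (\<ominus>\<^bsub>E 0\<^esub> \<epsilon> x) = \<zero>\<^bsub>E 1\<^esub>"
          using module_hom_minus[OF mE mE d, of "\<epsilon> x" 0] \<epsilon>'(1) x by simp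
        then show ?thesis using e x \<epsilon>'(1) zc by (simp add: g_def d0')
      qed
      ultimately show "z \<in> d 0 ` ?G 0" by blast
    qed
  qed
qed

lemma depth_ge_iff:
  "enat n \<le> depth R I X \<longleftrightarrow> (\<forall>i<n. \<not> nonzero_module (local_cohomology R I X i))"
proof -
  have "enat n \<le> depth R I X \<longleftrightarrow> (\<forall>i. nonzero_module (local_cohomology R I X i) \<longrightarrow> n \<le> i)"
    unfolding depth_def by (auto simp: le_Inf_iff)
  then show ?thesis by (auto simp: not_le[symmetric])
qed

lemma depth_ge_1_iff:
  assumes "noetherian_ring R" "module R X" "ideal I R"
  shows "depth R I X \<ge> 1 \<longleftrightarrow> socle_free R I X"
  using depth_ge_iff[of 1 R I X] local_cohomology_vanishing(1)[OF assms] by (simp add: one_enat_def)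

lemma depth_ge_2_iff:
  assumes "noetherian_ring R" "module R X" "ideal I R"
  shows "depth R I X \<ge> 2 \<longleftrightarrow> socle_free R I X \<and> homs_are_multiplications R I X"
  using depth_ge_iff[of 2 R I X] local_cohomology_vanishing[OF assms]
  by (auto simp: numeral_eq_enat less_2_cases_iff)

section \<open>Free modules\<close>

lemma free_module_simps [simp]:
  "\<zero>\<^bsub>free_module R S\<^esub> = (\<lambda>s. \<zero>\<^bsub>R\<^esub>)"
  "f \<oplus>\<^bsub>free_module R S\<^esub> g = (\<lambda>s. f s \<oplus>\<^bsub>R\<^esub> g s)"
  "a \<odot>\<^bsub>free_module R S\<^esub> f = (\<lambda>s. a \<otimes>\<^bsub>R\<^esub> f s)"
  by (simp_all add: free_module_def)

lemma free_module_carrier_iff: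
  "f \<in> carrier (free_module R S) \<longleftrightarrow> (\<forall>s\<in>S. f s \<in> carrier R) \<and> (\<forall>s. s \<notin> S \<longrightarrow> f s = \<zero>\<^bsub>R\<^esub>) \<and>
     finite {s. f s \<noteq> \<zero>\<^bsub>R\<^esub>}"
  by (simp add: free_module_def)

lemma free_module_closed:
  assumes "cring R" "f \<in> carrier (free_module R S)"
  shows "f s \<in> carrier R"
proof -
  interpret cring R by fact
  show ?thesis using assms(2) by (cases "s \<in> S") (auto simp: free_module_carrier_iff)
qed

lemma free_module_is_module:
  fixes R :: "('a, 'r) ring_scheme" and S :: "'s set"
  assumes "cring R"
  shows "module R (free_module R S)"
proof -
  interpret cring R by fact
  note c = free_module_closed[OF assms]
  have sub: "finite {s. h s \<noteq> \<zero>\<^bsub>R\<^esub>}" if "finite {s. f s \<noteq> \<zero>\<^bsub>R\<^esub>}" "finite {s. g s \<noteq> \<zero>\<^bsub>R\<^esub>}"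
    "\<And>s. f s = \<zero>\<^bsub>R\<^esub> \<Longrightarrow> g s = \<zero>\<^bsub>R\<^esub> \<Longrightarrow> h s = \<zero>\<^bsub>R\<^esub>" for f g h :: "'s \<Rightarrow> 'a"
    by (rule finite_subset[of _ "{s. f s \<noteq> \<zero>\<^bsub>R\<^esub>} \<union> {s. g s \<noteq> \<zero>\<^bsub>R\<^esub>}"]) (use that in auto)
  show ?thesis
  proof (intro moduleI abelian_groupI assms)
    fix f assume f: "f \<in> carrier (free_module R S)"
    have "(\<lambda>s. \<ominus>\<^bsub>R\<^esub> f s) \<in> carrier (free_module R S)"
      using f sub[of f f "\<lambda>s. \<ominus>\<^bsub>R\<^esub> f s"] by (auto simp: free_module_carrier_iff)
    moreover have "\<ominus>\<^bsub>R\<^esub> f s \<oplus>\<^bsub>R\<^esub> f s = \<zero>\<^bsub>R\<^esub>" for s using c[OF f] by (simp add: l_neg)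
    ultimately show "\<exists>g\<in>carrier (free_module R S). g \<oplus>\<^bsub>free_module R S\<^esub> f = \<zero>\<^bsub>free_module R S\<^esub>"
      by (intro bexI[of _ "\<lambda>s. \<ominus>\<^bsub>R\<^esub> f s"]) auto
  next
    fix f g assume "f \<in> carrier (free_module R S)" "g \<in> carrier (free_module R S)"
    then show "f \<oplus>\<^bsub>free_module R S\<^esub> g \<in> carrier (free_module R S)"
      using sub[of f g "\<lambda>s. f s \<oplus>\<^bsub>R\<^esub> g s"] by (auto simp: free_module_carrier_iff)
  next
    fix a f assume "a \<in> carrier R" "f \<in> carrier (free_module R S)"
    then show "a \<odot>\<^bsub>free_module R S\<^esub> f \<in> carrier (free_module R S)"
      using sub[of f f "\<lambda>s. a \<otimes>\<^bsub>R\<^esub> f s"] by (auto simp: free_module_carrier_iff)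
  next
    show "\<zero>\<^bsub>free_module R S\<^esub> \<in> carrier (free_module R S)" by (simp add: free_module_carrier_iff)
  qed (auto simp: fun_eq_iff c a_ac m_assoc l_distr r_distr)
qed

lemma free_basis_closed:
  assumes "cring R" "s \<in> S"
  shows "free_basis R s \<in> carrier (free_module R S)"
proof -
  interpret cring R by fact
  have "finite {t. free_basis R s t \<noteq> \<zero>\<^bsub>R\<^esub>}"
    by (rule finite_subset[of _ "{s}"]) (auto simp: free_basis_def)
  then show ?thesis using assms(2) by (auto simp: free_module_carrier_iff free_basis_def)
qed

lemma free_module_spanned:
  assumes R: "cring R" and H: "submodule H R (free_module R S)"
    and basis: "\<And>s. s \<in> S \<Longrightarrow> free_basis R s \<in> H"
  shows "carrier (free_module R S) \<subseteq> H"
proof -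
  interpret R: cring R by fact
  let ?F = "free_module R S"
  interpret F: module R ?F by (rule free_module_is_module[OF R])
  have "\<forall>f\<in>carrier ?F. {s. f s \<noteq> \<zero>\<^bsub>R\<^esub>} \<subseteq> T \<longrightarrow> f \<in> H" if "finite T" for T
    using that
  proof (induction T)
    case empty
    have "f = \<zero>\<^bsub>?F\<^esub>" if "{s. f s \<noteq> \<zero>\<^bsub>R\<^esub>} \<subseteq> {}" for f using that by (auto simp: fun_eq_iff)
    then show ?case using submodule_zero[OF H] by metis
  next
    case (insert t T)
    show ?case
    proof (intro ballI impI)
      fix f assume f: "f \<in> carrier ?F" and supp: "{s. f s \<noteq> \<zero>\<^bsub>R\<^esub>} \<subseteq> insert t T"
      note fc = free_module_closed[OF R f]
      show "f \<in> H"
      proof (cases "t \<in> S")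
        case False
        then have "f t = \<zero>\<^bsub>R\<^esub>" using f by (simp add: free_module_carrier_iff)
        then show ?thesis using insert.IH f supp by blast
      next
        case True
        have "{s. (f(t := \<zero>\<^bsub>R\<^esub>)) s \<noteq> \<zero>\<^bsub>R\<^esub>} \<subseteq> {s. f s \<noteq> \<zero>\<^bsub>R\<^esub>}" by auto
        then have "finite {s. (f(t := \<zero>\<^bsub>R\<^esub>)) s \<noteq> \<zero>\<^bsub>R\<^esub>}"
          by (rule finite_subset) (use f in \<open>simp add: free_module_carrier_iff\<close>)
        then have "f(t := \<zero>\<^bsub>R\<^esub>) \<in> carrier ?F"
          using f by (simp add: free_module_carrier_iff)
        moreover have "{s. (f(t := \<zero>\<^bsub>R\<^esub>)) s \<noteq> \<zero>\<^bsub>R\<^esub>} \<subseteq> T" using supp by auto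
        ultimately have "f(t := \<zero>\<^bsub>R\<^esub>) \<in> H" using insert.IH by blast
        moreover have "f t \<odot>\<^bsub>?F\<^esub> free_basis R t \<in> H"
          using submodule.smult_closed[OF H fc basis[OF True]] .
        ultimately have "f t \<odot>\<^bsub>?F\<^esub> free_basis R t \<oplus>\<^bsub>?F\<^esub> f(t := \<zero>\<^bsub>R\<^esub>) \<in> H"
          by (intro F.submoduleE(5)[OF H])
        also have "f t \<odot>\<^bsub>?F\<^esub> free_basis R t \<oplus>\<^bsub>?F\<^esub> f(t := \<zero>\<^bsub>R\<^esub>) = f"
          using fc by (auto simp: fun_eq_iff free_basis_def)
        finally show ?thesis .
      qed
    qed
  qed
  then show ?thesis by (auto simp: free_module_carrier_iff)
qed

lemma free_module_lift:
  assumes W: "module R W" and g: "\<And>s. s \<in> S \<Longrightarrow> g s \<in> carrier W"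
  obtains h where "h \<in> module_hom R (free_module R S) W" "\<And>s. s \<in> S \<Longrightarrow> h (free_basis R s) = g s"
proof -
  interpret W: module R W by fact
  let ?F = "free_module R S"
  define h where "h f = (\<Oplus>\<^bsub>W\<^esub>s\<in>{s. f s \<noteq> \<zero>\<^bsub>R\<^esub>}. f s \<odot>\<^bsub>W\<^esub> g s)" for f
  note c = free_module_closed[OF W.R.is_cring]
  have supp: "{s. f s \<noteq> \<zero>\<^bsub>R\<^esub>} \<subseteq> S" "finite {s. f s \<noteq> \<zero>\<^bsub>R\<^esub>}" if "f \<in> carrier ?F" for f
    using that by (auto simp: free_module_carrier_iff)
  have h: "h f = (\<Oplus>\<^bsub>W\<^esub>s\<in>T. f s \<odot>\<^bsub>W\<^esub> g s)" if "f \<in> carrier ?F" "finite T" "T \<subseteq> S" "{s. f s \<noteq> \<zero>\<^bsub>R\<^esub>} \<subseteq> T" for f T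
    unfolding h_def
    by (rule W.add.finprod_mono_neutral_cong_left) (use that c[OF that(1)] g in \<open>auto simp: subset_iff\<close>)
  have "h \<in> module_hom R ?F W"
  proof (rule module_homI)
    show "h f \<in> carrier W" if "f \<in> carrier ?F" for f
      unfolding h_def using supp[OF that] c[OF that] g by (intro W.finsum_closed) auto
  next
    fix f f' assume f: "f \<in> carrier ?F" and f': "f' \<in> carrier ?F"
    interpret F: module R ?F by (rule free_module_is_module[OF W.R.is_cring])
    let ?T = "{s. f s \<noteq> \<zero>\<^bsub>R\<^esub>} \<union> {s. f' s \<noteq> \<zero>\<^bsub>R\<^esub>}"
    have T: "finite ?T" "?T \<subseteq> S" using supp[OF f] supp[OF f'] by auto
    have gT: "g s \<in> carrier W" if "s \<in> ?T" for s using g T(2) that by blast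
    have "h (f \<oplus>\<^bsub>?F\<^esub> f') = (\<Oplus>\<^bsub>W\<^esub>s\<in>?T. (f s \<oplus>\<^bsub>R\<^esub> f' s) \<odot>\<^bsub>W\<^esub> g s)"
      by (subst h[OF F.M.a_closed[OF f f'] T]) auto
    also have "\<dots> = (\<Oplus>\<^bsub>W\<^esub>s\<in>?T. f s \<odot>\<^bsub>W\<^esub> g s \<oplus>\<^bsub>W\<^esub> f' s \<odot>\<^bsub>W\<^esub> g s)"
      by (rule W.finsum_cong') (use gT c[OF f] c[OF f'] in \<open>auto simp: W.smult_l_distr\<close>)
    also have "\<dots> = (\<Oplus>\<^bsub>W\<^esub>s\<in>?T. f s \<odot>\<^bsub>W\<^esub> g s) \<oplus>\<^bsub>W\<^esub> (\<Oplus>\<^bsub>W\<^esub>s\<in>?T. f' s \<odot>\<^bsub>W\<^esub> g s)"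
      by (rule W.finsum_addf) (use gT c[OF f] c[OF f'] in auto)
    also have "\<dots> = h f \<oplus>\<^bsub>W\<^esub> h f'"
      using h[OF f T] h[OF f' T] by simp
    finally show "h (f \<oplus>\<^bsub>?F\<^esub> f') = h f \<oplus>\<^bsub>W\<^esub> h f'" .
  next
    fix a f assume a: "a \<in> carrier R" and f: "f \<in> carrier ?F"
    interpret F: module R ?F by (rule free_module_is_module[OF W.R.is_cring])
    let ?T = "{s. f s \<noteq> \<zero>\<^bsub>R\<^esub>}"
    note T = supp(2,1)[OF f]
    have gT: "g s \<in> carrier W" if "s \<in> ?T" for s using g T(2) that by blast
    have "h (a \<odot>\<^bsub>?F\<^esub> f) = (\<Oplus>\<^bsub>W\<^esub>s\<in>?T. (a \<otimes>\<^bsub>R\<^esub> f s) \<odot>\<^bsub>W\<^esub> g s)"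
      by (subst h[OF F.smult_closed[OF a f] T]) (use a in auto)
    also have "\<dots> = (\<Oplus>\<^bsub>W\<^esub>s\<in>?T. a \<odot>\<^bsub>W\<^esub> (f s \<odot>\<^bsub>W\<^esub> g s))"
      by (rule W.finsum_cong') (use gT c[OF f] a in \<open>auto simp: W.smult_assoc1\<close>)
    also have "\<dots> = a \<odot>\<^bsub>W\<^esub> h f"
      unfolding h_def by (rule W.finsum_smult_ldistr[symmetric]) (use T gT c[OF f] a in auto)
    finally show "h (a \<odot>\<^bsub>?F\<^esub> f) = a \<odot>\<^bsub>W\<^esub> h f" .
  qed
  moreover have "h (free_basis R s) = g s" if s: "s \<in> S" for s
  proof -
    have "h (free_basis R s) = (\<Oplus>\<^bsub>W\<^esub>t\<in>{s}. free_basis R s t \<odot>\<^bsub>W\<^esub> g t)"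
      by (rule h[OF free_basis_closed[OF W.R.is_cring s]]) (use s in \<open>auto simp: free_basis_def\<close>)
    also have "\<dots> = g s" using g[OF s] by (simp add: free_basis_def)
    finally show ?thesis .
  qed
  ultimately show thesis by (rule that)
qed

section \<open>Tensor products\<close>

text \<open>The image of \<open>(x, y)\<close> in the tensor product.\<close>

definition pure_tensor ::
    "('a, 'r) ring_scheme \<Rightarrow> ('a, 'm) module \<Rightarrow> ('a, 'n) module \<Rightarrow> 'm \<Rightarrow> 'n \<Rightarrow> ('m \<times> 'n \<Rightarrow> 'a) set" where
  "pure_tensor R M N x y =
     (let F = free_module R (carrier M \<times> carrier N)
      in submodule_span R F (tensor_relations R M N) +>\<^bsub>F\<^esub> free_basis R (x, y))"

text \<open>The tensor product of two modules, with \<open>F\<close> for the free module on pairs and \<open>K\<close> for the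
  submodule of relations.\<close>

locale tensor = M: module R M + N: module R N
  for R :: "('a, 'r) ring_scheme" and M :: "('a, 'm) module" and N :: "('a, 'n) module"
begin

definition F where "F = free_module R (carrier M \<times> carrier N)"

definition K where "K = submodule_span R F (tensor_relations R M N)"

abbreviation T where "T \<equiv> tensor_module R M N"

lemma T_eq: "T = quot_module R F K"
  by (simp add: tensor_module_def F_def K_def Let_def)

lemma pure_eq: "pure_tensor R M N x y = K +>\<^bsub>F\<^esub> free_basis R (x, y)"
  by (simp add: pure_tensor_def F_def K_def Let_def)

lemma F_module: "module R F"
  unfolding F_def by (rule free_module_is_module[OF M.R.is_cring])

sublocale F: module R F by (rule F_module)

lemma basis_closed [simp]:
  "x \<in> carrier M \<Longrightarrow> y \<in> carrier N \<Longrightarrow> free_basis R (x, y) \<in> carrier F"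
  unfolding F_def by (rule free_basis_closed[OF M.R.is_cring]) simp

lemma tensor_relations_closed: "tensor_relations R M N \<subseteq> carrier F"
  unfolding tensor_relations_def Let_def by (fold F_def) auto

lemma K_submodule: "submodule K R F"
  unfolding K_def by (rule submodule_span_submodule[OF F_module tensor_relations_closed])

lemma tensor_is_module: "module R T"
  unfolding T_eq by (rule quot_module_is_module[OF F_module K_submodule])

lemma pure_closed [simp]:
  "x \<in> carrier M \<Longrightarrow> y \<in> carrier N \<Longrightarrow> pure_tensor R M N x y \<in> carrier T"
  by (simp add: T_eq pure_eq)

lemma relations_subset_K: "tensor_relations R M N \<subseteq> K"
  unfolding K_def by (rule submodule_span_superset)

lemma relation_in_K:
  "x \<in> carrier M \<Longrightarrow> x' \<in> carrier M \<Longrightarrow> y \<in> carrier N \<Longrightarrow>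
    free_basis R (x \<oplus>\<^bsub>M\<^esub> x', y) \<ominus>\<^bsub>F\<^esub> (free_basis R (x, y) \<oplus>\<^bsub>F\<^esub> free_basis R (x', y)) \<in> K"
  "x \<in> carrier M \<Longrightarrow> y \<in> carrier N \<Longrightarrow> y' \<in> carrier N \<Longrightarrow>
    free_basis R (x, y \<oplus>\<^bsub>N\<^esub> y') \<ominus>\<^bsub>F\<^esub> (free_basis R (x, y) \<oplus>\<^bsub>F\<^esub> free_basis R (x, y')) \<in> K"
  "a \<in> carrier R \<Longrightarrow> x \<in> carrier M \<Longrightarrow> y \<in> carrier N \<Longrightarrow>
    free_basis R (a \<odot>\<^bsub>M\<^esub> x, y) \<ominus>\<^bsub>F\<^esub> (a \<odot>\<^bsub>F\<^esub> free_basis R (x, y)) \<in> K"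
  "a \<in> carrier R \<Longrightarrow> x \<in> carrier M \<Longrightarrow> y \<in> carrier N \<Longrightarrow>
    free_basis R (x, a \<odot>\<^bsub>N\<^esub> y) \<ominus>\<^bsub>F\<^esub> (a \<odot>\<^bsub>F\<^esub> free_basis R (x, y)) \<in> K"
  by (rule subsetD[OF relations_subset_K],
      unfold tensor_relations_def Let_def, fold F_def, blast)+

lemma pure_bilinear:
  "x \<in> carrier M \<Longrightarrow> x' \<in> carrier M \<Longrightarrow> y \<in> carrier N \<Longrightarrow>
    pure_tensor R M N (x \<oplus>\<^bsub>M\<^esub> x') y = pure_tensor R M N x y \<oplus>\<^bsub>T\<^esub> pure_tensor R M N x' y"
  "x \<in> carrier M \<Longrightarrow> y \<in> carrier N \<Longrightarrow> y' \<in> carrier N \<Longrightarrow>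
    pure_tensor R M N x (y \<oplus>\<^bsub>N\<^esub> y') = pure_tensor R M N x y \<oplus>\<^bsub>T\<^esub> pure_tensor R M N x y'"
  "a \<in> carrier R \<Longrightarrow> x \<in> carrier M \<Longrightarrow> y \<in> carrier N \<Longrightarrow>
    pure_tensor R M N (a \<odot>\<^bsub>M\<^esub> x) y = a \<odot>\<^bsub>T\<^esub> pure_tensor R M N x y"
  "a \<in> carrier R \<Longrightarrow> x \<in> carrier M \<Longrightarrow> y \<in> carrier N \<Longrightarrow>
    pure_tensor R M N x (a \<odot>\<^bsub>N\<^esub> y) = a \<odot>\<^bsub>T\<^esub> pure_tensor R M N x y"
  unfolding T_eq pure_eq
  by (simp_all add: quot_module_ops[OF F_module K_submodule]
      quot_module_eqI[OF F_module K_submodule] relation_in_K)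

lemma tensor_spanned:
  assumes H: "submodule H R T"
    and pure: "\<And>x y. x \<in> carrier M \<Longrightarrow> y \<in> carrier N \<Longrightarrow> pure_tensor R M N x y \<in> H"
  shows "carrier T \<subseteq> H"
proof -
  note proj = module_homD[OF quot_module_proj_hom[OF F_module K_submodule], folded T_eq]
  interpret T: module R T by (rule tensor_is_module)
  note H' = T.submoduleE[OF H]
  have "submodule {f \<in> carrier F. K +>\<^bsub>F\<^esub> f \<in> H} R F"
  proof (rule F.submoduleI)
    show "\<ominus>\<^bsub>F\<^esub> f \<in> {f \<in> carrier F. K +>\<^bsub>F\<^esub> f \<in> H}" if "f \<in> {f \<in> carrier F. K +>\<^bsub>F\<^esub> f \<in> H}" for f
      using that H'(3) module_hom_minus[OF F_module _ quot_module_proj_hom[OF F_module K_submodule], folded T_eq,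
          OF tensor_is_module, of f] by simp
    show "\<zero>\<^bsub>F\<^esub> \<in> {f \<in> carrier F. K +>\<^bsub>F\<^esub> f \<in> H}"
      using submodule_zero[OF H] module_hom_zero[OF F_module _ quot_module_proj_hom[OF F_module K_submodule], folded T_eq,
          OF tensor_is_module] by simp
  qed (use proj H'(4,5) in auto)
  then have "carrier F \<subseteq> {f \<in> carrier F. K +>\<^bsub>F\<^esub> f \<in> H}"
    by (rule free_module_spanned[OF M.R.is_cring, where S = "carrier M \<times> carrier N", folded F_def])
      (use pure in \<open>auto simp: pure_eq\<close>)
  then show ?thesis by (auto simp: T_eq)
qed

text \<open>The universal property: bilinear maps factor through the tensor product.\<close>

lemma tensor_lift:
  assumes W: "module R W"
    and cl: "\<And>x y. x \<in> carrier M \<Longrightarrow> y \<in> carrier N \<Longrightarrow> \<beta> x y \<in> carrier W"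
    and bil: "\<And>x x' y. x \<in> carrier M \<Longrightarrow> x' \<in> carrier M \<Longrightarrow> y \<in> carrier N \<Longrightarrow> \<beta> (x \<oplus>\<^bsub>M\<^esub> x') y = \<beta> x y \<oplus>\<^bsub>W\<^esub> \<beta> x' y"
      "\<And>x y y'. x \<in> carrier M \<Longrightarrow> y \<in> carrier N \<Longrightarrow> y' \<in> carrier N \<Longrightarrow> \<beta> x (y \<oplus>\<^bsub>N\<^esub> y') = \<beta> x y \<oplus>\<^bsub>W\<^esub> \<beta> x y'"
      "\<And>a x y. a \<in> carrier R \<Longrightarrow> x \<in> carrier M \<Longrightarrow> y \<in> carrier N \<Longrightarrow> \<beta> (a \<odot>\<^bsub>M\<^esub> x) y = a \<odot>\<^bsub>W\<^esub> \<beta> x y"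
      "\<And>a x y. a \<in> carrier R \<Longrightarrow> x \<in> carrier M \<Longrightarrow> y \<in> carrier N \<Longrightarrow> \<beta> x (a \<odot>\<^bsub>N\<^esub> y) = a \<odot>\<^bsub>W\<^esub> \<beta> x y"
  obtains h where "h \<in> module_hom R T W"
    "\<And>x y. x \<in> carrier M \<Longrightarrow> y \<in> carrier N \<Longrightarrow> h (pure_tensor R M N x y) = \<beta> x y"
proof -
  interpret W: module R W by fact
  obtain l where l: "l \<in> module_hom R F W"
    "\<And>s. s \<in> carrier M \<times> carrier N \<Longrightarrow> l (free_basis R s) = case_prod \<beta> s"
    using free_module_lift[OF W, of "carrier M \<times> carrier N" "case_prod \<beta>", folded F_def] cl by auto
  note l' = module_homD[OF l(1)] and lm = module_hom_minus[OF F_module W l(1)]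
  have lb: "l (free_basis R (x, y)) = \<beta> x y" if "x \<in> carrier M" "y \<in> carrier N" for x y
    using l(2)[of "(x, y)"] that by simp
  have "tensor_relations R M N \<subseteq> {f \<in> carrier F. l f = \<zero>\<^bsub>W\<^esub>}"
    unfolding tensor_relations_def Let_def
    by (fold F_def) (auto simp: a_minus_def l' lm lb bil cl W.r_neg)
  then have "K \<subseteq> {f \<in> carrier F. l f = \<zero>\<^bsub>W\<^esub>}"
    unfolding K_def by (rule submodule_span_minimal[OF kernel_submodule[OF F_module W l(1)]])
  then obtain h where "h \<in> module_hom R T W" "\<And>f. f \<in> carrier F \<Longrightarrow> h (K +>\<^bsub>F\<^esub> f) = l f"
    using quot_module_lift[OF F_module K_submodule W l(1)] unfolding T_eq by blast
  then show thesis using lb by (intro that[of h]) (simp_all add: pure_eq)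
qed

end

section \<open>Nakayama over a noetherian local ring\<close>

lemma noetherian_maximal_element:
  assumes "noetherian_ring R" "A \<noteq> {}" "\<And>J. J \<in> A \<Longrightarrow> ideal J R"
  obtains L where "L \<in> A" "\<And>J. J \<in> A \<Longrightarrow> L \<subseteq> J \<Longrightarrow> J = L"
proof -
  have "\<Union>C \<in> A" if C: "C \<noteq> {}" "subset.chain A C" for C
  proof -
    have "subset.chain {I. ideal I R} C" using C(2) assms(3) by (auto simp: subset.chain_def)
    then have "\<Union>C \<in> C" by (rule noetherian_ring.ideal_chain_is_trivial[OF assms(1) C(1)])
    then show ?thesis using C(2) by (auto simp: subset.chain_def)
  qed
  from subset_Zorn_nonempty[OF assms(2) this] show thesis using that by blast
qed

lemma local_ring_unit:
  fixes R (structure)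
  assumes loc: "local_ring R \<mm>" and noeth: "noetherian_ring R"
    and u: "u \<in> carrier R" "u \<notin> \<mm>"
  obtains v where "v \<in> carrier R" "v \<otimes> u = \<one>"
proof -
  interpret cring R using loc by (simp add: local_ring_def)
  have "\<one> \<in> PIdl u"
  proof (rule ccontr)
    assume n: "\<one> \<notin> PIdl u"
    obtain L where L: "L \<in> {J. ideal J R \<and> PIdl u \<subseteq> J \<and> \<one> \<notin> J}"
      "\<And>J. J \<in> {J. ideal J R \<and> PIdl u \<subseteq> J \<and> \<one> \<notin> J} \<Longrightarrow> L \<subseteq> J \<Longrightarrow> J = L"
      by (rule noetherian_maximal_element[OF noeth, of "{J. ideal J R \<and> PIdl u \<subseteq> J \<and> \<one> \<notin> J}"])
        (use n cgenideal_ideal[OF u(1)] in auto)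
    have "maximalideal L R"
    proof (rule maximalidealI)
      show "ideal L R" using L(1) by simp
      show "carrier R \<noteq> L" using L(1) by auto
      fix J assume J: "ideal J R" "L \<subseteq> J" "J \<subseteq> carrier R"
      show "J = L \<or> J = carrier R"
      proof (cases "\<one> \<in> J")
        case True
        then show ?thesis using ideal.one_imp_carrier[OF J(1)] by simp
      next
        case False
        then show ?thesis using L J by auto
      qed
    qed
    then have "L = \<mm>" using loc by (simp add: local_ring_def)
    then show False using L(1) u cgenideal_self[OF u(1)] by auto
  qed
  then show thesis using that by (auto simp: cgenideal_def)
qed

text \<open>A form of Nakayama's lemma that avoids generators: a nonzero ideal \<open>I\<close> has a proper subideal that
  contains \<open>\<mm> I\<close>. A maximal proper subideal \<open>L\<close> has this property, for if \<open>a x \<notin> L\<close> with \<open>a \<in> \<mm>\<close>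
  and \<open>x \<in> I\<close>, then \<open>x \<in> L + R a x\<close> and hence \<open>(1 - r a) x \<in> L\<close> for some \<open>r\<close>, where
  \<open>1 - r a\<close> is a unit.\<close>

lemma nakayama_subideal:
  fixes R (structure)
  assumes loc: "local_ring R \<mm>" and noeth: "noetherian_ring R"
    and I: "ideal I R" "I \<noteq> {\<zero>}"
  obtains L where "ideal L R" "L \<subset> I" "\<And>a x. a \<in> \<mm> \<Longrightarrow> x \<in> I \<Longrightarrow> a \<otimes> x \<in> L"
proof -
  interpret R: cring R using loc by (simp add: local_ring_def)
  have max: "maximalideal \<mm> R" using loc by (simp add: local_ring_def)
  have mm: "ideal \<mm> R" using max by (rule maximalideal.axioms(1))
  have I0: "\<zero> \<in> I" using I(1) by (simp add: additive_subgroup.zero_closed ideal.axioms(1))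
  have mmc: "a \<in> carrier R" if "a \<in> \<mm>" for a using ideal.Icarr[OF mm that] .
  have Ic: "a \<in> carrier R" if "a \<in> I" for a using ideal.Icarr[OF I(1) that] .
  have one: "\<one> \<notin> \<mm>"
    using maximalideal.I_notcarr[OF max] ideal.one_imp_carrier[OF mm] by auto
  obtain L where L: "L \<in> {J. ideal J R \<and> J \<subset> I}" "\<And>J. J \<in> {J. ideal J R \<and> J \<subset> I} \<Longrightarrow> L \<subseteq> J \<Longrightarrow> J = L"
    by (rule noetherian_maximal_element[OF noeth, of "{J. ideal J R \<and> J \<subset> I}"])
      (use R.zeroideal I(2) I0 in auto)
  then have Li: "ideal L R" "L \<subset> I" by auto
  interpret L: ideal L R by (rule Li(1))
  show thesis
  proof (rule that[OF Li])
    fix a x assume a: "a \<in> \<mm>" and x: "x \<in> I"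
    note c = mmc[OF a] Ic[OF x]
    have ax: "a \<otimes> x \<in> I" using ideal.I_l_closed[OF I(1) x c(1)] .
    show "a \<otimes> x \<in> L"
    proof (rule ccontr)
      assume n: "a \<otimes> x \<notin> L"
      let ?P = "PIdl (a \<otimes> x)"
      let ?J = "L <+>\<^bsub>R\<^esub> ?P"
      have P: "ideal ?P R" using c by (intro R.cgenideal_ideal) simp
      have J: "ideal ?J R" by (rule R.add_ideals[OF Li(1) P])
      have P0: "\<zero> \<in> ?P" using P by (simp add: additive_subgroup.zero_closed ideal.axioms(1))
      have Pself: "a \<otimes> x \<in> ?P" using c by (intro R.cgenideal_self) simp
      have JI: "l \<oplus> q \<in> ?J" if "l \<in> L" "q \<in> ?P" for l q
        using that by (auto simp: set_add_def')
      have "?P \<subseteq> I" using R.cgenideal_minimal[OF I(1) ax] .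
      then have "?J \<subseteq> I"
        using Li(2) I(1) by (auto simp: set_add_def' additive_subgroup.a_closed ideal.axioms(1) psubset_eq subset_iff)
      moreover have "L \<subseteq> ?J"
      proof
        fix l assume l: "l \<in> L"
        then show "l \<in> ?J" using JI[OF l P0] by simp
      qed
      moreover have "a \<otimes> x \<in> ?J" using JI[OF L.zero_closed Pself] c by simp
      ultimately have "?J = I" using L(2)[of ?J] J n by blast
      then have "x \<in> ?J" using x by simp
      then obtain l r where lr: "l \<in> L" "r \<in> carrier R" "x = l \<oplus> r \<otimes> (a \<otimes> x)"
        by (auto simp: set_add_def' cgenideal_def)
      define u where "u = \<one> \<ominus> r \<otimes> a"
      have uc: "u \<in> carrier R" using lr c by (simp add: u_def)
      have ra: "r \<otimes> a \<in> \<mm>" using ideal.I_l_closed[OF mm a lr(2)] .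
      have "u \<oplus> r \<otimes> a = \<one>"
        using lr c by (simp add: u_def a_minus_def R.a_assoc R.l_neg)
      then have "u \<notin> \<mm>"
        using one ra additive_subgroup.a_closed[OF ideal.axioms(1)[OF mm], of u "r \<otimes> a"] by auto
      then obtain v where v: "v \<in> carrier R" "v \<otimes> u = \<one>"
        by (rule local_ring_unit[OF loc noeth uc])
      have lc: "l \<in> carrier R" using lr(1) by simp
      have "u \<otimes> x = x \<ominus> r \<otimes> (a \<otimes> x)"
        using lr(2) c by (simp add: u_def a_minus_def R.l_distr R.l_minus R.m_assoc)
      also have "\<dots> = (l \<oplus> r \<otimes> (a \<otimes> x)) \<ominus> r \<otimes> (a \<otimes> x)"
        using lr(3) by simp
      also have "\<dots> = l" using lr(2) c lc by (simp add: a_minus_def R.a_assoc R.r_neg)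
      finally have ul: "u \<otimes> x = l" .
      have "x = v \<otimes> (u \<otimes> x)" using v uc c by (simp flip: R.m_assoc)
      then have "x \<in> L" using ul L.I_l_closed[OF lr(1) v(1)] by simp
      then show False using n L.I_l_closed[OF _ c(1)] by blast
    qed
  qed
qed

section \<open>Torsionless modules\<close>

lemma torsionless_separated:
  assumes U: "module R U" and tl: "torsionless R U" and u: "u \<in> carrier U" "u \<noteq> \<zero>\<^bsub>U\<^esub>"
  obtains f where "f \<in> module_hom R U (self_module R)" "f u \<noteq> \<zero>\<^bsub>R\<^esub>"
proof -
  interpret U: module R U by fact
  note mS = self_module_is_module[OF U.R.is_cring]
  have "\<exists>f\<in>module_hom R U (self_module R). f u \<noteq> \<zero>\<^bsub>R\<^esub>"
  proof (rule ccontr)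
    assume "\<not> ?thesis"
    then have "f u = f \<zero>\<^bsub>U\<^esub>" if "f \<in> module_hom R U (self_module R)" for f
      using that module_hom_zero[OF U mS that] by auto
    then have "bidual_map R U u = bidual_map R U \<zero>\<^bsub>U\<^esub>"
      unfolding bidual_map_def by (intro restrict_ext) (simp add: dual_module_def Hom_module_def)
    then show False using tl u unfolding torsionless_def by (auto dest: inj_onD)
  qed
  then show thesis using that by blast
qed

lemma torsionless_torsion_free:
  assumes R: "domain R" and U: "module R U" and tl: "torsionless R U"
    and a: "a \<in> carrier R" "a \<noteq> \<zero>\<^bsub>R\<^esub>" and u: "u \<in> carrier U" "a \<odot>\<^bsub>U\<^esub> u = \<zero>\<^bsub>U\<^esub>"
  shows "u = \<zero>\<^bsub>U\<^esub>"
proof (rule ccontr)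
  assume "u \<noteq> \<zero>\<^bsub>U\<^esub>"
  then obtain f where f: "f \<in> module_hom R U (self_module R)" "f u \<noteq> \<zero>\<^bsub>R\<^esub>"
    by (rule torsionless_separated[OF U tl u(1)])
  interpret domain R by fact
  have "a \<otimes>\<^bsub>R\<^esub> f u = f \<zero>\<^bsub>U\<^esub>"
    using module_homD(3)[OF f(1) a(1) u(1)] u(2) by simp
  also have "\<dots> = \<zero>\<^bsub>R\<^esub>"
    using module_hom_zero[OF U self_module_is_module[OF is_cring] f(1)] by simp
  finally show False using integral[of a "f u"] a f(2) module_homD(1)[OF f(1) u(1)] by simp
qed

lemma smult_left_cancel:
  assumes U: "module R U" and tf: "\<And>u. u \<in> carrier U \<Longrightarrow> a \<odot>\<^bsub>U\<^esub> u = \<zero>\<^bsub>U\<^esub> \<Longrightarrow> u = \<zero>\<^bsub>U\<^esub>"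
    and a: "a \<in> carrier R" and uv: "u \<in> carrier U" "v \<in> carrier U" "a \<odot>\<^bsub>U\<^esub> u = a \<odot>\<^bsub>U\<^esub> v"
  shows "u = v"
proof -
  interpret U: module R U by fact
  have "a \<odot>\<^bsub>U\<^esub> (u \<oplus>\<^bsub>U\<^esub> \<ominus>\<^bsub>U\<^esub> v) = \<zero>\<^bsub>U\<^esub>"
    using a uv by (simp add: U.smult_r_distr U.smult_r_minus U.r_neg)
  then have "u \<oplus>\<^bsub>U\<^esub> \<ominus>\<^bsub>U\<^esub> v = \<zero>\<^bsub>U\<^esub>" using tf uv by simp
  then show ?thesis using uv by (metis U.minus_equality U.minus_minus U.a_comm U.a_inv_closed)
qed

section \<open>Cyclic modules and their tensor products\<close>

lemma ideal_submodule_self: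
  assumes "cring R" "ideal I R"
  shows "submodule I R (self_module R)"
proof -
  interpret cring R by fact
  have "module R ((self_module R)\<lparr>carrier := I\<rparr>)"
    using ideal_module_is_module[OF assms] by (simp add: ideal_module_def)
  then show ?thesis
    using ideal.Icarr[OF assms(2)]
    by (intro module.module_incl_imp_submodule[OF self_module_is_module[OF assms(1)]]) auto
qed

text \<open>The map \<open>p\<close> presents \<open>N\<close> as \<open>R/yR\<close>. This is stated up to isomorphism, since the test modules have
  a prescribed element type.\<close>

definition cyclic_presentation ::
    "('a, 'r) ring_scheme \<Rightarrow> 'a \<Rightarrow> ('a, 'm) module \<Rightarrow> ('a \<Rightarrow> 'm) \<Rightarrow> bool" where
  "cyclic_presentation R y N p \<longleftrightarrow> module R N \<and> p \<in> module_hom R (self_module R) N \<and>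
     p ` carrier R = carrier N \<and> (\<forall>r\<in>carrier R. p r = \<zero>\<^bsub>N\<^esub> \<longleftrightarrow> r \<in> PIdl\<^bsub>R\<^esub> y)"

lemma cyclic_presentation_exists:
  fixes R :: "('a, 'r) ring_scheme" (structure)
  assumes R: "cring R" and y: "y \<in> carrier R"
  obtains N :: "'a fg_module" and p where "cyclic_presentation R y N p"
proof -
  interpret cring R by fact
  let ?Y = "PIdl y"
  let ?S = "self_module R"
  let ?Q = "quot_module R ?S ?Y"
  have mS: "module R ?S" by (rule self_module_is_module[OF R])
  have Y: "submodule ?Y R ?S" by (rule ideal_submodule_self[OF R cgenideal_ideal[OF y]])
  have mQ: "module R ?Q" by (rule quot_module_is_module[OF mS Y])
  let ?k = "\<lambda>C. (\<lambda>a (_::nat). a) ` C"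
  have k: "inj_on ?k (carrier ?Q)"
  proof (rule inj_onI)
    fix C D :: "'a set" assume "?k C = ?k D"
    then have "(\<lambda>g. g (0::nat)) ` ?k C = (\<lambda>g. g 0) ` ?k D" by simp
    then show "C = D" by (simp add: image_image)
  qed
  let ?N = "transport_module ?Q ?k"
  have mN: "module R ?N" by (rule transport_module_is_module[OF mQ k])
  note kh = transport_module_hom(1)[OF mQ k]
  let ?p = "?k \<circ> (\<lambda>r. ?Y +>\<^bsub>?S\<^esub> r)"
  have "?p \<in> module_hom R ?S ?N"
    by (rule module_hom_comp[OF quot_module_proj_hom[OF mS Y] kh])
  moreover have "?p ` carrier R = carrier ?N" by (auto simp: image_iff)
  moreover have "?p r = \<zero>\<^bsub>?N\<^esub> \<longleftrightarrow> r \<in> ?Y" if r: "r \<in> carrier R" for r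
  proof -
    have c: "?Y +>\<^bsub>?S\<^esub> r \<in> carrier ?Q" using r by simp
    have z: "?Y \<in> carrier ?Q" using module.axioms(2)[OF mQ] abelian_group.a_inv_closed
      by (metis abelian_group_def abelian_monoid.zero_closed quot_module_simps(2))
    have "?p r = \<zero>\<^bsub>?N\<^esub> \<longleftrightarrow> ?Y +>\<^bsub>?S\<^esub> r = ?Y"
      using inj_on_eq_iff[OF k c z] by simp
    then show ?thesis using quot_module_zero_iff[OF mS Y] r by simp
  qed
  ultimately show thesis using mN by (intro that[of ?N ?p]) (simp add: cyclic_presentation_def)
qed

context
  fixes R :: "('a, 'r) ring_scheme" (structure) and y :: 'a and N :: "('a, 'm) module" and p :: "'a \<Rightarrow> 'm"
  assumes R: "cring R" and y: "y \<in> carrier R" and pres: "cyclic_presentation R y N p"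
begin

interpretation R: cring R by (rule R)

lemma cyclic_module: "module R N"
  using pres by (simp add: cyclic_presentation_def)

interpretation N: module R N by (rule cyclic_module)

lemma cyclic_hom: "p \<in> module_hom R (self_module R) N"
  using pres by (simp add: cyclic_presentation_def)

lemmas cyclic_homD = module_homD[OF cyclic_hom, simplified]

lemma cyclic_zero_iff: "r \<in> carrier R \<Longrightarrow> p r = \<zero>\<^bsub>N\<^esub> \<longleftrightarrow> r \<in> PIdl y"
  using pres by (simp add: cyclic_presentation_def)

lemma cyclic_surj: "n \<in> carrier N \<Longrightarrow> \<exists>r\<in>carrier R. n = p r"
  using pres by (auto simp: cyclic_presentation_def)

lemma cyclic_smult_one: "r \<in> carrier R \<Longrightarrow> p r = r \<odot>\<^bsub>N\<^esub> p \<one>"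
  using cyclic_homD(3)[of r "\<one>"] by simp

lemma cyclic_fin_gen: "fin_gen_module R N"
  unfolding fin_gen_module_def
proof (intro conjI exI[of _ "{p \<one>}"])
  show c: "{p \<one>} \<subseteq> carrier N" using cyclic_homD(1) by simp
  have "carrier N \<subseteq> H" if "submodule H R N" "{p \<one>} \<subseteq> H" for H
  proof
    fix n assume "n \<in> carrier N"
    then obtain r where r: "r \<in> carrier R" "n = p r" using cyclic_surj by blast
    then show "n \<in> H"
      using submodule.smult_closed[OF that(1) r(1), of "p \<one>"] that(2) cyclic_smult_one[OF r(1)] by simp
  qed
  then have "carrier N \<subseteq> submodule_span R N {p \<one>}" by (auto simp: submodule_span_def)
  then show "submodule_span R N {p \<one>} = carrier N"
    using submodule_span_minimal[OF N.carrier_is_submodule c] by blast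
qed (simp_all add: cyclic_module)

lemma cyclic_tensor_element:
  assumes U: "module R U" and t: "t \<in> carrier (tensor_module R N U)"
  shows "\<exists>u\<in>carrier U. t = pure_tensor R N U (p \<one>) u"
proof -
  interpret T: tensor R N U by (rule tensor.intro[OF cyclic_module U])
  let ?q = "pure_tensor R N U (p \<one>)"
  have q: "?q \<in> module_hom R U T.T"
    using cyclic_homD(1) by (intro module_homI) (simp_all add: T.pure_bilinear)
  have "submodule (?q ` carrier U) R T.T"
    by (rule image_submodule[OF U T.tensor_is_module q T.N.carrier_is_submodule])
  moreover have "pure_tensor R N U n u \<in> ?q ` carrier U" if "n \<in> carrier N" "u \<in> carrier U" for n u
  proof -
    obtain r where r: "r \<in> carrier R" "n = p r" using cyclic_surj \<open>n \<in> carrier N\<close> by blast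
    have "pure_tensor R N U n u = r \<odot>\<^bsub>T.T\<^esub> ?q u"
      unfolding r(2) cyclic_smult_one[OF r(1)]
      using r(1) that(2) cyclic_homD(1) by (simp add: T.pure_bilinear)
    also have "\<dots> = ?q (r \<odot>\<^bsub>U\<^esub> u)"
      using r(1) that(2) cyclic_homD(1) by (simp add: T.pure_bilinear)
    finally show ?thesis using r(1) that(2) by simp
  qed
  ultimately have "carrier T.T \<subseteq> ?q ` carrier U" by (rule T.tensor_spanned)
  with t show ?thesis by blast
qed

text \<open>With the preceding lemma this identifies \<open>N \<otimes> U\<close> with \<open>U/yU\<close>, the class of \<open>u\<close> corresponding to
  \<open>p 1 \<otimes> u\<close>.\<close>

lemma cyclic_tensor_zero_iff:
  assumes U: "module R U" and u: "u \<in> carrier U"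
  shows "pure_tensor R N U (p \<one>) u = \<zero>\<^bsub>tensor_module R N U\<^esub> \<longleftrightarrow> (\<exists>v\<in>carrier U. u = y \<odot>\<^bsub>U\<^esub> v)"
proof -
  interpret T: tensor R N U by (rule tensor.intro[OF cyclic_module U])
  interpret TM: module R T.T by (rule T.tensor_is_module)
  let ?q = "pure_tensor R N U (p \<one>)"
  have "p y = \<zero>\<^bsub>N\<^esub>" using cyclic_zero_iff[OF y] R.cgenideal_self[OF y] by simp
  then have yy: "y \<odot>\<^bsub>N\<^esub> p \<one> = \<zero>\<^bsub>N\<^esub>" by (simp only: cyclic_smult_one[OF y])
  have ymul: "(\<lambda>v. y \<odot>\<^bsub>U\<^esub> v) \<in> module_hom R U U"
    using y by (intro module_homI)
      (auto simp: T.N.smult_r_distr R.m_comm simp flip: T.N.smult_assoc1)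
  define K where "K = (\<lambda>v. y \<odot>\<^bsub>U\<^esub> v) ` carrier U"
  have K: "submodule K R U"
    unfolding K_def by (rule image_submodule[OF U U ymul T.N.carrier_is_submodule])
  let ?W = "quot_module R U K"
  have mW: "module R ?W" by (rule quot_module_is_module[OF U K])
  note ops = quot_module_ops[OF U K]
  \<comment> \<open>the bilinear map \<open>(p r, v) \<mapsto> r v\<close> modulo \<open>yU\<close>\<close>
  define \<beta> where "\<beta> n v = K +>\<^bsub>U\<^esub> ((SOME r. r \<in> carrier R \<and> p r = n) \<odot>\<^bsub>U\<^esub> v)" for n v
  have \<beta>: "\<beta> (p r) v = K +>\<^bsub>U\<^esub> (r \<odot>\<^bsub>U\<^esub> v)" if r: "r \<in> carrier R" and v: "v \<in> carrier U" for r v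
  proof -
    define s where "s = (SOME s. s \<in> carrier R \<and> p s = p r)"
    have s: "s \<in> carrier R" "p s = p r"
      using someI[of "\<lambda>s. s \<in> carrier R \<and> p s = p r" r] r by (auto simp: s_def)
    have "p (\<ominus> r) = \<ominus>\<^bsub>N\<^esub> p r"
      using cyclic_homD(3)[of "\<ominus> \<one>" r] cyclic_homD(1)[OF r] r
      by (simp add: R.l_minus N.smult_l_minus)
    then have "p (s \<ominus> r) = p s \<oplus>\<^bsub>N\<^esub> \<ominus>\<^bsub>N\<^esub> p r"
      using s r by (simp add: a_minus_def cyclic_homD)
    also have "\<dots> = \<zero>\<^bsub>N\<^esub>" using s(2) cyclic_homD(1)[OF r] by (simp add: N.r_neg)
    finally have "s \<ominus> r \<in> PIdl y" using cyclic_zero_iff[of "s \<ominus> r"] s r by simp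
    then obtain c where c: "c \<in> carrier R" "s \<ominus> r = c \<otimes> y" by (auto simp: cgenideal_def)
    have "(s \<odot>\<^bsub>U\<^esub> v) \<ominus>\<^bsub>U\<^esub> (r \<odot>\<^bsub>U\<^esub> v) = (s \<ominus> r) \<odot>\<^bsub>U\<^esub> v"
      using s r v by (simp add: a_minus_def T.N.smult_l_distr T.N.smult_l_minus)
    also have "\<dots> = y \<odot>\<^bsub>U\<^esub> (c \<odot>\<^bsub>U\<^esub> v)"
      using c y v by (simp add: R.m_comm flip: T.N.smult_assoc1)
    finally have "(s \<odot>\<^bsub>U\<^esub> v) \<ominus>\<^bsub>U\<^esub> (r \<odot>\<^bsub>U\<^esub> v) \<in> K" using c v by (auto simp: K_def)
    then show ?thesis
      unfolding \<beta>_def s_def[symmetric] using s r v by (intro quot_module_eqI[OF U K]) auto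
  qed
  obtain h where h: "h \<in> module_hom R T.T ?W"
    "\<And>n v. n \<in> carrier N \<Longrightarrow> v \<in> carrier U \<Longrightarrow> h (pure_tensor R N U n v) = \<beta> n v"
  proof (rule T.tensor_lift[OF mW, of \<beta>])
    fix n v assume nv: "n \<in> carrier N" "v \<in> carrier U"
    obtain r where r: "r \<in> carrier R" "n = p r" using cyclic_surj nv(1) by blast
    show "\<beta> n v \<in> carrier ?W" using r nv by (simp add: \<beta>)
    show "\<beta> (a \<odot>\<^bsub>N\<^esub> n) v = a \<odot>\<^bsub>?W\<^esub> \<beta> n v" if a: "a \<in> carrier R" for a
    proof -
      have "a \<odot>\<^bsub>N\<^esub> n = p (a \<otimes> r)" using r a by (simp add: cyclic_homD)
      then show ?thesis using r a nv by (simp add: \<beta> ops T.N.smult_assoc1)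
    qed
    show "\<beta> n (a \<odot>\<^bsub>U\<^esub> v) = a \<odot>\<^bsub>?W\<^esub> \<beta> n v" if a: "a \<in> carrier R" for a
      using r a nv by (simp add: \<beta> ops R.m_comm flip: T.N.smult_assoc1)
    show "\<beta> n (v \<oplus>\<^bsub>U\<^esub> v') = \<beta> n v \<oplus>\<^bsub>?W\<^esub> \<beta> n v'" if "v' \<in> carrier U" for v'
      using r that nv by (simp add: \<beta> ops T.N.smult_r_distr)
    show "\<beta> (n \<oplus>\<^bsub>N\<^esub> n') v = \<beta> n v \<oplus>\<^bsub>?W\<^esub> \<beta> n' v" if n': "n' \<in> carrier N" for n'
    proof -
      obtain r' where r': "r' \<in> carrier R" "n' = p r'" using cyclic_surj n' by blast
      have "n \<oplus>\<^bsub>N\<^esub> n' = p (r \<oplus> r')" using r r' by (simp add: cyclic_homD)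
      then show ?thesis using r r' nv by (simp add: \<beta> ops T.N.smult_l_distr)
    qed
  qed blast
  have hq: "h (?q u) = K +>\<^bsub>U\<^esub> u" using h(2)[of "p \<one>" u] \<beta>[of "\<one>" u] u cyclic_homD(1) by simp
  show ?thesis
  proof
    assume "?q u = \<zero>\<^bsub>T.T\<^esub>"
    then have "K +>\<^bsub>U\<^esub> u = K" using hq module_hom_zero[OF T.tensor_is_module mW h(1)] by simp
    then show "\<exists>v\<in>carrier U. u = y \<odot>\<^bsub>U\<^esub> v"
      using quot_module_zero_iff[OF U K u] by (auto simp: K_def)
  next
    assume "\<exists>v\<in>carrier U. u = y \<odot>\<^bsub>U\<^esub> v"
    then obtain v where v: "v \<in> carrier U" "u = y \<odot>\<^bsub>U\<^esub> v" by blast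
    have "?q u = pure_tensor R N U (y \<odot>\<^bsub>N\<^esub> p \<one>) v"
      using v y cyclic_homD(1) by (simp add: T.pure_bilinear)
    also have "\<dots> = pure_tensor R N U (\<zero> \<odot>\<^bsub>N\<^esub> \<zero>\<^bsub>N\<^esub>) v"
      using yy by simp
    also have "\<dots> = \<zero>\<^bsub>T.T\<^esub>"
      by (subst T.pure_bilinear(3)) (use v in simp_all)
    finally show "?q u = \<zero>\<^bsub>T.T\<^esub>" .
  qed
qed

end

section \<open>Bounds for the depth\<close>

text \<open>If \<open>I r \<subseteq> yR\<close>, then \<open>a \<mapsto> a r / y\<close> is a homomorphism from \<open>I\<close> to \<open>R\<close>, hence multiplication by
  some \<open>s\<close>, so that \<open>r = s y\<close>. The case \<open>y = 0\<close> is that of \<open>R\<close> itself.\<close>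

lemma cyclic_quotient_depth_pos:
  fixes R (structure)
  assumes dom: "domain R" and noeth: "noetherian_ring R" and I: "ideal I R" "I \<noteq> {\<zero>\<^bsub>R\<^esub>}"
    and hm: "homs_are_multiplications R I (self_module R)"
    and y: "y \<in> I" and pres: "cyclic_presentation R y N p"
  shows "depth R I N \<ge> 1"
proof -
  interpret domain R by fact
  have Ic: "a \<in> carrier R" if "a \<in> I" for a using ideal.Icarr[OF I(1) that] .
  note yc = Ic[OF y]
  note mN = cyclic_module[OF is_cring yc pres] and pD = cyclic_homD[OF is_cring yc pres]
    and p0 = cyclic_zero_iff[OF is_cring yc pres]
  have I0: "\<zero> \<in> I" using I(1) by (simp add: additive_subgroup.zero_closed ideal.axioms(1))
  obtain a0 where a0: "a0 \<in> I" "a0 \<noteq> \<zero>" using I(2) I0 by blast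
  have "socle_free R I N"
    unfolding socle_free_def
  proof (intro ballI impI)
    fix n assume n: "n \<in> carrier N" "\<forall>a\<in>I. a \<odot>\<^bsub>N\<^esub> n = \<zero>\<^bsub>N\<^esub>"
    obtain r where r: "r \<in> carrier R" "n = p r" using cyclic_surj[OF is_cring yc pres n(1)] by blast
    have "\<exists>c\<in>carrier R. a \<otimes> r = c \<otimes> y" if a: "a \<in> I" for a
    proof -
      have "p (a \<otimes> r) = \<zero>\<^bsub>N\<^esub>" using pD(3)[OF Ic[OF a] r(1)] n(2) a r(2) by simp
      then have "a \<otimes> r \<in> PIdl y" using p0[of "a \<otimes> r"] Ic[OF a] r(1) by simp
      then show ?thesis by (auto simp: cgenideal_def)
    qed
    then obtain f where f: "\<And>a. a \<in> I \<Longrightarrow> f a \<in> carrier R" "\<And>a. a \<in> I \<Longrightarrow> a \<otimes> r = f a \<otimes> y" by metis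
    have "r \<in> PIdl y"
    proof (cases "y = \<zero>")
      case True
      then have "a0 \<otimes> r = \<zero>" using f[OF a0(1)] by simp
      then have "r = \<zero>" using integral[of a0 r] a0 Ic r by auto
      then show ?thesis using cgenideal_ideal[OF yc] by (simp add: additive_subgroup.zero_closed ideal.axioms(1))
    next
      case False
      have cancel: "u = v" if "u \<otimes> y = v \<otimes> y" "u \<in> carrier R" "v \<in> carrier R" for u v
        using m_rcancel[OF False yc] that by simp
      have Iadd: "a \<oplus> b \<in> I" if "a \<in> I" "b \<in> I" for a b
        using that I(1) by (simp add: additive_subgroup.a_closed ideal.axioms(1))
      have Ism: "c \<otimes> a \<in> I" if "a \<in> I" "c \<in> carrier R" for a c using ideal.I_l_closed[OF I(1) that] .
      have "f \<in> module_hom R (ideal_module R I) (self_module R)"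
      proof (rule module_homI; simp add: f(1))
        show "f (a \<oplus> b) = f a \<oplus> f b" if "a \<in> I" "b \<in> I" for a b
          by (rule cancel) (use that f Ic yc r Iadd in \<open>simp_all add: l_distr flip: f(2)\<close>)
        show "f (c \<otimes> a) = c \<otimes> f a" if "c \<in> carrier R" "a \<in> I" for c a
          by (rule cancel) (use that f Ic yc r Ism in \<open>simp_all add: m_assoc flip: f(2)\<close>)
      qed
      then obtain s where s: "s \<in> carrier R" "\<And>a. a \<in> I \<Longrightarrow> f a = a \<otimes> s"
        using hm unfolding homs_are_multiplications_def by fastforce
      have "a0 \<otimes> r = a0 \<otimes> (s \<otimes> y)"
        using f(2)[OF a0(1)] s a0 Ic yc by (simp add: m_assoc)
      then have "r = s \<otimes> y" using m_lcancel[OF a0(2) Ic[OF a0(1)]] r s yc by simp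
      then show ?thesis using s(1) by (auto simp: cgenideal_def)
    qed
    then show "n = \<zero>\<^bsub>N\<^esub>" using p0 r by simp
  qed
  then show ?thesis using depth_ge_1_iff[OF noeth mN I(1)] by simp
qed

text \<open>The inclusion of \<open>I\<close> in itself is not multiplication by an element of \<open>I\<close>.\<close>

lemma depth_maximal_ideal:
  fixes R (structure)
  assumes dom: "domain R" and noeth: "noetherian_ring R" and I: "ideal I R" "I \<noteq> {\<zero>\<^bsub>R\<^esub>}" "\<one>\<^bsub>R\<^esub> \<notin> I"
  shows "\<not> depth R I (ideal_module R I) \<ge> 2"
proof
  interpret domain R by fact
  have Ic: "a \<in> carrier R" if "a \<in> I" for a using ideal.Icarr[OF I(1) that] .
  have I0: "\<zero> \<in> I" using I(1) by (simp add: additive_subgroup.zero_closed ideal.axioms(1))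
  obtain a where a: "a \<in> I" "a \<noteq> \<zero>" using I(2) I0 by blast
  assume "depth R I (ideal_module R I) \<ge> 2"
  then have "homs_are_multiplications R I (ideal_module R I)"
    using depth_ge_2_iff[OF noeth ideal_module_is_module[OF is_cring I(1)] I(1)] by simp
  moreover have "(\<lambda>x. x) \<in> module_hom R (ideal_module R I) (ideal_module R I)"
    by (rule module_homI) auto
  ultimately obtain x where x: "x \<in> I" "\<And>a. a \<in> I \<Longrightarrow> a = a \<otimes> x"
    unfolding homs_are_multiplications_def by fastforce
  have "a \<otimes> \<one> = a \<otimes> x" using x(2)[OF a(1)] Ic[OF a(1)] by simp
  then have "x = \<one>" using m_lcancel[OF a(2) Ic[OF a(1)], of \<one> x] Ic[OF x(1)] by simp
  then show False using x(1) I(3) by simp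
qed

text \<open>The upper bound for the depth of \<open>\<mm> \<otimes> U\<close>, witnessed by a homomorphism \<open>a \<mapsto> a \<otimes> u\<close>.\<close>

lemma depth_tensor_maximal_ideal:
  fixes R (structure)
  assumes dom: "domain R" and noeth: "noetherian_ring R" and loc: "local_ring R \<mm>" and nz: "\<mm> \<noteq> {\<zero>\<^bsub>R\<^esub>}"
    and U: "module R U" "nonzero_module U" "torsionless R U"
  shows "\<not> depth R \<mm> (tensor_module R (ideal_module R \<mm>) U) \<ge> 2"
proof
  interpret domain R by fact
  interpret U: module R U by (rule U(1))
  have mm: "ideal \<mm> R" using loc by (simp add: local_ring_def maximalideal.axioms(1))
  have mmc: "a \<in> carrier R" if "a \<in> \<mm>" for a using ideal.Icarr[OF mm that] .
  have mm0: "\<zero> \<in> \<mm>" using mm by (simp add: additive_subgroup.zero_closed ideal.axioms(1))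
  obtain a0 where a0: "a0 \<in> \<mm>" "a0 \<noteq> \<zero>" using nz mm0 by blast
  interpret T: tensor R "ideal_module R \<mm>" U
    by (rule tensor.intro[OF ideal_module_is_module[OF is_cring mm] U(1)])
  obtain u0 where u0: "u0 \<in> carrier U" "u0 \<noteq> \<zero>\<^bsub>U\<^esub>"
    using U(2) U.zero_closed by (auto simp: nonzero_module_def)
  obtain f where f: "f \<in> module_hom R U (self_module R)" "f u0 \<noteq> \<zero>"
    by (rule torsionless_separated[OF U(1,3) u0])
  note f' = module_homD[OF f(1), simplified]
  note mS = self_module_is_module[OF is_cring]
  have sub: "submodule (f ` carrier U) R (self_module R)"
    by (rule image_submodule[OF U(1) mS f(1) U.carrier_is_submodule])
  have I: "ideal (f ` carrier U) R"
  proof (rule idealI)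
    show "subgroup (f ` carrier U) (add_monoid R)"
      using submodule.axioms(1)[OF sub] by (simp add: self_module_def subgroup_def m_inv_def)
    show "x \<otimes> a \<in> f ` carrier U" if "a \<in> f ` carrier U" "x \<in> carrier R" for a x
      using submodule.smult_closed[OF sub that(2,1)] by simp
    then show "a \<otimes> x \<in> f ` carrier U" if "a \<in> f ` carrier U" "x \<in> carrier R" for a x
      using that f'(1) by (auto simp: m_comm)
  qed (rule ring_axioms)
  have "f ` carrier U \<noteq> {\<zero>}" using f(2) u0 by auto
  then obtain L where L: "ideal L R" "L \<subset> f ` carrier U"
    "\<And>a x. a \<in> \<mm> \<Longrightarrow> x \<in> f ` carrier U \<Longrightarrow> a \<otimes> x \<in> L"
    by (rule nakayama_subideal[OF loc noeth I]) metis
  then obtain u where u: "u \<in> carrier U" "f u \<notin> L" by blast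
  have Lc: "x \<in> carrier R" if "x \<in> L" for x using ideal.Icarr[OF L(1) that] .
  assume "depth R \<mm> T.T \<ge> 2"
  then have hm: "homs_are_multiplications R \<mm> T.T"
    using depth_ge_2_iff[OF noeth T.tensor_is_module mm] by simp
  have "(\<lambda>a. pure_tensor R (ideal_module R \<mm>) U a u) \<in> module_hom R (ideal_module R \<mm>) T.T"
    using u(1) T.pure_bilinear T.pure_closed by (intro module_homI) simp_all
  then obtain t where t: "t \<in> carrier T.T"
    "\<And>a. a \<in> \<mm> \<Longrightarrow> pure_tensor R (ideal_module R \<mm>) U a u = a \<odot>\<^bsub>T.T\<^esub> t"
    using hm unfolding homs_are_multiplications_def by fastforce
  obtain g where g: "g \<in> module_hom R T.T (ideal_module R L)"
    "\<And>a v. a \<in> carrier (ideal_module R \<mm>) \<Longrightarrow> v \<in> carrier U \<Longrightarrow> g (pure_tensor R (ideal_module R \<mm>) U a v) = a \<otimes> f v"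
  proof (rule T.tensor_lift[OF ideal_module_is_module[OF is_cring L(1)], of "\<lambda>a v. a \<otimes> f v"])
    show "a \<otimes> f v \<in> carrier (ideal_module R L)" if "a \<in> carrier (ideal_module R \<mm>)" "v \<in> carrier U" for a v
      using L(3) that by simp
  qed (use f' mmc in \<open>auto simp: l_distr r_distr m_assoc m_lcomm\<close>)
  have gt: "g t \<in> L" using module_homD(1)[OF g(1) t(1)] by simp
  have "a0 \<otimes> f u = g (a0 \<odot>\<^bsub>T.T\<^esub> t)" using g(2)[of a0 u] t(2)[OF a0(1)] a0 u by simp
  also have "\<dots> = a0 \<otimes> g t" using module_homD(3)[OF g(1) mmc[OF a0(1)] t(1)] by simp
  finally have "f u = g t" using m_lcancel[OF a0(2) mmc[OF a0(1)]] f'(1)[OF u(1)] Lc[OF gt] by simp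
  then show False using u gt by simp
qed

lemma no_equidepth_torsionless_module:
  fixes R :: "('a, 'r) ring_scheme" (structure) and U :: "('a, 'u) module"
  assumes dom: "domain R" and noeth: "noetherian_ring R" and loc: "local_ring R \<mm>"
    and depth: "depth R \<mm> (self_module R) > 1"
    and U: "module R U" "nonzero_module U" "torsionless R U"
    and eq: "\<And>N :: 'a fg_module. fin_gen_module R N \<Longrightarrow> nonzero_module N \<Longrightarrow>
      depth R \<mm> (ideal_module R \<mm>) \<le> depth R \<mm> N \<Longrightarrow>
      depth R \<mm> (tensor_module R (ideal_module R \<mm>) U) = depth R \<mm> (tensor_module R N U)"
  shows False
proof -
  interpret domain R by fact
  interpret U: module R U by (rule U(1))
  have max: "maximalideal \<mm> R" using loc by (simp add: local_ring_def)
  then have mm: "ideal \<mm> R" by (rule maximalideal.axioms(1))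
  have mmc: "a \<in> carrier R" if "a \<in> \<mm>" for a using ideal.Icarr[OF mm that] .
  have mm0: "\<zero> \<in> \<mm>" using mm by (simp add: additive_subgroup.zero_closed ideal.axioms(1))
  have mm1: "\<one> \<notin> \<mm>" using maximalideal.I_notcarr[OF max] ideal.one_imp_carrier[OF mm] by auto
  note mS = self_module_is_module[OF is_cring]
  have eSuc_1: "eSuc 1 = (2::enat)"
    by (simp add: one_enat_def eSuc_enat numeral_eq_enat)
  have "eSuc 1 \<le> depth R \<mm> (self_module R)" using depth by (rule ileI1)
  then have "2 \<le> depth R \<mm> (self_module R)" by (simp add: eSuc_1)
  then have sfR: "socle_free R \<mm> (self_module R)" and hmR: "homs_are_multiplications R \<mm> (self_module R)"
    using depth_ge_2_iff[OF noeth mS mm] by simp_all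
  have nz: "\<mm> \<noteq> {\<zero>}"
  proof
    assume "\<mm> = {\<zero>}"
    then have "\<one> = \<zero>" using bspec[OF sfR[unfolded socle_free_def], of \<one>] by simp
    then show False by simp
  qed
  then obtain y where y: "y \<in> \<mm>" "y \<noteq> \<zero>" using mm0 by blast
  note yc = mmc[OF y(1)]
  have depth_mm: "depth R \<mm> (ideal_module R \<mm>) \<le> 1"
  proof (rule ccontr)
    assume "\<not> ?thesis"
    then have "eSuc 1 \<le> depth R \<mm> (ideal_module R \<mm>)" by (intro ileI1) simp
    then show False
      using depth_maximal_ideal[OF dom noeth mm nz mm1]
      by (simp add: eSuc_1)
  qed
  let ?d = "depth R \<mm> (tensor_module R (ideal_module R \<mm>) U)"
  have d2: "\<not> 2 \<le> ?d" by (rule depth_tensor_maximal_ideal[OF dom noeth loc nz U])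
  have d_cyclic: "?d = depth R \<mm> (tensor_module R N U)"
    if c: "c \<in> \<mm>" and pres: "cyclic_presentation R c N p" for c and N :: "'a fg_module" and p
  proof (rule eq)
    note cc = mmc[OF c]
    show "fin_gen_module R N" by (rule cyclic_fin_gen[OF is_cring cc pres])
    have "PIdl c \<subseteq> \<mm>" by (rule cgenideal_minimal[OF mm c])
    then have "p \<one> \<noteq> \<zero>\<^bsub>N\<^esub>" using cyclic_zero_iff[OF is_cring cc pres] mm1 by auto
    moreover have "p \<one> \<in> carrier N" using cyclic_homD(1)[OF is_cring cc pres] by simp
    ultimately show "nonzero_module N" by (auto simp: nonzero_module_def)
    have "1 \<le> depth R \<mm> N" by (rule cyclic_quotient_depth_pos[OF dom noeth mm nz hmR c pres])
    then show "depth R \<mm> (ideal_module R \<mm>) \<le> depth R \<mm> N" using depth_mm by (rule order_trans[rotated])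
  qed
  obtain N0 :: "'a fg_module" and p0 where pres0: "cyclic_presentation R \<zero> N0 p0"
    by (rule cyclic_presentation_exists[OF is_cring zero_closed])
  obtain Ny :: "'a fg_module" and py where presy: "cyclic_presentation R y Ny py"
    by (rule cyclic_presentation_exists[OF is_cring yc])
  interpret T0: tensor R N0 U by (rule tensor.intro[OF cyclic_module[OF is_cring zero_closed pres0] U(1)])
  interpret Ty: tensor R Ny U by (rule tensor.intro[OF cyclic_module[OF is_cring yc presy] U(1)])
  interpret T0M: module R T0.T by (rule T0.tensor_is_module)
  interpret TyM: module R Ty.T by (rule Ty.tensor_is_module)
  \<comment> \<open>\<open>q\<close> is an isomorphism from \<open>U\<close> to \<open>R \<otimes> U\<close>, and \<open>r\<close> induces one from \<open>U/yU\<close> to \<open>R/yR \<otimes> U\<close>\<close>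
  define q where "q = pure_tensor R N0 U (p0 \<one>)"
  define r where "r = pure_tensor R Ny U (py \<one>)"
  have q: "q \<in> module_hom R U T0.T"
    unfolding q_def using cyclic_homD(1)[OF is_cring zero_closed pres0]
    by (intro module_homI) (simp_all add: T0.pure_bilinear)
  have r: "r \<in> module_hom R U Ty.T"
    unfolding r_def using cyclic_homD(1)[OF is_cring yc presy]
    by (intro module_homI) (simp_all add: Ty.pure_bilinear)
  note q' = module_homD[OF q] and r' = module_homD[OF r]
  have q_surj: "\<exists>u\<in>carrier U. t = q u" if "t \<in> carrier T0.T" for t
    unfolding q_def by (rule cyclic_tensor_element[OF is_cring zero_closed pres0 U(1) that])
  have q_zero: "u = \<zero>\<^bsub>U\<^esub>" if "u \<in> carrier U" "q u = \<zero>\<^bsub>T0.T\<^esub>" for u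
    using cyclic_tensor_zero_iff[OF is_cring zero_closed pres0 U(1) that(1)] that(2)
    by (auto simp: q_def)
  have q_inj: "inj_on q (carrier U)"
    using module_hom_inj_iff[OF U(1) T0.tensor_is_module q] q_zero by blast
  have r_zero: "r u = \<zero>\<^bsub>Ty.T\<^esub> \<longleftrightarrow> (\<exists>v\<in>carrier U. u = y \<odot>\<^bsub>U\<^esub> v)" if "u \<in> carrier U" for u
    unfolding r_def by (rule cyclic_tensor_zero_iff[OF is_cring yc presy U(1) that])
  have tf: "u = \<zero>\<^bsub>U\<^esub>" if "u \<in> carrier U" "y \<odot>\<^bsub>U\<^esub> u = \<zero>\<^bsub>U\<^esub>" for u
    using torsionless_torsion_free[OF dom U(1,3) yc y(2) that] .
  have sf0: "socle_free R \<mm> T0.T"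
    unfolding socle_free_def
  proof (intro ballI impI)
    fix t assume t: "t \<in> carrier T0.T" "\<forall>a\<in>\<mm>. a \<odot>\<^bsub>T0.T\<^esub> t = \<zero>\<^bsub>T0.T\<^esub>"
    obtain u where u: "u \<in> carrier U" "t = q u" using q_surj[OF t(1)] by blast
    have "q (y \<odot>\<^bsub>U\<^esub> u) = \<zero>\<^bsub>T0.T\<^esub>" using q'(3)[OF yc u(1)] t(2) y(1) u(2) by simp
    then have "u = \<zero>\<^bsub>U\<^esub>" by (intro tf[OF u(1)] q_zero U.smult_closed yc u(1))
    then show "t = \<zero>\<^bsub>T0.T\<^esub>"
      using u(2) module_hom_zero[OF U(1) T0.tensor_is_module q] by simp
  qed
  then have "1 \<le> depth R \<mm> T0.T" using depth_ge_1_iff[OF noeth T0.tensor_is_module mm] by simp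
  then have "1 \<le> depth R \<mm> Ty.T" using d_cyclic[OF mm0 pres0] d_cyclic[OF y(1) presy] by simp
  then have sfy: "socle_free R \<mm> Ty.T" using depth_ge_1_iff[OF noeth Ty.tensor_is_module mm] by simp
  have "homs_are_multiplications R \<mm> T0.T"
    unfolding homs_are_multiplications_def
  proof
    fix \<phi> assume \<phi>: "\<phi> \<in> module_hom R (ideal_module R \<mm>) T0.T"
    note \<phi>' = module_homD[OF \<phi>, simplified]
    have "\<exists>u\<in>carrier U. \<phi> a = q u" if "a \<in> \<mm>" for a using q_surj \<phi>'(1)[OF that] by blast
    then obtain \<psi> where \<psi>: "\<And>a. a \<in> \<mm> \<Longrightarrow> \<psi> a \<in> carrier U" "\<And>a. a \<in> \<mm> \<Longrightarrow> \<phi> a = q (\<psi> a)"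
      by metis
    have sym: "a \<odot>\<^bsub>U\<^esub> \<psi> y = y \<odot>\<^bsub>U\<^esub> \<psi> a" if a: "a \<in> \<mm>" for a
    proof (rule inj_onD[OF q_inj])
      have "q (a \<odot>\<^bsub>U\<^esub> \<psi> y) = \<phi> (a \<otimes> y)"
        using \<phi>'(3)[OF mmc[OF a] y(1)] q'(3)[OF mmc[OF a] \<psi>(1)[OF y(1)]] \<psi>(2)[OF y(1)] by simp
      also have "\<dots> = \<phi> (y \<otimes> a)" using mmc[OF a] yc by (simp add: m_comm)
      also have "\<dots> = q (y \<odot>\<^bsub>U\<^esub> \<psi> a)"
        using \<phi>'(3)[OF yc a] q'(3)[OF yc \<psi>(1)[OF a]] \<psi>(2)[OF a] by simp
      finally show "q (a \<odot>\<^bsub>U\<^esub> \<psi> y) = q (y \<odot>\<^bsub>U\<^esub> \<psi> a)" .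
    qed (use mmc[OF a] yc \<psi>(1) a y(1) in auto)
    have "a \<odot>\<^bsub>Ty.T\<^esub> r (\<psi> y) = \<zero>\<^bsub>Ty.T\<^esub>" if a: "a \<in> \<mm>" for a
    proof -
      have "a \<odot>\<^bsub>Ty.T\<^esub> r (\<psi> y) = r (y \<odot>\<^bsub>U\<^esub> \<psi> a)"
        using r'(3)[OF mmc[OF a] \<psi>(1)[OF y(1)]] sym[OF a] by simp
      also have "\<dots> = \<zero>\<^bsub>Ty.T\<^esub>" using r_zero[of "y \<odot>\<^bsub>U\<^esub> \<psi> a"] yc \<psi>(1)[OF a] by auto
      finally show ?thesis .
    qed
    then have "r (\<psi> y) = \<zero>\<^bsub>Ty.T\<^esub>"
      using sfy r'(1)[OF \<psi>(1)[OF y(1)]] by (simp add: socle_free_def)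
    then obtain v where v: "v \<in> carrier U" "\<psi> y = y \<odot>\<^bsub>U\<^esub> v"
      using r_zero[OF \<psi>(1)[OF y(1)]] by blast
    have "\<phi> a = a \<odot>\<^bsub>T0.T\<^esub> q v" if a: "a \<in> \<mm>" for a
    proof -
      have eq: "y \<odot>\<^bsub>U\<^esub> \<psi> a = y \<odot>\<^bsub>U\<^esub> (a \<odot>\<^bsub>U\<^esub> v)"
        using sym[OF a] v mmc[OF a] yc by (simp add: m_comm flip: U.smult_assoc1)
      have "\<psi> a = a \<odot>\<^bsub>U\<^esub> v"
        by (rule smult_left_cancel[OF U(1) _ yc \<psi>(1)[OF a] U.smult_closed[OF mmc[OF a] v(1)] eq])
          (rule tf)
      then show ?thesis using \<psi>(2)[OF a] q'(3)[OF mmc[OF a] v(1)] by simp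
    qed
    then show "\<exists>t\<in>carrier T0.T. \<forall>a\<in>\<mm>. \<phi> a = a \<odot>\<^bsub>T0.T\<^esub> t" using q'(1)[OF v(1)] by blast
  qed
  then have "2 \<le> depth R \<mm> T0.T"
    using sf0 depth_ge_2_iff[OF noeth T0.tensor_is_module mm] by simp
  then show False using d2 d_cyclic[OF mm0 pres0] by simp
qed

theorem corollary5p3:
  fixes R :: "('a, 'r) ring_scheme" and \<mm> :: "'a set"
  assumes "domain R" and "noetherian_ring R" and "local_ring R \<mm>"
    and "depth R \<mm> (self_module R) > 1"
  shows "\<not> (\<exists>U :: ('a, 'u) module. module R U \<and> nonzero_module U \<and> torsionless R U \<and>
    (\<forall>N :: 'a fg_module. fin_gen_module R N \<and> nonzero_module N \<and>
        depth R \<mm> (ideal_module R \<mm>) \<le> depth R \<mm> N \<longrightarrow>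
      depth R \<mm> (tensor_module R (ideal_module R \<mm>) U) = depth R \<mm> (tensor_module R N U)))"
  using no_equidepth_torsionless_module[OF assms] by blast

end
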